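(* Let $X$ be a separable Banach space, let $\gamma$ be a nondegenerate centered Gaussian probability measure on the Borel $\sigma$-algebra of $X$, and let $E\subset X$ be a Borel set of finite perimeter in $(X,\gamma)$. Write $D_\gamma\chi_E=\nu_E|D_\gamma\chi_E|$ for the polar decomposition of the $H$-valued measure $D_\gamma\chi_E$, where $H$ is the Cameron-Martin space of $(X,\gamma)$ and $|\nu_E|_H=1$ holds $|D_\gamma\chi_E|$-a.e. For $|D_\gamma\chi_E|$-a.e. $x$, let $S(x)=S_{\nu_E(x)}$ be the halfspace with inner normal $\nu_E(x)$. Then $$ \lim_{t\downarrow 0}\int_X\int_X\left|\chi_E\bigl(e^{-t}x+\sqrt{1-e^{-2t}}\,y\bigr)-\chi_{S(x)}(y)\right|\,d\gamma(y)\,d|D_\gamma\chi_E|(x)=0. $$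
   Context: Setting: $(X,\|\cdot\|)$ is a separable (possibly infinite-dimensional) Banach space and $\gamma$ is a Gaussian probability measure on its Borel $\sigma$-algebra. It is nondegenerate (every closed proper subspace of $X$ is $\gamma$-negligible) and centered ($\int_X x\,d\gamma=0$). Cameron-Martin space: $H:=\{\int_X f(x)\,x\,d\gamma(x): f\in L^2(X,\gamma)\}\subset X$. For $h\in H$, $\hat h\in L^2(X,\gamma)$ is the unique element of the $L^2(\gamma)$-closure of $X^*$ with $h=\int_X \hat h(x)\,x\,d\gamma(x)$. Equivalently, it is the element satisfying $\int_X\partial_h\phi\,d\gamma=\int_X\hat h\,\phi\,d\gamma$ for all $\phi\in C^1_b(X)$. In particular, if $h=\int_X\langle x^*,x\rangle x\,d\gamma(x)$ with $x^*\in X^*$, then $\hat h(x)=\langle x^*,x\rangle$. The space $H$ is a Hilbert space with the norm $|\cdot|_H$ that makes $h\mapsto\hat h\in L^2(X,\gamma)$ an isometry. $C^1_b(X)$ is the space of continuously differentiable cylindrical functions on $X$ (functions depending on finitely many elements of $X^*$) that are bounded and have bounded gradient. $\partial_h$ is the directional derivative along $h$. Finite perimeter: a Borel set $E\subset X$ has finite perimeter in $(X,\gamma)$ if there exists a (necessarily unique) $H$-valued Borel measure $D_\gamma\chi_E$ with finite total variation in $X$ such that, for all $\phi\in C^1_b(X)$ and $h\in H$, $$\int_E\partial_h\phi\,d\gamma=-\int_X\phi\,d\langle D_\gamma\chi_E,h\rangle_H+\int_E\phi\,\hat h\,d\gamma .$$ $|D_\gamma\chi_E|$ is the total variation measure of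 $D_\gamma\chi_E$ with respect to $|\cdot|_H$, and $\nu_E:X\to H$ is a Borel vector field with $D_\gamma\chi_E=\nu_E|D_\gamma\chi_E|$. Halfspaces: for a unit vector $h\in H$ (i.e. $|h|_H=1$), $S_h:=\{x\in X:\hat h(x)>0\}$, which is defined up to $\gamma$-negligible sets. $\chi_A$ is the characteristic function of $A$. *)

theory Defs
  imports "HOL-Probability.Probability"
begin

definition gaussian_measure :: "'a::{banach, second_countable_topology} measure \<Rightarrow> bool" where
  "gaussian_measure \<gamma> \<longleftrightarrow> prob_space \<gamma> \<and> sets \<gamma> = sets borel \<and>
     (\<forall>f :: 'a \<Rightarrow>\<^sub>L real. \<exists>m \<sigma>. \<sigma> \<ge> 0 \<and>
        distr \<gamma> borel (blinfun_apply f) =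
          (if \<sigma> = 0 then return borel m else density lborel (\<lambda>x. ennreal (normal_density m \<sigma> x))))"

definition centered :: "'a::{banach, second_countable_topology} measure \<Rightarrow> bool" where
  "centered \<gamma> \<longleftrightarrow> has_bochner_integral \<gamma> (\<lambda>x. x) 0"

definition nondegenerate :: "'a::{banach, second_countable_topology} measure \<Rightarrow> bool" where
  "nondegenerate \<gamma> \<longleftrightarrow> (\<forall>V. closed V \<and> subspace V \<and> V \<noteq> UNIV \<longrightarrow> V \<in> null_sets \<gamma>)"

text \<open>Elements of \<open>L\<^sup>2(\<gamma>)\<close> are represented by functions; equality there means equality
  \<open>\<gamma>\<close>-almost everywhere.\<close>

definition L2 :: "'a::{banach, second_countable_topology} measure \<Rightarrow> ('a \<Rightarrow> real) set" where
  "L2 \<gamma> = {f \<in> borel_measurable \<gamma>. integrable \<gamma> (\<lambda>x. (f x)\<^sup>2)}"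

definition L2_dual_closure ::
    "'a::{banach, second_countable_topology} measure \<Rightarrow> ('a \<Rightarrow> real) set" where
  "L2_dual_closure \<gamma> = {g \<in> L2 \<gamma>. \<exists>f :: nat \<Rightarrow> ('a \<Rightarrow>\<^sub>L real).
     (\<lambda>n. \<integral>\<^sup>+x. ennreal ((g x - blinfun_apply (f n) x)\<^sup>2) \<partial>\<gamma>) \<longlonglongrightarrow> 0}"

definition CM :: "'a::{banach, second_countable_topology} measure \<Rightarrow> 'a set" where
  "CM \<gamma> = {(LINT x|\<gamma>. f x *\<^sub>R x) |f. f \<in> L2 \<gamma>}"

text \<open>For \<open>h \<in> CM \<gamma>\<close> the representative chosen by \<open>hat \<gamma> h\<close> is unique only up to
  \<open>\<gamma>\<close>-null sets; outside \<open>CM \<gamma>\<close> the value is meaningless, and so are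
  the values of \<open>cm_inner\<close> and \<open>cm_norm\<close>.\<close>

definition hat :: "'a::{banach, second_countable_topology} measure \<Rightarrow> 'a \<Rightarrow> 'a \<Rightarrow> real" where
  "hat \<gamma> h = (SOME g. g \<in> L2_dual_closure \<gamma> \<and> h = (LINT x|\<gamma>. g x *\<^sub>R x))"

definition cm_inner :: "'a::{banach, second_countable_topology} measure \<Rightarrow> 'a \<Rightarrow> 'a \<Rightarrow> real" where
  "cm_inner \<gamma> h k = (LINT x|\<gamma>. hat \<gamma> h x * hat \<gamma> k x)"

definition cm_norm :: "'a::{banach, second_countable_topology} measure \<Rightarrow> 'a \<Rightarrow> real" where
  "cm_norm \<gamma> h = sqrt (LINT x|\<gamma>. (hat \<gamma> h x)\<^sup>2)"

text \<open>The Borel sigma-algebra of \<open>(CM \<gamma>, cm_norm \<gamma>)\<close>, generated by the sets that are open for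
  the Hilbert norm (not for the norm of the ambient space).\<close>

definition cm_borel :: "'a::{banach, second_countable_topology} measure \<Rightarrow> 'a measure" where
  "cm_borel \<gamma> = sigma (CM \<gamma>)
     {U. U \<subseteq> CM \<gamma> \<and> (\<forall>h\<in>U. \<exists>r>0. \<forall>k\<in>CM \<gamma>. cm_norm \<gamma> (k - h) < r \<longrightarrow> k \<in> U)}"

text \<open>A function is cylindrical if its value is determined by finitely many elements of the dual.\<close>

definition cylindrical :: "('a::real_normed_vector \<Rightarrow> real) \<Rightarrow> bool" where
  "cylindrical \<phi> \<longleftrightarrow> (\<exists>F :: ('a \<Rightarrow>\<^sub>L real) set. finite F \<and>
     (\<forall>x y. (\<forall>f\<in>F. blinfun_apply f x = blinfun_apply f y) \<longrightarrow> \<phi> x = \<phi> y))"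

definition C1b :: "('a::real_normed_vector \<Rightarrow> real) set" where
  "C1b = {\<phi>. cylindrical \<phi> \<and> bounded (range \<phi>) \<and>
     (\<exists>\<phi>' :: 'a \<Rightarrow> ('a \<Rightarrow>\<^sub>L real).
        (\<forall>x. (\<phi> has_derivative blinfun_apply (\<phi>' x)) (at x)) \<and>
        continuous_on UNIV \<phi>' \<and> bounded (range \<phi>'))}"

definition dir_deriv :: "'a::real_normed_vector \<Rightarrow> ('a \<Rightarrow> real) \<Rightarrow> 'a \<Rightarrow> real" where
  "dir_deriv h \<phi> x = deriv (\<lambda>s::real. \<phi> (x + s *\<^sub>R h)) 0"

text \<open>Integration against a finite signed Borel measure, through its Jordan decomposition:
  \<open>signed_pos \<mu>\<close> and \<open>signed_pos (- \<mu>)\<close> are the positive and the negative part.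
  Note that \<open>ennreal\<close> truncates negative values to \<open>0\<close>.\<close>

definition signed_pos :: "('a::topological_space set \<Rightarrow> real) \<Rightarrow> 'a measure" where
  "signed_pos \<mu> = measure_of UNIV (sets borel)
     (\<lambda>A. \<Squnion>B\<in>{B \<in> sets borel. B \<subseteq> A}. ennreal (\<mu> B))"

definition signed_integral :: "('a::topological_space set \<Rightarrow> real) \<Rightarrow> ('a \<Rightarrow> real) \<Rightarrow> real" where
  "signed_integral \<mu> \<phi> =
     (LINT x|signed_pos \<mu>. \<phi> x) - (LINT x|signed_pos (\<lambda>B. - \<mu> B). \<phi> x)"

text \<open>\<open>H\<close>-valued Borel measures, \<open>H = CM \<gamma>\<close>: set functions on the Borel sets with values
  in \<open>H\<close>, countably additive for the norm of \<open>H\<close>. Values on non-Borel sets are irrelevant.\<close>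

definition cm_measure ::
    "'a::{banach, second_countable_topology} measure \<Rightarrow> ('a set \<Rightarrow> 'a) \<Rightarrow> bool" where
  "cm_measure \<gamma> D \<longleftrightarrow> (\<forall>B\<in>sets borel. D B \<in> CM \<gamma>) \<and>
     (\<forall>A :: nat \<Rightarrow> 'a set. range A \<subseteq> sets borel \<longrightarrow> disjoint_family A \<longrightarrow>
        (\<lambda>n. cm_norm \<gamma> (D (\<Union>i. A i) - (\<Sum>i<n. D (A i)))) \<longlonglongrightarrow> 0)"

definition total_variation ::
    "'a::{banach, second_countable_topology} measure \<Rightarrow> ('a set \<Rightarrow> 'a) \<Rightarrow> 'a set \<Rightarrow> ennreal" where
  "total_variation \<gamma> D B =
     (\<Squnion>A\<in>{A :: nat \<Rightarrow> 'a set. range A \<subseteq> sets borel \<and> disjoint_family A \<and> (\<Union>i. A i) = B}.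
        \<Sum>i. ennreal (cm_norm \<gamma> (D (A i))))"

definition variation_measure ::
    "'a::{banach, second_countable_topology} measure \<Rightarrow> ('a set \<Rightarrow> 'a) \<Rightarrow> 'a measure" where
  "variation_measure \<gamma> D = measure_of UNIV (sets borel) (total_variation \<gamma> D)"

definition is_D_chi ::
    "'a::{banach, second_countable_topology} measure \<Rightarrow> 'a set \<Rightarrow> ('a set \<Rightarrow> 'a) \<Rightarrow> bool" where
  "is_D_chi \<gamma> E D \<longleftrightarrow> cm_measure \<gamma> D \<and> total_variation \<gamma> D UNIV < \<infinity> \<and>
     (\<forall>\<phi>\<in>C1b. \<forall>h\<in>CM \<gamma>.
        (LINT x:E|\<gamma>. dir_deriv h \<phi> x) =
          - signed_integral (\<lambda>B. cm_inner \<gamma> (D B) h) \<phi> + (LINT x:E|\<gamma>. \<phi> x * hat \<gamma> h x))"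

definition finite_perimeter ::
    "'a::{banach, second_countable_topology} measure \<Rightarrow> 'a set \<Rightarrow> bool" where
  "finite_perimeter \<gamma> E \<longleftrightarrow> E \<in> sets borel \<and> (\<exists>D. is_D_chi \<gamma> E D)"

text \<open>The measure \<open>D\<^sub>\<gamma>\<chi>\<^sub>E\<close>; its values on Borel sets are uniquely determined when \<open>E\<close> has
  finite perimeter.\<close>

definition D_chi ::
    "'a::{banach, second_countable_topology} measure \<Rightarrow> 'a set \<Rightarrow> 'a set \<Rightarrow> 'a" where
  "D_chi \<gamma> E = (SOME D. is_D_chi \<gamma> E D)"

text \<open>\<open>D = \<nu> |D|\<close> with \<open>\<nu>\<close> a Borel vector field with values in the Hilbert space \<open>H = CM \<gamma>\<close>. The
  \<open>H\<close>-valued integral of \<open>\<nu>\<close> over \<open>B\<close> is the element of \<open>H\<close> whose inner product with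
  each \<open>h \<in> H\<close> is the integral of \<open>\<langle>\<nu>, h\<rangle>\<^sub>H\<close> over \<open>B\<close>.\<close>

definition polar_decomposition ::
    "'a::{banach, second_countable_topology} measure \<Rightarrow> ('a set \<Rightarrow> 'a) \<Rightarrow> ('a \<Rightarrow> 'a) \<Rightarrow> bool" where
  "polar_decomposition \<gamma> D \<nu> \<longleftrightarrow> \<nu> \<in> measurable borel (cm_borel \<gamma>) \<and>
     (AE x in variation_measure \<gamma> D. cm_norm \<gamma> (\<nu> x) = 1) \<and>
     (\<forall>B\<in>sets borel. \<forall>h\<in>CM \<gamma>.
        cm_inner \<gamma> (D B) h = (LINT x:B|variation_measure \<gamma> D. cm_inner \<gamma> (\<nu> x) h))"

definition halfspace :: "'a::{banach, second_countable_topology} measure \<Rightarrow> 'a \<Rightarrow> 'a set" where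
  "halfspace \<gamma> h = {x. hat \<gamma> h x > 0}"

end

theory Submission
  imports Defs
begin

text \<open>Write \<open>c = e\<^sup>-\<^sup>t = cos a\<close>. The product \<open>\<gamma> \<otimes> \<gamma>\<close> is invariant under the rotations of \<open>X \<times> X\<close>, and
  the integration by parts formula for \<open>E\<close> says that \<open>\<chi>\<^sub>E \<gamma> \<otimes> \<gamma>\<close>, carried along by the rotations, moves with
  velocity given by the rotated measure \<open>W |D\<chi>\<^sub>E| \<otimes> \<gamma>\<close>, where \<open>W (x, y)\<close> is the value at \<open>y\<close> of the
  functional that represents \<open>\<nu>\<^sub>E(x)\<close>. Consequently the overlap \<open>\<integral> \<chi>\<^sub>E T\<^sub>t \<chi>\<^sub>E d\<gamma>\<close>, with \<open>T\<^sub>t\<close> the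
  Ornstein-Uhlenbeck semigroup, decreases in \<open>a\<close> at the rate
  \<open>F a = \<integral>\<integral> W (x, y) \<chi>\<^sub>E (cos a x + sin a y) d\<gamma>(y) d|D\<chi>\<^sub>E|(x)\<close>, which is at most \<open>\<integral>\<integral> W\<^sup>+\<close>; the defect
  \<open>\<integral>\<integral> W\<^sup>+ - F a\<close> is the integral of \<open>|W|\<close> times the absolute value in the theorem, so it suffices that it
  tends to \<open>0\<close>, because \<open>W \<noteq> 0\<close> almost everywhere. Testing the rotated measure against continuous
  functions that approximate the sign of \<open>W\<close> shows that the averages of \<open>F\<close> over \<open>[0, a]\<close> tend to
  \<open>\<integral>\<integral> W\<^sup>+\<close>. The overlap is a convex function of \<open>t\<close>, which turns the convergence of the averages into
  convergence of \<open>F\<close> itself: \<open>F\<close> is right continuous, since the law of \<open>cos a x + sin a y\<close> under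
  \<open>|D\<chi>\<^sub>E| \<otimes> \<gamma>\<close> is absolutely continuous with respect to \<open>\<gamma>\<close>.\<close>

section \<open>Norming functionals\<close>

text \<open>The formula that defines the perimeter measure admits only smooth cylindrical test
  functions, while the argument needs indicators and images under \<open>ou\<close>. Hence every
  identity between signed measures is checked on cosines with a phase, where Gaussian integrals are
  explicit, and \<open>trig_monotone_class\<close> extends it to bounded Borel functions. Two
  factors 2 have to match: a test function with values in [-1, 1] is controlled by the symmetric
  difference of the set and its rotated copy, which is twice the loss of overlap, and the integral
  of |W| is twice that of its positive part since each W (x, .) has mean zero. Convexity lives in t
  = - ln (cos a), the flux in a, and dt/da = tan a; comparing a with (1 + \<eta>) a costs a ratio of
  tangents that tends to 1 with \<eta> \<rightarrow> 0. The obstacle to right continuity is that M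
  need not be absolutely continuous, so a statement that holds \<gamma>-a.e. cannot be evaluated
  M-a.e.; rewriting the flux at a fixed smaller angle b moves all dependence on a into a function
  \<open>ou c\<close> of \<chi>_E, taken at a point blurred by Gaussian noise.\<close>

definition sublinear :: "('a::real_vector \<Rightarrow> real) \<Rightarrow> bool" where
  "sublinear p \<longleftrightarrow> p 0 = 0 \<and> (\<forall>x y. p (x + y) \<le> p x + p y) \<and> (\<forall>c>0. \<forall>x. p (c *\<^sub>R x) \<le> c * p x)"

lemma sublinear_ge: "sublinear p \<Longrightarrow> - p (- x) \<le> p x"
  unfolding sublinear_def by (metis add.right_inverse add.commute diff_0 diff_le_eq)

lemma sublinear_pos_scale: "sublinear p \<Longrightarrow> 0 \<le> c \<Longrightarrow> p (c *\<^sub>R x) = c * p x"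
proof (cases "c = 0")
  case False
  assume p: "sublinear p" and "0 \<le> c"
  with False have c: "c > 0" by simp
  have "p ((1 / c) *\<^sub>R (c *\<^sub>R x)) \<le> (1 / c) * p (c *\<^sub>R x)"
    using p c unfolding sublinear_def by (metis divide_pos_pos zero_less_one)
  then have "c * p x \<le> p (c *\<^sub>R x)" using c by (simp add: field_simps)
  moreover have "p (c *\<^sub>R x) \<le> c * p x" using p c unfolding sublinear_def by simp
  ultimately show ?thesis by simp
qed (simp add: sublinear_def)

text \<open>The classical modification step of the Hahn-Banach theorem. The result lies below p
  (take t = 0), is again sublinear, and satisfies \<open>lower_along p y (- y) \<le> - p y\<close>
  (take t = 1), so a functional that cannot be lowered is odd along y.\<close>

definition lower_along :: "('a::real_vector \<Rightarrow> real) \<Rightarrow> 'a \<Rightarrow> 'a \<Rightarrow> real" where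
  "lower_along p y x = (INF t\<in>{0..}. p (x + t *\<^sub>R y) - t * p y)"

lemma lower_along_bdd:
  assumes p: "sublinear p"
  shows "bdd_below ((\<lambda>t. p (x + t *\<^sub>R y) - t * p y) ` {0..})"
proof (rule bdd_belowI2)
  fix t :: real assume "t \<in> {0..}"
  then have "t * p y = p (t *\<^sub>R y)" using sublinear_pos_scale[OF p] by simp
  also have "\<dots> \<le> p (x + t *\<^sub>R y) + p (- x)"
    using p unfolding sublinear_def by (metis add.commute add_minus_cancel)
  finally show "- p (- x) \<le> p (x + t *\<^sub>R y) - t * p y" by simp
qed

lemma lower_along_le:
  assumes p: "sublinear p" and "0 \<le> t"
  shows "lower_along p y x \<le> p (x + t *\<^sub>R y) - t * p y"
  unfolding lower_along_def using lower_along_bdd[OF p] assms(2) by (intro cINF_lower) auto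

lemma lower_along_ge:
  assumes "\<And>t. 0 \<le> t \<Longrightarrow> b \<le> p (x + t *\<^sub>R y) - t * p y"
  shows "b \<le> lower_along p y x"
  unfolding lower_along_def using assms by (intro cINF_greatest) auto

lemma sublinear_lower_along:
  assumes p: "sublinear p"
  shows "sublinear (lower_along p y)"
proof -
  have 0: "lower_along p y 0 = 0"
  proof (rule antisym)
    show "lower_along p y 0 \<le> 0" using lower_along_le[OF p, of 0 y 0] p by (simp add: sublinear_def)
    show "0 \<le> lower_along p y 0"
      by (rule lower_along_ge) (simp add: sublinear_pos_scale[OF p])
  qed
  have add: "lower_along p y (a + b) \<le> lower_along p y a + lower_along p y b" for a b
  proof -
    have *: "lower_along p y (a + b) \<le> (p (a + s *\<^sub>R y) - s * p y) + (p (b + t *\<^sub>R y) - t * p y)"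
      if "0 \<le> s" "0 \<le> t" for s t
    proof -
      have "lower_along p y (a + b) \<le> p (a + b + (s + t) *\<^sub>R y) - (s + t) * p y"
        using that by (intro lower_along_le[OF p]) simp
      also have "a + b + (s + t) *\<^sub>R y = (a + s *\<^sub>R y) + (b + t *\<^sub>R y)" by (simp add: algebra_simps)
      also have "p \<dots> \<le> p (a + s *\<^sub>R y) + p (b + t *\<^sub>R y)" using p unfolding sublinear_def by blast
      finally show ?thesis by (simp add: algebra_simps)
    qed
    have "lower_along p y (a + b) - (p (b + t *\<^sub>R y) - t * p y) \<le> lower_along p y a" if "0 \<le> t" for t
      using *[OF _ that] by (intro lower_along_ge) (simp add: algebra_simps)
    then have "lower_along p y (a + b) - lower_along p y a \<le> lower_along p y b"
      by (intro lower_along_ge) (simp add: algebra_simps)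
    then show ?thesis by simp
  qed
  have scale: "lower_along p y (c *\<^sub>R x) \<le> c * lower_along p y x" if c: "c > 0" for c x
  proof -
    have "lower_along p y (c *\<^sub>R x) / c \<le> lower_along p y x"
    proof (rule lower_along_ge)
      fix t :: real assume t: "0 \<le> t"
      have "lower_along p y (c *\<^sub>R x) \<le> p (c *\<^sub>R x + (c * t) *\<^sub>R y) - (c * t) * p y"
        using t c by (intro lower_along_le[OF p]) simp
      also have "c *\<^sub>R x + (c * t) *\<^sub>R y = c *\<^sub>R (x + t *\<^sub>R y)" by (simp add: algebra_simps)
      also have "p \<dots> = c * p (x + t *\<^sub>R y)" using sublinear_pos_scale[OF p] c by simp
      finally show "lower_along p y (c *\<^sub>R x) / c \<le> p (x + t *\<^sub>R y) - t * p y"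
        using c by (simp add: field_simps)
    qed
    then show ?thesis using c by (simp add: field_simps)
  qed
  show ?thesis unfolding sublinear_def using 0 add scale by blast
qed

text \<open>Hahn-Banach: a minimal sublinear functional is linear, since it agrees with all its
  modifications \<^const>\<open>lower_along\<close>.\<close>

lemma sublinear_minimal_exists:
  assumes p: "sublinear p"
  shows "\<exists>q. sublinear q \<and> q \<le> p \<and> (\<forall>r. sublinear r \<longrightarrow> r \<le> q \<longrightarrow> r = q)"
proof -
  define A where "A = {q. sublinear q \<and> q \<le> p}"
  define P where "P = (\<lambda>q r :: 'a \<Rightarrow> real. r \<le> q)"
  have "\<exists>m\<in>A. \<forall>a\<in>A. P m a \<longrightarrow> a = m"
  proof (rule predicate_Zorn)
    show "partial_order_on A (relation_of P A)"
      by (rule partial_order_on_relation_ofI) (auto simp: P_def)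
    fix C assume "C \<in> Chains (relation_of P A)"
    then have CA: "C \<subseteq> A" and ch: "\<And>q r. q \<in> C \<Longrightarrow> r \<in> C \<Longrightarrow> q \<le> r \<or> r \<le> q"
      by (auto simp: Chains_def relation_of_def P_def)
    show "\<exists>u\<in>A. \<forall>a\<in>C. P a u"
    proof (cases "C = {}")
      case True
      then show ?thesis using p by (auto simp: A_def)
    next
      case False
      define u where "u x = (INF q\<in>C. q x)" for x
      have bdd: "bdd_below ((\<lambda>q. q x) ` C)" for x
      proof (rule bdd_belowI2)
        fix q assume "q \<in> C"
        with CA have "sublinear q" "q (- x) \<le> p (- x)" by (auto simp: A_def le_fun_def)
        then show "- p (- x) \<le> q x" using sublinear_ge[of q x] by simp
      qed
      have le: "u x \<le> q x" if "q \<in> C" for q x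
        unfolding u_def using bdd that by (rule cINF_lower)
      have ge: "b \<le> u x" if "\<And>q. q \<in> C \<Longrightarrow> b \<le> q x" for b x
        unfolding u_def using False that by (rule cINF_greatest)
      have 1: "u (x + y) \<le> u x + u y" for x y
      proof -
        have *: "u (x + y) \<le> q x + r y" if qr: "q \<in> C" "r \<in> C" for q r
        proof -
          obtain s where s: "s \<in> C" "s \<le> q" "s \<le> r" using ch[OF qr] qr by auto
          have "u (x + y) \<le> s (x + y)" using le s by blast
          also have "\<dots> \<le> s x + s y" using s CA by (auto simp: A_def sublinear_def)
          also have "\<dots> \<le> q x + r y" using s by (auto simp: le_fun_def intro: add_mono)
          finally show ?thesis .
        qed
        have "u (x + y) - r y \<le> u x" if "r \<in> C" for r
          using *[OF _ that] by (intro ge) (simp add: algebra_simps)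
        then have "u (x + y) - u x \<le> u y" by (intro ge) (simp add: algebra_simps)
        then show ?thesis by simp
      qed
      have 2: "u (c *\<^sub>R x) \<le> c * u x" if c: "c > 0" for c x
      proof -
        have "u (c *\<^sub>R x) / c \<le> u x"
        proof (rule ge)
          fix q assume q: "q \<in> C"
          have "u (c *\<^sub>R x) \<le> q (c *\<^sub>R x)" using le q by blast
          also have "\<dots> = c * q x" using q CA c by (intro sublinear_pos_scale) (auto simp: A_def)
          finally show "u (c *\<^sub>R x) / c \<le> q x" using c by (simp add: field_simps)
        qed
        then show ?thesis using c by (simp add: field_simps)
      qed
      have 3: "u 0 = 0"
        unfolding u_def using CA False by (subst INF_cong[of C C _ "\<lambda>_. 0"]) (auto simp: A_def sublinear_def)
      obtain q0 where "q0 \<in> C" using False by blast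
      then have "u x \<le> p x" for x
        using le[of q0 x] CA by (auto simp: A_def le_fun_def intro: order_trans[of _ "q0 x"])
      then have "u \<le> p" by (simp add: le_fun_def)
      then have "u \<in> A" using 1 2 3 by (auto simp: A_def sublinear_def)
      then show ?thesis using le by (auto simp: P_def le_fun_def)
    qed
  qed
  then obtain m where m: "m \<in> A" "\<And>a. a \<in> A \<Longrightarrow> a \<le> m \<Longrightarrow> a = m" by (auto simp: P_def)
  have "r = m" if "sublinear r" "r \<le> m" for r
    using m that by (auto simp: A_def intro: order_trans)
  with m show ?thesis by (auto simp: A_def)
qed

text \<open>Minimising below \<open>lower_along norm x0\<close> instead of below the norm makes the
  minimal functional q satisfy \<open>q (- x0) \<le> - norm x0\<close>; linearity turns this into
  the norming property at x0.\<close>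

lemma norming_functional:
  fixes x0 :: "'a::real_normed_vector"
  shows "\<exists>f :: 'a \<Rightarrow>\<^sub>L real. (\<forall>x. f x \<le> norm x) \<and> f x0 = norm x0"
proof -
  have n: "sublinear (norm :: 'a \<Rightarrow> real)" by (auto simp: sublinear_def norm_triangle_ineq)
  obtain q where q: "sublinear q" "q \<le> lower_along norm x0"
    and min: "\<And>r. sublinear r \<Longrightarrow> r \<le> q \<Longrightarrow> r = q"
    using sublinear_minimal_exists[OF sublinear_lower_along[OF n]] by blast
  have le: "q x \<le> norm x" for x
  proof -
    have "q x \<le> lower_along norm x0 x" using q(2) by (simp add: le_fun_def)
    also have "\<dots> \<le> norm x" using lower_along_le[OF n, of 0 x0 x] by simp
    finally show ?thesis .
  qed
  have add: "q (x + y) = q x + q y" for x y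
  proof (rule antisym)
    show "q (x + y) \<le> q x + q y" using q(1) by (simp add: sublinear_def)
    \<comment> \<open>Minimality leaves no room below q, and the case t = 1 of the modification then
      reads as superadditivity.\<close>
    have "lower_along q y = q"
    proof (rule min[OF sublinear_lower_along[OF q(1)]])
      show "lower_along q y \<le> q" using lower_along_le[OF q(1), of 0 y] by (simp add: le_fun_def)
    qed
    then show "q x + q y \<le> q (x + y)" using lower_along_le[OF q(1), of 1 y x] by simp
  qed
  have minus: "q (- x) = - q x" for x
    using add[of x "- x"] q(1) by (simp add: sublinear_def)
  have scale: "q (c *\<^sub>R x) = c *\<^sub>R q x" for c x
  proof (cases "0 \<le> c")
    case True
    then show ?thesis using sublinear_pos_scale[OF q(1)] by simp
  next
    case False
    then show ?thesis using sublinear_pos_scale[OF q(1), of "- c" "x"] minus[of "c *\<^sub>R x"] by simp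
  qed
  have bl: "bounded_linear q"
  proof (rule bounded_linear_intro[of _ 1])
    show "norm (q x) \<le> norm x * 1" for x
      using le[of x] le[of "- x"] minus[of x] by (simp add: abs_le_iff)
  qed (use add scale in auto)
  have "q (- x0) \<le> lower_along norm x0 (- x0)" using q(2) by (simp add: le_fun_def)
  also have "\<dots> \<le> - norm x0" using lower_along_le[OF n, of 1 x0 "- x0"] by simp
  finally have "q x0 = norm x0" using le[of x0] minus[of x0] by simp
  then show ?thesis using le bl by (intro exI[of _ "Blinfun q"]) (simp add: bounded_linear_Blinfun_apply)
qed

lemma blinfun_separates:
  fixes x y :: "'a::real_normed_vector"
  assumes "\<And>f :: 'a \<Rightarrow>\<^sub>L real. f x = f y"
  shows "x = y"
proof -
  obtain f :: "'a \<Rightarrow>\<^sub>L real" where "f (x - y) = norm (x - y)"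
    using norming_functional[of "x - y"] by blast
  then show ?thesis using assms[of f] by (simp add: blinfun.diff_right)
qed

text \<open>A closed ball is a countable intersection of half-spaces given by functionals that norm
  the points of a countable dense set, and an open set is a countable union of such balls. N is kept
  abstract because it will be the \<sigma>-algebra of sets whose indicator lies in
  \<open>trig_closure\<close>.\<close>

lemma borel_measurable_weakly:
  fixes N :: "'a::{real_normed_vector, second_countable_topology} measure"
  assumes sp: "space N = UNIV" and f: "\<And>f :: 'a \<Rightarrow>\<^sub>L real. blinfun_apply f \<in> borel_measurable N"
  shows "sets borel \<subseteq> sets N"
proof -
  obtain D :: "'a set" where D: "countable D" "\<And>X. open X \<Longrightarrow> X \<noteq> {} \<Longrightarrow> \<exists>d\<in>D. d \<in> X"
    by (rule countable_dense_setE) blast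
  have "\<forall>d. \<exists>f :: 'a \<Rightarrow>\<^sub>L real. (\<forall>x. f x \<le> norm x) \<and> f d = norm d" using norming_functional by blast
  then obtain F :: "'a \<Rightarrow> ('a \<Rightarrow>\<^sub>L real)" where F: "\<And>d x. F d x \<le> norm x" "\<And>d. F d d = norm d"
    by metis
  have near: "\<exists>d\<in>D. dist x d < e" if "e > 0" for x e
    using D(2)[of "ball x e"] that by (auto simp: mem_ball)
  \<comment> \<open>A functional that norms x - z itself need not be in the countable family; one
    that norms a dense point d near x - z loses at most twice the distance.\<close>
  have cball: "{x. norm (x - z) \<le> r} = (\<Inter>d\<in>D. {x. F d x \<le> F d z + r})" for z r
  proof safe
    fix x d assume "norm (x - z) \<le> r"
    then show "F d x \<le> F d z + r" using F(1)[of d "x - z"] by (simp add: blinfun.diff_right)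
  next
    fix x assume *: "x \<in> (\<Inter>d\<in>D. {x. F d x \<le> F d z + r})"
    show "norm (x - z) \<le> r"
    proof (rule field_le_epsilon)
      fix e :: real assume "e > 0"
      then obtain d where d: "d \<in> D" "dist (x - z) d < e / 2" using near[of "e/2"] by auto
      have "norm (x - z) \<le> norm d + e / 2"
        using d(2) norm_triangle_sub[of "x - z" d] by (simp add: dist_norm)
      also have "norm d = F d (x - z) - F d (x - z - d)" using F(2) by (simp add: blinfun.diff_right)
      also have "\<dots> \<le> r + e / 2"
      proof -
        have "F d (x - z) \<le> r" using * d by (auto simp: blinfun.diff_right algebra_simps)
        moreover have "- F d (x - z - d) \<le> norm (x - z - d)"
          using F(1)[of d "- (x - z - d)"] by (metis blinfun.minus_right norm_minus_cancel)
        moreover have "norm (x - z - d) \<le> e / 2" using d by (simp add: dist_norm)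
        ultimately show ?thesis by linarith
      qed
      finally show "norm (x - z) \<le> r + e" by simp
    qed
  qed
  obtain d0 where "d0 \<in> D" using near[of 1 0] by auto
  have cb: "{x. norm (x - z) \<le> r} \<in> sets N" for z r
    unfolding cball
  proof (rule sets.countable_INT')
    show "countable D" "D \<noteq> {}" using D \<open>d0 \<in> D\<close> by auto
    show "(\<lambda>d. {x. F d x \<le> F d z + r}) ` D \<subseteq> sets N"
      using f by (auto simp: borel_measurable_iff_le sp)
  qed
  have "S \<in> sets N" if S: "open S" for S :: "'a set"
  proof -
    have "S = (\<Union>(d, n)\<in>{(d, n :: nat). d \<in> D \<and> {x. norm (x - d) \<le> 1 / real (Suc n)} \<subseteq> S}. {x. norm (x - d) \<le> 1 / real (Suc n)})"
    proof (intro equalityI subsetI)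
      fix x assume "x \<in> S"
      then obtain e where e: "e > 0" "ball x e \<subseteq> S" using S open_contains_ball by blast
      obtain n where n: "1 / real (Suc n) < e / 2" using nat_approx_posE[of "e/2"] e by auto
      obtain d where d: "d \<in> D" "dist x d < 1 / real (Suc n)" using near[of "1 / real (Suc n)" x] by auto
      have "{y. norm (y - d) \<le> 1 / real (Suc n)} \<subseteq> S"
      proof
        fix y assume "y \<in> {y. norm (y - d) \<le> 1 / real (Suc n)}"
        then have "dist x y < e" using n d dist_triangle_half_r[of d x e y] by (auto simp: dist_norm norm_minus_commute)
        then show "y \<in> S" using e by auto
      qed
      then show "x \<in> (\<Union>(d, n)\<in>{(d, n :: nat). d \<in> D \<and> {x. norm (x - d) \<le> 1 / real (Suc n)} \<subseteq> S}. {x. norm (x - d) \<le> 1 / real (Suc n)})"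
        using d by (auto simp: dist_norm intro!: exI[of _ d] exI[of _ n])
    qed auto
    also have "\<dots> \<in> sets N"
    proof (rule sets.countable_UN')
      have "countable (D \<times> (UNIV :: nat set))" using D by simp
      then show "countable {(d, n :: nat). d \<in> D \<and> {x. norm (x - d) \<le> 1 / real (Suc n)} \<subseteq> S}"
        by (rule countable_subset[rotated]) auto
    qed (use cb in auto)
    finally show ?thesis .
  qed
  then show ?thesis
    unfolding borel_def using sp by (auto intro!: sets.sigma_sets_subset[of _ N, simplified sp])
qed

section \<open>Trigonometric functions determine measures\<close>

text \<open>The smallest class that contains the cosines of functionals with a phase and is closed
  under linear combinations and bounded pointwise limits. As an inductive predicate it brings the
  induction rule by which integral identities are extended; the phase includes the sines.\<close>

inductive trig_closure :: "('a::real_normed_vector \<Rightarrow> real) \<Rightarrow> bool" where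
  cos: "trig_closure (\<lambda>x. cos (blinfun_apply f x + \<theta>))"
| add: "trig_closure u \<Longrightarrow> trig_closure v \<Longrightarrow> trig_closure (\<lambda>x. u x + v x)"
| scale: "trig_closure u \<Longrightarrow> trig_closure (\<lambda>x. c * u x)"
| lim: "(\<And>n. trig_closure (U n)) \<Longrightarrow> (\<And>n x. \<bar>U n x\<bar> \<le> K) \<Longrightarrow>
    (\<And>x. (\<lambda>n::nat. U n x) \<longlonglongrightarrow> v x) \<Longrightarrow> trig_closure v"

lemma trig_closure_bounded: "trig_closure u \<Longrightarrow> \<exists>K. \<forall>x. \<bar>u x\<bar> \<le> K"
proof (induction rule: trig_closure.induct)
  case (add u v)
  then obtain K L where "\<forall>x. \<bar>u x\<bar> \<le> K" "\<forall>x. \<bar>v x\<bar> \<le> L" by blast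
  then have "\<forall>x. \<bar>u x + v x\<bar> \<le> K + L" by (meson abs_triangle_ineq add_mono order_trans)
  then show ?case by blast
next
  case (scale u c)
  then obtain K where "\<forall>x. \<bar>u x\<bar> \<le> K" by blast
  then have "\<forall>x. \<bar>c * u x\<bar> \<le> \<bar>c\<bar> * K" by (simp add: abs_mult mult_left_mono)
  then show ?case by blast
next
  case (lim U K v)
  then have "\<forall>x. \<bar>v x\<bar> \<le> K" by (metis LIMSEQ_le_const2 tendsto_rabs)
  then show ?case by blast
qed (use abs_cos_le_one in blast)

text \<open>The product-to-sum formula settles a product of two cosines, and induction on u does the
  rest. A second induction, on the other factor, makes the class an algebra.\<close>

lemma trig_closure_mult_cos:
  "trig_closure u \<Longrightarrow> trig_closure (\<lambda>x. u x * cos (blinfun_apply f x + \<theta>))"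
proof (induction rule: trig_closure.induct)
  case (cos g \<eta>)
  have "trig_closure (\<lambda>x. (1/2) * (cos (blinfun_apply (g - f) x + (\<eta> - \<theta>)) + cos (blinfun_apply (g + f) x + (\<eta> + \<theta>))))"
    by (intro trig_closure.intros)
  also have "(\<lambda>x. (1/2) * (cos (blinfun_apply (g - f) x + (\<eta> - \<theta>)) + cos (blinfun_apply (g + f) x + (\<eta> + \<theta>))))
     = (\<lambda>x. cos (g x + \<eta>) * cos (f x + \<theta>))"
  proof
    fix x
    show "(1/2) * (cos (blinfun_apply (g - f) x + (\<eta> - \<theta>)) + cos (blinfun_apply (g + f) x + (\<eta> + \<theta>)))
      = cos (g x + \<eta>) * cos (f x + \<theta>)"
      by (simp add: cos_times_cos blinfun.diff_left blinfun.add_left algebra_simps)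
  qed
  finally show ?case .
next
  case (add u v)
  then show ?case by (simp add: distrib_right trig_closure.add)
next
  case (scale u c)
  then show ?case using trig_closure.scale[of _ c] by (simp add: mult.assoc)
next
  case (lim U K v)
  show ?case
  proof (rule trig_closure.lim[of "\<lambda>n x. U n x * cos (f x + \<theta>)" K])
    fix n x
    have "\<bar>U n x * cos (f x + \<theta>)\<bar> \<le> K * 1"
      unfolding abs_mult using lim(2)[of n x] abs_cos_le_one by (intro mult_mono) auto
    then show "\<bar>U n x * cos (f x + \<theta>)\<bar> \<le> K" by simp
  qed (use lim in \<open>auto intro!: tendsto_intros\<close>)
qed

lemma trig_closure_mult:
  "trig_closure v \<Longrightarrow> trig_closure u \<Longrightarrow> trig_closure (\<lambda>x. u x * v x)"
proof (induction rule: trig_closure.induct)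
  case (add v w)
  then show ?case by (simp add: distrib_left trig_closure.add)
next
  case (scale v c)
  then show ?case using trig_closure.scale[of _ c] by (simp add: mult.left_commute)
next
  case (lim U K v)
  obtain L where L: "\<And>x. \<bar>u x\<bar> \<le> L" using trig_closure_bounded lim by blast
  show ?case
  proof (rule trig_closure.lim[of "\<lambda>n x. u x * U n x" "L * K"])
    fix n x
    show "\<bar>u x * U n x\<bar> \<le> L * K"
      unfolding abs_mult using lim(2)[of n x] L[of x] by (intro mult_mono) auto
  qed (use lim in \<open>auto intro!: tendsto_intros\<close>)
qed (simp add: trig_closure_mult_cos)

lemma trig_closure_const: "trig_closure (\<lambda>x. c)"
  using trig_closure.scale[OF trig_closure.cos[of 0 0], of c] by simp

lemma trig_closure_sum: "finite A \<Longrightarrow> (\<And>i. i \<in> A \<Longrightarrow> trig_closure (u i)) \<Longrightarrow> trig_closure (\<lambda>x. \<Sum>i\<in>A. u i x)"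
  by (induction A rule: finite_induct) (auto intro: trig_closure.add trig_closure_const)

lemma trig_closure_power: "trig_closure u \<Longrightarrow> trig_closure (\<lambda>x. u x ^ n)"
  by (induction n) (auto intro: trig_closure_mult trig_closure_const)

lemma trig_closure_one_minus: "trig_closure u \<Longrightarrow> trig_closure (\<lambda>x. 1 - u x)"
  using trig_closure.add[OF trig_closure_const[of 1] trig_closure.scale[of u "- 1"]] by simp

text \<open>Since the class is an algebra, it contains the Bernstein polynomials of h composed with
  u, and these converge uniformly to h on [0, 1].\<close>

lemma trig_closure_continuous:
  assumes u: "trig_closure u" and u01: "\<And>x. 0 \<le> u x \<and> u x \<le> 1"
    and h: "continuous_on {0..1} h"
  shows "trig_closure (\<lambda>x. h (u x) :: real)"
proof -
  have "\<forall>m::nat. \<exists>N. \<forall>x\<in>{0..1}. \<bar>h x - (\<Sum>k\<le>N. h (k/N) * Bernstein N k x)\<bar> < 1 / Suc m"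
  proof
    fix m :: nat
    obtain N where "\<forall>n x. N \<le> n \<and> x \<in> {0..1} \<longrightarrow> \<bar>h x - (\<Sum>k\<le>n. h (k/n) * Bernstein n k x)\<bar> < 1 / Suc m"
      using Bernstein_Weierstrass[OF h, of "1 / Suc m"] by auto
    then show "\<exists>N. \<forall>x\<in>{0..1}. \<bar>h x - (\<Sum>k\<le>N. h (k/N) * Bernstein N k x)\<bar> < 1 / Suc m"
      by (intro exI[of _ N]) simp
  qed
  then obtain N where N: "\<And>m x. x \<in> {0..1} \<Longrightarrow> \<bar>h x - (\<Sum>k\<le>N m. h (k/N m) * Bernstein (N m) k x)\<bar> < 1 / Suc m"
    by metis
  have "bounded (h ` {0..1})" using h compact_continuous_image compact_imp_bounded by blast
  then obtain K where K: "\<And>x. x \<in> {0..1} \<Longrightarrow> \<bar>h x\<bar> \<le> K" unfolding bounded_iff by fastforce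
  show ?thesis
  proof (rule trig_closure.lim[of "\<lambda>m x. \<Sum>k\<le>N m. h (k/N m) * Bernstein (N m) k (u x)" "K + 1"])
    show "trig_closure (\<lambda>x. \<Sum>k\<le>N m. h (k/N m) * Bernstein (N m) k (u x))" for m
      unfolding Bernstein_def
      by (intro trig_closure_sum trig_closure.scale trig_closure_mult trig_closure_power
            trig_closure_one_minus u) auto
  next
    fix m x
    have "\<bar>h (u x) - (\<Sum>k\<le>N m. h (k/N m) * Bernstein (N m) k (u x))\<bar> < 1 / Suc m" using N u01 by auto
    moreover have "1 / real (Suc m) \<le> 1" by simp
    ultimately show "\<bar>\<Sum>k\<le>N m. h (k/N m) * Bernstein (N m) k (u x)\<bar> \<le> K + 1"
      using K[of "u x"] u01[of x] unfolding abs_le_iff abs_less_iff atLeastAtMost_iff by linarith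
  next
    fix x
    have "(\<lambda>m. h (u x) - (\<Sum>k\<le>N m. h (k/N m) * Bernstein (N m) k (u x))) \<longlonglongrightarrow> 0"
    proof (rule Lim_null_comparison[OF _ LIMSEQ_inverse_real_of_nat])
      show "\<forall>\<^sub>F m in sequentially. norm (h (u x) - (\<Sum>k\<le>N m. h (k/N m) * Bernstein (N m) k (u x))) \<le> inverse (real (Suc m))"
        using N u01 by (intro always_eventually allI) (auto simp: inverse_eq_divide intro: less_imp_le)
    qed
    from tendsto_diff[OF tendsto_const[of "h (u x)"] this]
    show "(\<lambda>m. \<Sum>k\<le>N m. h (k/N m) * Bernstein (N m) k (u x)) \<longlonglongrightarrow> h (u x)" by simp
  qed
qed


lemma trig_closure_indicator_greater:
  assumes u: "trig_closure u"
  shows "trig_closure (indicat_real {x. u x > c})"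
proof -
  obtain K where K: "\<And>x. \<bar>u x\<bar> \<le> K" using trig_closure_bounded[OF u] by blast
  define L where "L = K + \<bar>c\<bar> + 1"
  have L: "L > 0" using K[of undefined] by (simp add: L_def)
  define w where "w x = 1/2 + (1 / (2 * L)) * (u x + - c)" for x
  have w: "trig_closure w" unfolding w_def
    by (intro trig_closure.add trig_closure.scale trig_closure_const u)
  have w01: "0 \<le> w x \<and> w x \<le> 1" for x
  proof -
    have "\<bar>u x - c\<bar> \<le> L" using K[of x] by (simp add: L_def)
    then show ?thesis unfolding w_def using L by (auto simp: abs_le_iff field_simps)
  qed
  have w_iff: "w x > 1/2 \<longleftrightarrow> u x > c" for x
    using L by (auto simp: w_def zero_less_mult_iff zero_less_divide_iff)
  \<comment> \<open>For n > 0 a ramp that vanishes up to 1/2 and equals 1 from 1/2 + 1/n on; its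
    pointwise limit is the indicator of y > 1/2.\<close>
  define h where "h n y = min 1 (max 0 (real n * (y - 1/2)))" for n :: nat and y :: real
  show ?thesis
  proof (rule trig_closure.lim[of "\<lambda>n x. h n (w x)" 1])
    show "trig_closure (\<lambda>x. h n (w x))" for n
      by (rule trig_closure_continuous[OF w w01]) (auto simp: h_def intro!: continuous_intros)
    show "\<bar>h n (w x)\<bar> \<le> 1" for n x by (auto simp: h_def)
    fix x
    show "(\<lambda>n. h n (w x)) \<longlonglongrightarrow> indicat_real {x. c < u x} x"
    proof (cases "u x > c")
      case True
      then have p: "w x - 1/2 > 0" using w_iff by simp
      obtain m :: nat where m: "1 / (w x - 1/2) < real m" using reals_Archimedean2 by blast
      have "h n (w x) = 1" if "n \<ge> m" for n
      proof -
        have "1 < real m * (w x - 1/2)" using m p by (simp add: field_simps)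
        also have "\<dots> \<le> real n * (w x - 1/2)" using that p by (intro mult_right_mono) auto
        finally have "1 < real n * (w x - 1/2)" .
        then show ?thesis by (simp add: h_def)
      qed
      then show ?thesis using True
        by (intro tendsto_eventually eventually_sequentiallyI[of m]) auto
    next
      case False
      then have "w x \<le> 1/2" using w_iff by (meson not_le)
      then have "real n * (w x - 1/2) \<le> 0" for n by (simp add: mult_nonneg_nonpos)
      then show ?thesis using False by (simp add: h_def max_absorb1)
    qed
  qed
qed

lemma trig_closure_indicator_Un:
  assumes "trig_closure (indicat_real A)" "trig_closure (indicat_real B)"
  shows "trig_closure (indicat_real (A \<union> B))"
proof -
  have "trig_closure (\<lambda>x. 1 - (1 - indicat_real A x) * (1 - indicat_real B x))"
    by (intro trig_closure_one_minus trig_closure_mult assms)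
  moreover have "(\<lambda>x. 1 - (1 - indicat_real A x) * (1 - indicat_real B x)) = indicat_real (A \<union> B)"
    by (auto simp: indicator_def)
  ultimately show ?thesis by simp
qed

text \<open>The sets with indicator in the class form a \<sigma>-algebra that contains the
  superlevel sets of all functions in the class. An unbounded functional f is the limit of n sin (f
  / n), hence measurable for this \<sigma>-algebra, and measurability of all functionals already
  produces the Borel sets.\<close>

lemma trig_closure_indicator_borel:
  fixes A :: "'a::{real_normed_vector, second_countable_topology} set"
  assumes "A \<in> sets borel"
  shows "trig_closure (indicat_real A)"
proof -
  define S where "S = {A :: 'a set. trig_closure (indicat_real A)}"
  have S: "sigma_algebra UNIV S"
    unfolding sigma_algebra_iff2
  proof (intro conjI ballI allI impI)
    show "{} \<in> S" using trig_closure_const[of 0] by (simp add: S_def indicator_def[abs_def])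
  next
    fix A assume "A \<in> S"
    then have "trig_closure (\<lambda>x. 1 - indicat_real A x)" by (auto simp: S_def intro: trig_closure_one_minus)
    moreover have "(\<lambda>x. 1 - indicat_real A x) = indicat_real (UNIV - A)" by (auto simp: indicator_def)
    ultimately show "UNIV - A \<in> S" by (simp add: S_def)
  next
    fix A :: "nat \<Rightarrow> 'a set" assume A: "range A \<subseteq> S"
    show "\<Union> (range A) \<in> S" unfolding S_def mem_Collect_eq
    proof (rule trig_closure.lim[of "\<lambda>n. indicat_real (\<Union>i<n. A i)" 1])
      show "trig_closure (indicat_real (\<Union>i<n. A i))" for n
      proof (induction n)
        case 0
        then show ?case using trig_closure_const[of 0] by (simp add: indicator_def[abs_def])
      next
        case (Suc n)
        have "trig_closure (indicat_real (A n))" using A by (auto simp: S_def)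
        from trig_closure_indicator_Un[OF this Suc] show ?case by (simp add: lessThan_Suc)
      qed
      show "(\<lambda>n. indicat_real (\<Union>i<n. A i) x) \<longlonglongrightarrow> indicat_real (\<Union> (range A)) x" for x
        by (rule LIMSEQ_indicator_UN)
    qed (auto simp: indicator_def)
  qed simp
  define N where "N = sigma UNIV S"
  have N: "space N = UNIV" "sets N = S"
    using S by (auto simp: N_def sigma_algebra.sigma_sets_eq)
  have meas: "u \<in> borel_measurable N" if "trig_closure u" for u
    unfolding borel_measurable_iff_greater using trig_closure_indicator_greater[OF that]
    by (simp add: N S_def)
  have "blinfun_apply f \<in> borel_measurable N" for f :: "'a \<Rightarrow>\<^sub>L real"
  proof (rule borel_measurable_LIMSEQ_real)
    fix n :: nat
    have "trig_closure (\<lambda>x. real (Suc n) * cos (blinfun_apply ((1 / real (Suc n)) *\<^sub>R f) x + (- (pi/2))))"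
      by (intro trig_closure.scale trig_closure.cos)
    moreover have "cos (y + (- (pi/2))) = sin y" for y :: real by (simp add: cos_diff)
    ultimately have "trig_closure (\<lambda>x. real (Suc n) * sin (f x / real (Suc n)))"
      by (simp add: blinfun.scaleR_left)
    then show "(\<lambda>x. real (Suc n) * sin (f x / real (Suc n))) \<in> borel_measurable N" by (rule meas)
  next
    fix x
    have "((\<lambda>s. sin (f x * s)) has_real_derivative f x) (at 0)"
      by (auto intro!: derivative_eq_intros)
    then have "(\<lambda>s. sin (f x * s) / s) \<midarrow>0\<rightarrow> f x"
      by (simp add: has_field_derivative_iff)
    moreover have "filterlim (\<lambda>n. inverse (real (Suc n))) (at 0) sequentially"
      using LIMSEQ_inverse_real_of_nat by (auto simp: filterlim_at)
    ultimately have "(\<lambda>n. sin (f x * inverse (real (Suc n))) / inverse (real (Suc n))) \<longlonglongrightarrow> f x"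
      by (rule filterlim_compose)
    then show "(\<lambda>n. real (Suc n) * sin (f x / real (Suc n))) \<longlonglongrightarrow> f x"
      by (simp add: field_simps)
  qed
  from borel_measurable_weakly[OF N(1) this] assms show ?thesis by (auto simp: N S_def)
qed

lemma trig_closure_borel_nonneg:
  fixes u :: "'a::{real_normed_vector, second_countable_topology} \<Rightarrow> real"
  assumes "u \<in> borel_measurable borel" "\<And>x. 0 \<le> u x"
  shows "(\<And>x. u x \<le> K) \<Longrightarrow> trig_closure u"
  using assms
proof (induction u arbitrary: K rule: borel_measurable_induct_real)
  case (set A)
  then show ?case by (rule_tac trig_closure_indicator_borel)
next
  case (mult u c)
  show ?case
  proof (cases "c = 0")
    case True
    then show ?thesis using trig_closure_const[of 0] by simp
  next
    case False
    then have c: "c > 0" using mult by simp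
    have "trig_closure u"
      by (rule mult.IH[of "K / c"]) (use mult.prems c in \<open>simp add: field_simps\<close>)
    then show ?thesis by (rule trig_closure.scale)
  qed
next
  case (add u v)
  have "u x \<le> K" "v x \<le> K" for x
    using add.prems[of x] add.hyps(2,4)[of x] by (auto intro: order_trans[rotated])
  then show ?case using add.IH by (intro trig_closure.add) blast+
next
  case (seq U)
  have UK: "U i x \<le> K" for i x
  proof -
    have "incseq (\<lambda>i. U i x)" using seq.hyps by (auto simp: incseq_def le_fun_def)
    then have "U i x \<le> u x" using seq.hyps(4)[of x] by (intro incseq_le) auto
    then show ?thesis using seq.prems[of x] by simp
  qed
  show ?case
    by (rule trig_closure.lim[of U K, OF seq.IH[OF UK]]) (use UK seq.hyps in auto)
qed

lemma trig_closure_borel: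
  fixes u :: "'a::{real_normed_vector, second_countable_topology} \<Rightarrow> real"
  assumes u: "u \<in> borel_measurable borel" and K: "\<And>x. \<bar>u x\<bar> \<le> K"
  shows "trig_closure u"
proof -
  have "trig_closure (\<lambda>x. u x + K)"
  proof (rule trig_closure_borel_nonneg[of _ "2 * K"])
    show "0 \<le> u x + K" "u x + K \<le> 2 * K" for x using K[of x] by auto
  qed (use u in measurable)
  from trig_closure.add[OF this trig_closure_const[of "- K"]] show ?thesis by simp
qed

text \<open>The closure steps supply measurability and bounds in addition to P: when P is an
  integral identity, additivity needs integrability and the limit needs a dominating
  constant.\<close>

lemma trig_monotone_class [consumes 2, case_names cos add scale lim]:
  fixes u :: "'a::{real_normed_vector, second_countable_topology} \<Rightarrow> real"
  assumes u: "u \<in> borel_measurable borel" and K: "\<And>x. \<bar>u x\<bar> \<le> K"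
    and cos: "\<And>f \<theta>. P (\<lambda>x. cos (blinfun_apply f x + \<theta>))"
    and add: "\<And>u v A B. u \<in> borel_measurable borel \<Longrightarrow> v \<in> borel_measurable borel \<Longrightarrow>
      (\<And>x. \<bar>u x\<bar> \<le> A) \<Longrightarrow> (\<And>x. \<bar>v x\<bar> \<le> B) \<Longrightarrow> P u \<Longrightarrow> P v \<Longrightarrow> P (\<lambda>x. u x + v x)"
    and scale: "\<And>c u A. u \<in> borel_measurable borel \<Longrightarrow> (\<And>x. \<bar>u x\<bar> \<le> A) \<Longrightarrow> P u \<Longrightarrow> P (\<lambda>x. c * u x)"
    and lim: "\<And>U v A. (\<And>n. U n \<in> borel_measurable borel) \<Longrightarrow> v \<in> borel_measurable borel \<Longrightarrow> (\<And>n x. \<bar>U n x\<bar> \<le> A) \<Longrightarrow>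
      (\<And>x. (\<lambda>n::nat. U n x) \<longlonglongrightarrow> v x) \<Longrightarrow> (\<And>n. P (U n)) \<Longrightarrow> P v"
  shows "P u"
proof -
  have "trig_closure u" using u K by (rule trig_closure_borel)
  then have "u \<in> borel_measurable borel \<and> P u"
  proof (induction rule: trig_closure.induct)
    case (add u v)
    obtain A B where "\<And>x. \<bar>u x\<bar> \<le> A" "\<And>x. \<bar>v x\<bar> \<le> B"
      using trig_closure_bounded[OF add.hyps(1)] trig_closure_bounded[OF add.hyps(2)] by blast
    with add.IH assms(4)[of u v A B] show ?case by (simp add: borel_measurable_add)
  next
    case (scale u c)
    obtain A where "\<And>x. \<bar>u x\<bar> \<le> A" using trig_closure_bounded[OF scale.hyps(1)] by blast
    with scale.IH assms(5)[of u A c] show ?case by (simp add: borel_measurable_times)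
  next
    case (lim U K v)
    then have "v \<in> borel_measurable borel" by (blast intro: borel_measurable_LIMSEQ_real)
    then show ?case using lim assms(6)[of U v K] by blast
  next
    case (cos f \<theta>)
    have "(\<lambda>x. cos (blinfun_apply f x + \<theta>)) \<in> borel_measurable borel"
      by (intro borel_measurable_continuous_onI continuous_intros)
    then show ?case using assms(3) by blast
  qed
  then show ?thesis by simp
qed

lemma sets_borel_prod [simp]:
  "sets (borel \<Otimes>\<^sub>M borel :: ('a::second_countable_topology \<times> 'b::second_countable_topology) measure) = sets borel"
  by (rule arg_cong[OF borel_prod])

text \<open>A real form of the uniqueness theorem for characteristic functions: the phases 0 and
  -\<pi>/2 carry the real and the imaginary part. Being based on the monotone class, it holds in
  infinite dimension.\<close>

lemma measure_eqI_cos: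
  fixes \<mu>1 \<mu>2 :: "'a::{real_normed_vector, second_countable_topology} measure"
  assumes fin: "finite_measure \<mu>1" "finite_measure \<mu>2"
    and sets: "sets \<mu>1 = sets borel" "sets \<mu>2 = sets borel"
    and eq: "\<And>f (\<theta> :: real). (LINT x|\<mu>1. cos (blinfun_apply f x + \<theta>)) = (LINT x|\<mu>2. cos (blinfun_apply f x + \<theta>))"
  shows "\<mu>1 = \<mu>2"
proof (rule measure_eqI)
  interpret m1: finite_measure \<mu>1 by fact
  interpret m2: finite_measure \<mu>2 by fact
  have int: "integrable \<mu>1 u" "integrable \<mu>2 u"
    if "u \<in> borel_measurable borel" "\<And>x. \<bar>u x\<bar> \<le> K" for u :: "'a \<Rightarrow> real" and K
    using that measurable_cong_sets[OF sets(1) refl, of borel] measurable_cong_sets[OF sets(2) refl, of borel]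
    by (auto intro!: m1.integrable_const_bound[of _ K] m2.integrable_const_bound[of _ K])
  fix A assume "A \<in> sets \<mu>1"
  then have A: "A \<in> sets borel" by (simp add: sets)
  have "(LINT x|\<mu>1. indicat_real A x) = (LINT x|\<mu>2. indicat_real A x)"
  proof (rule trig_monotone_class[of "indicat_real A" 1])
    show "(LINT x|\<mu>1. u x + v x) = (LINT x|\<mu>2. u x + v x)"
      if "u \<in> borel_measurable borel" "v \<in> borel_measurable borel" "\<And>x. \<bar>u x\<bar> \<le> A" "\<And>x. \<bar>v x\<bar> \<le> B"
        "(LINT x|\<mu>1. u x) = (LINT x|\<mu>2. u x)" "(LINT x|\<mu>1. v x) = (LINT x|\<mu>2. v x)" for u v :: "'a \<Rightarrow> real" and A B
      using int[OF that(1,3)] int[OF that(2,4)] that by simp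
    show "(LINT x|\<mu>1. v x) = (LINT x|\<mu>2. v x)"
      if U: "\<And>n. U n \<in> borel_measurable borel" and v: "v \<in> borel_measurable borel"
        and bd: "\<And>n x. \<bar>U n x\<bar> \<le> A" and lim: "\<And>x. (\<lambda>n. U n x) \<longlonglongrightarrow> v x"
        and IH: "\<And>n. (LINT x|\<mu>1. U n x) = (LINT x|\<mu>2. U n x)" for U :: "nat \<Rightarrow> 'a \<Rightarrow> real" and v A
    proof (rule LIMSEQ_unique)
      note m = measurable_cong_sets[OF sets(1) refl, of borel] measurable_cong_sets[OF sets(2) refl, of borel]
      show "(\<lambda>n. LINT x|\<mu>1. U n x) \<longlonglongrightarrow> (LINT x|\<mu>1. v x)"
        using U v bd lim by (intro integral_dominated_convergence[where w = "\<lambda>_. A"]) (auto simp: m)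
      show "(\<lambda>n. LINT x|\<mu>1. U n x) \<longlonglongrightarrow> (LINT x|\<mu>2. v x)"
        unfolding IH
        using U v bd lim by (intro integral_dominated_convergence[where w = "\<lambda>_. A"]) (auto simp: m)
    qed
  qed (use A eq in auto)
  then have "measure \<mu>1 A = measure \<mu>2 A"
    using A sets m1.integrable_const by (simp add: sets_eq_imp_space_eq[OF sets(1)] sets_eq_imp_space_eq[OF sets(2)])
  then show "emeasure \<mu>1 A = emeasure \<mu>2 A"
    by (simp add: m1.emeasure_eq_measure m2.emeasure_eq_measure)
qed (simp add: sets)

section \<open>Gaussian measures\<close>

locale centered_gaussian =
  fixes \<gamma> :: "'a::{banach, second_countable_topology} measure"
  assumes gaussian: "gaussian_measure \<gamma>" and centered: "centered \<gamma>"
begin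

sublocale prob_space \<gamma>
  using gaussian by (simp add: gaussian_measure_def)

lemma sets_gauss [simp, measurable_cong]: "sets \<gamma> = sets borel"
  using gaussian by (simp add: gaussian_measure_def)

lemma space_gauss [simp]: "space \<gamma> = UNIV"
  using sets_eq_imp_space_eq[OF sets_gauss] by simp

lemma measurable_gauss [simp]: "measurable \<gamma> N = measurable borel N"
  by (rule measurable_cong_sets) simp_all

lemma prob_UNIV [simp]: "prob UNIV = 1"
  using prob_space by simp

lemma blinfun_measurable [measurable]: "blinfun_apply (f :: 'a \<Rightarrow>\<^sub>L real) \<in> borel_measurable borel"
  by (intro borel_measurable_continuous_onI continuous_intros)

definition cov :: "('a \<Rightarrow>\<^sub>L real) \<Rightarrow> ('a \<Rightarrow>\<^sub>L real) \<Rightarrow> real" where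
  "cov f g = (LINT x|\<gamma>. f x * g x)"

lemma integrable_id: "integrable \<gamma> (\<lambda>x. x)" and integral_id: "(LINT x|\<gamma>. x) = 0"
  using centered unfolding centered_def has_bochner_integral_iff by auto

lemma integrable_blinfun: "integrable \<gamma> (blinfun_apply f)" for f :: "'a \<Rightarrow>\<^sub>L real"
  by (rule integrable_bounded_linear[OF blinfun.bounded_linear_right integrable_id])

lemma integral_blinfun [simp]: "(LINT x|\<gamma>. blinfun_apply f x) = 0" for f :: "'a \<Rightarrow>\<^sub>L real"
  using integral_bounded_linear[OF blinfun.bounded_linear_right integrable_id, of f]
  by (simp add: integral_id blinfun.zero_right)

lemma blinfun_law:
  fixes f :: "'a \<Rightarrow>\<^sub>L real"
  shows "(AE x in \<gamma>. f x = 0) \<or> (\<exists>\<sigma>>0. distributed \<gamma> lborel (blinfun_apply f) (normal_density 0 \<sigma>))"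
proof -
  obtain m \<sigma> where \<sigma>: "\<sigma> \<ge> 0" and d: "distr \<gamma> borel (blinfun_apply f) =
      (if \<sigma> = 0 then return borel m else density lborel (\<lambda>x. ennreal (normal_density m \<sigma> x)))"
    using gaussian unfolding gaussian_measure_def by blast
  have distr': "distr \<gamma> lborel (blinfun_apply f) = distr \<gamma> borel (blinfun_apply f)"
    by (rule distr_cong) auto
  show ?thesis
  proof (cases "\<sigma> = 0")
    case True
    then have "AE y in distr \<gamma> borel (blinfun_apply f). y = m" unfolding d by (simp add: AE_return[where P = "\<lambda>y. y = m"])
    then have ae: "AE x in \<gamma>. f x = m" by (subst (asm) AE_distr_iff) auto
    have "0 = (LINT x|\<gamma>. f x)" by simp
    also have "\<dots> = (LINT x|\<gamma>. m)" using ae by (intro integral_cong_AE) auto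
    finally have "m = 0" by (simp add: prob_space)
    with ae show ?thesis by simp
  next
    case False
    then have s: "\<sigma> > 0" using \<sigma> by simp
    have D: "distributed \<gamma> lborel (blinfun_apply f) (normal_density m \<sigma>)"
      unfolding distributed_def distr' d using False by auto
    have "m = 0" using normal_distributed_expectation[OF s D] by simp
    with D s show ?thesis by blast
  qed
qed

lemma blinfun_law_moments:
  fixes f :: "'a \<Rightarrow>\<^sub>L real"
  assumes s: "\<sigma> > 0" and D: "distributed \<gamma> lborel (blinfun_apply f) (normal_density 0 \<sigma>)"
  shows "integrable \<gamma> (\<lambda>x. (f x)\<^sup>2)" "cov f f = \<sigma>\<^sup>2"
    "(LINT x|\<gamma>. cos (f x)) = exp (- \<sigma>\<^sup>2 / 2)" "(LINT x|\<gamma>. sin (f x)) = 0"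
proof -
  show "integrable \<gamma> (\<lambda>x. (f x)\<^sup>2)"
    using distributed_integrable[OF D, of "\<lambda>x. x\<^sup>2"] integrable_normal_moment[OF s, of 0 2] by simp
  show "cov f f = \<sigma>\<^sup>2"
    using normal_distributed_variance[OF s D] by (simp add: cov_def power2_eq_square)
  have S: "distributed \<gamma> lborel (\<lambda>x. f x / \<sigma>) std_normal_density"
    using normal_standard_normal_convert[OF s, of "blinfun_apply f" 0] D by simp
  have std: "distr \<gamma> lborel (\<lambda>x. f x / \<sigma>) = std_normal_distribution"
    using distributed_distr_eq_density[OF S] by simp
  have "char std_normal_distribution \<sigma> = (CLINT x|\<gamma>. iexp (\<sigma> * (f x / \<sigma>)))"
    unfolding char_def std[symmetric] by (subst integral_distr) auto
  then have e: "(CLINT x|\<gamma>. iexp (f x)) = exp (- \<sigma>\<^sup>2 / 2)"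
    using s by (simp add: char_std_normal_distribution)
  have i: "complex_integrable \<gamma> (\<lambda>x. iexp (f x))" by (intro integrable_const_bound[of _ 1]) auto
  have "(LINT x|\<gamma>. Re (iexp (f x))) = Re (CLINT x|\<gamma>. iexp (f x))" using i by simp
  then show "(LINT x|\<gamma>. cos (f x)) = exp (- \<sigma>\<^sup>2 / 2)" unfolding e by (simp add: Re_exp)
  have "(LINT x|\<gamma>. Im (iexp (f x))) = Im (CLINT x|\<gamma>. iexp (f x))" using i by simp
  then show "(LINT x|\<gamma>. sin (f x)) = 0" unfolding e by (simp add: Im_exp)
qed

lemma integrable_blinfun_power2 [simp]: "integrable \<gamma> (\<lambda>x. (f x)\<^sup>2)" for f :: "'a \<Rightarrow>\<^sub>L real"
proof (cases "AE x in \<gamma>. f x = 0")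
  case True
  then have "integrable \<gamma> (\<lambda>x. (f x)\<^sup>2) \<longleftrightarrow> integrable \<gamma> (\<lambda>x. 0 :: real)"
    by (intro integrable_cong_AE) auto
  then show ?thesis by simp
qed (use blinfun_law blinfun_law_moments in blast)

lemma cos_integral_0:
  fixes f :: "'a \<Rightarrow>\<^sub>L real"
  shows "(LINT x|\<gamma>. cos (f x)) = exp (- cov f f / 2) \<and> (LINT x|\<gamma>. sin (f x)) = 0"
proof (cases "AE x in \<gamma>. f x = 0")
  case True
  have "cov f f = (LINT x|\<gamma>. 0)" unfolding cov_def using True by (intro integral_cong_AE) auto
  moreover have "(LINT x|\<gamma>. cos (f x)) = (LINT x|\<gamma>. 1)" using True by (intro integral_cong_AE) auto
  moreover have "(LINT x|\<gamma>. sin (f x)) = (LINT x|\<gamma>. 0)" using True by (intro integral_cong_AE) auto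
  ultimately show ?thesis by (simp add: prob_space)
qed (use blinfun_law[of f] blinfun_law_moments[of _ f] in auto)

lemma cos_integral:
  fixes f :: "'a \<Rightarrow>\<^sub>L real"
  shows "(LINT x|\<gamma>. cos (f x + \<theta>)) = cos \<theta> * exp (- cov f f / 2)"
proof -
  have "integrable \<gamma> (\<lambda>x. cos (f x))" "integrable \<gamma> (\<lambda>x. sin (f x))"
    by (auto intro!: integrable_const_bound[of _ 1])
  then show ?thesis using cos_integral_0[of f] by (simp add: cos_add)
qed

lemma integrable_blinfun_mult [simp]:
  "integrable \<gamma> (\<lambda>x. f x * g x)" for f g :: "'a \<Rightarrow>\<^sub>L real"
proof (rule Bochner_Integration.integrable_bound)
  show "integrable \<gamma> (\<lambda>x. (f x)\<^sup>2 + (g x)\<^sup>2)" by simp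
  have "\<bar>a * b\<bar> \<le> a\<^sup>2 + b\<^sup>2" for a b :: real
  proof -
    have "2 * \<bar>a * b\<bar> \<le> a\<^sup>2 + b\<^sup>2" using sum_squares_bound[of "\<bar>a\<bar>" "\<bar>b\<bar>"] by (simp add: abs_mult)
    then show ?thesis using abs_ge_zero[of "a * b"] by linarith
  qed
  then show "AE x in \<gamma>. norm (f x * g x) \<le> norm ((f x)\<^sup>2 + (g x)\<^sup>2)" by simp
qed simp

lemma cov_add_left: "cov (f + g) h = cov f h + cov g h"
  and cov_add_right: "cov h (f + g) = cov h f + cov h g"
  and cov_scale_left: "cov (c *\<^sub>R f) g = c * cov f g"
  and cov_scale_right: "cov f (c *\<^sub>R g) = c * cov f g"
  and cov_diff_left: "cov (f - g) h = cov f h - cov g h"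
  and cov_diff_right: "cov h (f - g) = cov h f - cov h g"
  and cov_minus_left: "cov (- f) g = - cov f g"
  and cov_minus_right: "cov f (- g) = - cov f g"
  by (simp_all add: cov_def blinfun.add_left blinfun.scaleR_left blinfun.diff_left blinfun.minus_left
      distrib_right distrib_left left_diff_distrib right_diff_distrib mult.left_commute mult.assoc)

lemma cov_commute: "cov f g = cov g f"
  by (simp add: cov_def mult.commute)

lemma cov_nonneg: "0 \<le> cov f f"
  by (simp add: cov_def)

lemmas cov_simps = cov_add_left cov_add_right cov_scale_left cov_scale_right cov_diff_left
  cov_diff_right cov_minus_left cov_minus_right

text \<open>Gaussian integration by parts without densities: the mean of cos (g + t f + \<theta>) is
  explicit in t by \<open>cos_integral\<close>, and differentiation at t = 0 produces the factor f
  on one side and \<open>cov f g\<close> on the other.\<close>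

lemma cov_sin_integral:
  fixes f g :: "'a \<Rightarrow>\<^sub>L real"
  shows "(LINT x|\<gamma>. f x * sin (g x + \<theta>)) = cov f g * cos \<theta> * exp (- cov g g / 2)"
proof -
  define s where "s n = inverse (real (Suc n))" for n
  have s0: "filterlim s (at 0) sequentially"
    unfolding s_def using LIMSEQ_inverse_real_of_nat by (auto simp: filterlim_at)
  define D where "D n x = (cos (g x + \<theta> + s n * f x) - cos (g x + \<theta>)) / s n" for n x
  have "(\<lambda>n. LINT x|\<gamma>. D n x) \<longlonglongrightarrow> (LINT x|\<gamma>. - (f x * sin (g x + \<theta>)))"
  proof (rule integral_dominated_convergence[where w = "\<lambda>x. \<bar>f x\<bar>"])
    show "integrable \<gamma> (\<lambda>x. \<bar>f x\<bar>)" using integrable_blinfun by simp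
    show "AE x in \<gamma>. (\<lambda>n. D n x) \<longlonglongrightarrow> - (f x * sin (g x + \<theta>))"
    proof (rule AE_I2)
      fix x
      have "((\<lambda>t. cos (g x + \<theta> + t * f x)) has_real_derivative - (f x * sin (g x + \<theta>))) (at 0)"
        by (auto intro!: derivative_eq_intros)
      then have "(\<lambda>t. (cos (g x + \<theta> + t * f x) - cos (g x + \<theta>)) / t) \<midarrow>0\<rightarrow> - (f x * sin (g x + \<theta>))"
        by (simp add: has_field_derivative_iff)
      from filterlim_compose[OF this s0] show "(\<lambda>n. D n x) \<longlonglongrightarrow> - (f x * sin (g x + \<theta>))"
        by (simp add: D_def)
    qed
    show "AE x in \<gamma>. norm (D n x) \<le> \<bar>f x\<bar>" for n
    proof (rule AE_I2)
      fix x
      have s: "s n > 0" by (simp add: s_def)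
      have lip: "\<bar>cos u - cos v\<bar> \<le> \<bar>u - v\<bar>" for u v :: real
      proof -
        have "\<bar>cos u - cos v\<bar> = 2 * \<bar>sin ((u + v) / 2)\<bar> * \<bar>sin ((v - u) / 2)\<bar>"
          by (simp add: cos_diff_cos abs_mult)
        also have "\<dots> \<le> 2 * 1 * \<bar>(v - u) / 2\<bar>"
          by (intro mult_mono abs_sin_x_le_abs_x) auto
        finally show ?thesis by simp
      qed
      have "\<bar>cos (g x + \<theta> + s n * f x) - cos (g x + \<theta>)\<bar> \<le> \<bar>s n * f x\<bar>"
        using lip[of "g x + \<theta> + s n * f x" "g x + \<theta>"] by simp
      then show "norm (D n x) \<le> \<bar>f x\<bar>" using s by (simp add: D_def abs_mult field_simps)
    qed
  qed (auto simp: D_def)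
  moreover have "(\<lambda>n. LINT x|\<gamma>. D n x) \<longlonglongrightarrow> - (cov f g * cos \<theta> * exp (- cov g g / 2))"
  proof -
    define q where "q t = cos \<theta> * exp (- (cov g g + 2 * t * cov f g + t\<^sup>2 * cov f f) / 2)" for t
    have int: "integrable \<gamma> (\<lambda>x. cos (g x + \<theta> + t * f x))" for t
      by (auto intro!: integrable_const_bound[of _ 1])
    have q: "(LINT x|\<gamma>. cos (g x + \<theta> + t * f x)) = q t" for t
    proof -
      have "(LINT x|\<gamma>. cos (g x + \<theta> + t * f x)) = (LINT x|\<gamma>. cos (blinfun_apply (g + t *\<^sub>R f) x + \<theta>))"
        by (simp add: blinfun.add_left blinfun.scaleR_left add_ac)
      also have "\<dots> = q t"
        unfolding cos_integral q_def by (simp add: cov_simps cov_commute[of g f] power2_eq_square algebra_simps)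
      finally show ?thesis .
    qed
    have "(LINT x|\<gamma>. D n x) = (q (s n) - q 0) / s n" for n
      unfolding D_def using q[of 0] q[of "s n"] int[of 0] int[of "s n"] by simp
    moreover have "(q has_real_derivative - (cov f g * cos \<theta> * exp (- cov g g / 2))) (at 0)"
      unfolding q_def by (auto intro!: derivative_eq_intros)
    then have "(\<lambda>t. (q t - q 0) / t) \<midarrow>0\<rightarrow> - (cov f g * cos \<theta> * exp (- cov g g / 2))"
      by (simp add: has_field_derivative_iff)
    ultimately show ?thesis using filterlim_compose[OF _ s0] by simp
  qed
  ultimately have "(LINT x|\<gamma>. - (f x * sin (g x + \<theta>))) = - (cov f g * cos \<theta> * exp (- cov g g / 2))"
    by (rule LIMSEQ_unique)
  then show ?thesis by simp
qed

lemma cov_cos_integral: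
  fixes f g :: "'a \<Rightarrow>\<^sub>L real"
  shows "(LINT x|\<gamma>. f x * cos (g x + \<theta>)) = - (cov f g * sin \<theta> * exp (- cov g g / 2))"
  using cov_sin_integral[of f g "\<theta> + pi/2"] by (simp add: sin_add cos_add)

section \<open>The product measure, its rotations, and the tail of the norm\<close>

sublocale pp: pair_prob_space \<gamma> \<gamma> ..

abbreviation GG :: "('a \<times> 'a) measure" where "GG \<equiv> \<gamma> \<Otimes>\<^sub>M \<gamma>"

lemma space_gauss2 [simp]: "space GG = UNIV"
  by (simp add: space_pair_measure)

lemma sets_gauss2 [simp]: "sets GG = sets borel"
  unfolding borel_prod[symmetric] by (rule sets_pair_measure_cong) simp_all

lemma measure_times:
  assumes "A \<in> sets borel" "B \<in> sets borel"
  shows "measure GG (A \<times> B) = prob A * prob B"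
  using assms by (simp add: measure_def emeasure_pair_measure_Times enn2real_mult)

lemma cos_integral_pair:
  fixes f g :: "'a \<Rightarrow>\<^sub>L real"
  shows "(LINT p|GG. cos (f (fst p) + g (snd p) + \<theta>)) = cos \<theta> * exp (- (cov f f + cov g g) / 2)"
proof -
  have "integrable GG (\<lambda>(x, y). cos (f x + g y + \<theta>))"
    by (intro pp.P.integrable_const_bound[of _ 1]) auto
  from pp.integral_fst'[OF this, symmetric]
  have "(LINT p|GG. cos (f (fst p) + g (snd p) + \<theta>)) = (LINT x|\<gamma>. LINT y|\<gamma>. cos (f x + g y + \<theta>))"
    by (simp add: case_prod_unfold)
  also have "\<dots> = (LINT x|\<gamma>. LINT y|\<gamma>. cos (g y + (f x + \<theta>)))"
    by (simp add: add_ac)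
  also have "\<dots> = (LINT x|\<gamma>. cos (f x + \<theta>) * exp (- cov g g / 2))"
    by (simp only: cos_integral)
  also have "\<dots> = cos \<theta> * (exp (- cov f f / 2) * exp (- cov g g / 2))"
    by (simp add: cos_integral)
  also have "\<dots> = cos \<theta> * exp (- (cov f f + cov g g) / 2)"
    by (simp add: exp_add[symmetric] add_divide_distrib)
  finally show ?thesis .
qed

lemma blinfun_prod_split:
  fixes f :: "('a \<times> 'a) \<Rightarrow>\<^sub>L real"
  obtains f1 f2 :: "'a \<Rightarrow>\<^sub>L real" where "\<And>x y. f (x, y) = f1 x + f2 y"
proof -
  have 1: "bounded_linear (\<lambda>x. f (x, 0))" and 2: "bounded_linear (\<lambda>y. f (0, y))"
    by (auto intro!: bounded_linear_compose[OF blinfun.bounded_linear_right] bounded_linear_Pair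
        bounded_linear_ident bounded_linear_zero)
  have "f (x, y) = Blinfun (\<lambda>x. f (x, 0)) x + Blinfun (\<lambda>y. f (0, y)) y" for x y
    using blinfun.add_right[of f "(x, 0)" "(0, y)"] by (simp add: bounded_linear_Blinfun_apply 1 2)
  then show ?thesis by (rule that)
qed

definition rot :: "real \<Rightarrow> real \<Rightarrow> 'a \<times> 'a \<Rightarrow> 'a \<times> 'a" where
  "rot c s p = (c *\<^sub>R fst p + s *\<^sub>R snd p, c *\<^sub>R snd p - s *\<^sub>R fst p)"

lemma rot_measurable [measurable]: "rot c s \<in> measurable borel borel"
  unfolding rot_def[abs_def] by (intro borel_measurable_continuous_onI continuous_intros)

text \<open>The cross terms with \<open>cov f1 f2\<close> cancel after a rotation, and the sum of
  the variances is multiplied by c^2 + s^2 = 1; cosines of functionals on the product therefore keep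
  their mean.\<close>

lemma distr_rot:
  assumes cs: "c\<^sup>2 + s\<^sup>2 = 1"
  shows "distr GG borel (rot c s) = GG"
proof (rule measure_eqI_cos)
  have m: "rot c s \<in> measurable GG borel"
    by (simp add: measurable_cong_sets[OF sets_gauss2 refl])
  show "finite_measure (distr GG borel (rot c s))" using m by (rule pp.P.finite_measure_distr)
  show "finite_measure GG" by (rule pp.P.finite_measure_axioms)
  fix f :: "('a \<times> 'a) \<Rightarrow>\<^sub>L real" and \<theta>
  obtain f1 f2 :: "'a \<Rightarrow>\<^sub>L real" where f: "\<And>x y. f (x, y) = f1 x + f2 y" using blinfun_prod_split[of f] by blast
  have [measurable]: "(\<lambda>p. cos (f p + \<theta>)) \<in> borel_measurable borel"
    by (intro borel_measurable_continuous_onI continuous_intros)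
  have "(LINT p|distr GG borel (rot c s). cos (f p + \<theta>)) = (LINT p|GG. cos (f (rot c s p) + \<theta>))"
    by (rule integral_distr[OF m]) simp
  also have "\<dots> = (LINT p|GG. cos ((c *\<^sub>R f1 - s *\<^sub>R f2) (fst p) + (s *\<^sub>R f1 + c *\<^sub>R f2) (snd p) + \<theta>))"
    by (simp add: rot_def f blinfun.add_right blinfun.diff_right blinfun.scaleR_right
        blinfun.add_left blinfun.diff_left blinfun.scaleR_left algebra_simps)
  also have "\<dots> = cos \<theta> * exp (- ((c\<^sup>2 + s\<^sup>2) * (cov f1 f1 + cov f2 f2)) / 2)"
    unfolding cos_integral_pair by (simp add: cov_simps cov_commute[of f2 f1] power2_eq_square algebra_simps)
  also have "\<dots> = (LINT p|GG. cos (f1 (fst p) + f2 (snd p) + \<theta>))"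
    unfolding cos_integral_pair cs by simp
  also have "\<dots> = (LINT p|GG. cos (f p + \<theta>))"
    by (intro Bochner_Integration.integral_cong refl) (metis f prod.collapse)
  finally show "(LINT p|distr GG borel (rot c s). cos (f p + \<theta>)) = (LINT p|GG. cos (f p + \<theta>))" .
qed simp_all

lemma distr_gauss_mix:
  assumes cs: "c\<^sup>2 + s\<^sup>2 = 1"
  shows "distr GG borel (\<lambda>p. c *\<^sub>R fst p + s *\<^sub>R snd p) = \<gamma>"
proof (rule measure_eqI_cos)
  have "(\<lambda>p :: 'a \<times> 'a. c *\<^sub>R fst p + s *\<^sub>R snd p) \<in> borel_measurable borel"
    by (intro borel_measurable_continuous_onI continuous_intros)
  then have m: "(\<lambda>p. c *\<^sub>R fst p + s *\<^sub>R snd p) \<in> measurable GG borel"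
    by (simp add: measurable_cong_sets[OF sets_gauss2 refl])
  show "finite_measure (distr GG borel (\<lambda>p. c *\<^sub>R fst p + s *\<^sub>R snd p))"
    using m by (rule pp.P.finite_measure_distr)
  show "finite_measure \<gamma>" by (rule finite_measure_axioms)
  fix f :: "'a \<Rightarrow>\<^sub>L real" and \<theta>
  have "(LINT p|distr GG borel (\<lambda>p. c *\<^sub>R fst p + s *\<^sub>R snd p). cos (f p + \<theta>))
      = (LINT p|GG. cos (f (c *\<^sub>R fst p + s *\<^sub>R snd p) + \<theta>))"
    by (rule integral_distr[OF m]) simp
  also have "\<dots> = (LINT p|GG. cos ((c *\<^sub>R f) (fst p) + (s *\<^sub>R f) (snd p) + \<theta>))"
    by (simp add: blinfun.add_right blinfun.scaleR_right blinfun.scaleR_left)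
  also have "\<dots> = cos \<theta> * exp (- ((c\<^sup>2 + s\<^sup>2) * cov f f) / 2)"
    unfolding cos_integral_pair by (simp add: cov_simps power2_eq_square algebra_simps)
  also have "\<dots> = (LINT p|\<gamma>. cos (f p + \<theta>))"
    unfolding cos_integral cs by simp
  finally show "(LINT p|distr GG borel (\<lambda>p. c *\<^sub>R fst p + s *\<^sub>R snd p). cos (f p + \<theta>)) = (LINT p|\<gamma>. cos (f p + \<theta>))" .
qed simp_all

text \<open>Fernique's argument with an independent pair rotated by 45 degrees: if (x - y) / sqrt 2
  has norm at most r and (x + y) / sqrt 2 has norm above t, then x and y both have norm above (t -
  r) / sqrt 2.\<close>

lemma norm_tail_step:
  assumes "0 < t"
  shows "prob {x. norm x \<le> r} * prob {x. norm x > t} \<le> (prob {x. norm x > (t - r) / sqrt 2})\<^sup>2"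
proof -
  define k where "k = 1 / sqrt (2 :: real)"
  have k: "k > 0" "k * k = 1/2" by (auto simp: k_def)
  then have k2: "k\<^sup>2 + (- k)\<^sup>2 = 1" by (simp add: power2_eq_square)
  have m: "rot k (- k) \<in> measurable GG borel"
    by (simp add: measurable_cong_sets[OF sets_gauss2 refl])
  let ?A = "{x :: 'a. norm x \<le> r}" and ?B = "{x :: 'a. norm x > t}" and ?C = "{x :: 'a. norm x > (t - r) / sqrt 2}"
  have meas: "?A \<in> sets borel" "?B \<in> sets borel" "?C \<in> sets borel" by measurable
  have "prob ?A * prob ?B = measure GG (?A \<times> ?B)"
    using meas by (simp add: measure_times)
  also have "\<dots> = measure (distr GG borel (rot k (- k))) (?A \<times> ?B)"
    by (simp add: distr_rot[OF k2])
  also have "\<dots> = measure GG (rot k (- k) -` (?A \<times> ?B))"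
    using meas pair_measureI[of ?A borel ?B borel] by (subst measure_distr[OF m]) auto
  also have "\<dots> \<le> measure GG (?C \<times> ?C)"
  proof (rule pp.P.finite_measure_mono)
    show "?C \<times> ?C \<in> sets GG" using meas pair_measureI[of ?C borel ?C borel] by auto
    show "rot k (- k) -` (?A \<times> ?B) \<subseteq> ?C \<times> ?C"
    proof
      fix p assume "p \<in> rot k (- k) -` (?A \<times> ?B)"
      then have p: "norm (k *\<^sub>R fst p - k *\<^sub>R snd p) \<le> r" "norm (k *\<^sub>R snd p + k *\<^sub>R fst p) > t"
        by (auto simp: rot_def)
      have two: "(2 * k) *\<^sub>R y = k *\<^sub>R y + k *\<^sub>R y" for y :: 'a
        by (simp add: scaleR_add_left[symmetric])
      have "norm (k *\<^sub>R snd p + k *\<^sub>R fst p) \<le> norm ((2 * k) *\<^sub>R fst p) + norm (k *\<^sub>R fst p - k *\<^sub>R snd p)"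
        using norm_triangle_ineq4[of "(2 * k) *\<^sub>R fst p" "k *\<^sub>R fst p - k *\<^sub>R snd p"]
        by (simp add: two add.commute)
      moreover have "norm (k *\<^sub>R snd p + k *\<^sub>R fst p) \<le> norm ((2 * k) *\<^sub>R snd p) + norm (k *\<^sub>R fst p - k *\<^sub>R snd p)"
        using norm_triangle_ineq[of "(2 * k) *\<^sub>R snd p" "k *\<^sub>R fst p - k *\<^sub>R snd p"]
        by (simp add: two add.commute)
      moreover have nk: "norm ((2 * k) *\<^sub>R y) = sqrt 2 * norm y" for y :: 'a
        using k by (simp add: k_def field_simps)
      ultimately have "t - r < sqrt 2 * norm (fst p)" "t - r < sqrt 2 * norm (snd p)"
        using p nk[of "fst p"] nk[of "snd p"] by linarith+
      then show "p \<in> ?C \<times> ?C" by (cases p) (simp add: field_simps)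
    qed
  qed
  also have "\<dots> = (prob ?C)\<^sup>2" using meas by (simp add: measure_times power2_eq_square)
  finally show ?thesis .
qed


text \<open>Markov's inequality gives decay of order 1 / t. Each use of \<open>step\<close> squares
  the bound at a quarter of the radius, so two uses reach order t^-4, enough for a finite second
  moment.\<close>

lemma norm_tail_le:
  obtains C where "\<And>t. t > 0 \<Longrightarrow> prob {x. norm x > t} \<le> C / t ^ 4"
proof -
  define M where "M = (LINT x|\<gamma>. norm x) + 1"
  define p where "p t = prob {x. norm x > t}" for t
  have M: "M > 0" unfolding M_def by (intro add_nonneg_pos) auto
  have in_sets: "{x :: 'a. norm x > t} \<in> sets borel" "{x :: 'a. norm x \<le> t} \<in> sets borel" for t by measurable
  have p_nonneg: "0 \<le> p t" and p_le_1: "p t \<le> 1" for t by (auto simp: p_def)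
  have p_mono: "p t \<le> p r" if "r \<le> t" for r t
    unfolding p_def using that in_sets by (intro finite_measure_mono) auto
  have p1: "p t \<le> M / t" if "t > 0" for t
  proof -
    have "p t \<le> prob {x \<in> space \<gamma>. norm x \<ge> t}"
      unfolding p_def by (intro finite_measure_mono) auto
    also have "\<dots> \<le> (LINT x|\<gamma>. norm x) / t"
      using that integrable_id by (intro integral_Markov_inequality_measure[where A = "{}"]) auto
    also have "\<dots> \<le> M / t" using that by (simp add: M_def divide_right_mono)
    finally show ?thesis .
  qed
  \<comment> \<open>At this radius Markov's inequality leaves at least half of the mass inside the
    ball, which is the origin of the factor 2 in \<open>step\<close>.\<close>
  define r where "r = 2 * M"
  have r: "r > 0" using M by (simp add: r_def)
  have compl: "prob {x. norm x \<le> r} \<ge> 1 / 2"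
  proof -
    have "prob {x. norm x \<le> r} = 1 - p r"
      unfolding p_def using prob_compl[of "{x. norm x > r}"] in_sets
      by (simp add: Compl_eq_Diff_UNIV[symmetric] Collect_neg_eq[symmetric] not_less)
    moreover have "p r \<le> 1 / 2" using p1[OF r] M by (simp add: r_def)
    ultimately show ?thesis by simp
  qed
  have step: "p t \<le> 2 * (p (t / 4))\<^sup>2" if t: "t \<ge> 4 * r" for t
  proof -
    have "1 / 2 * p t \<le> prob {x. norm x \<le> r} * p t" using compl p_nonneg by (rule mult_right_mono)
    also have "\<dots> \<le> (p ((t - r) / sqrt 2))\<^sup>2"
      unfolding p_def using t r by (intro norm_tail_step) simp
    also have "\<dots> \<le> (p (t / 4))\<^sup>2"
    proof (intro power_mono p_mono p_nonneg)
      have "sqrt 2 \<le> 2" by (simp add: real_le_lsqrt real_sqrt_le_iff)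
      then have "t / 4 * sqrt 2 \<le> t / 4 * 2" using t r by (intro mult_left_mono) auto
      also have "\<dots> \<le> t - r" using t r by simp
      finally show "t / 4 \<le> (t - r) / sqrt 2" by (simp add: field_simps)
    qed
    finally show ?thesis by simp
  qed
  \<comment> \<open>The first summand is the outcome of two uses of \<open>step\<close>, legitimate
    for t \<ge> 16 r since then t and t / 4 are at least 4 r; the second one makes the right side at
    least 1 for smaller t.\<close>
  define C where "C = 2 * (512 * M\<^sup>2)\<^sup>2 + (16 * r) ^ 4"
  have "p t \<le> C / t ^ 4" if t: "t > 0" for t
  proof (cases "t \<ge> 16 * r")
    case True
    have "p (t / 4) \<le> 2 * (p (t / 4 / 4))\<^sup>2" using True r by (intro step) auto
    also have "\<dots> \<le> 2 * (M / (t / 4 / 4))\<^sup>2" using t p1[of "t / 4 / 4"] p_nonneg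
      by (intro mult_left_mono power_mono) auto
    also have "\<dots> = 512 * M\<^sup>2 / t\<^sup>2" by (simp add: power_divide power_mult_distrib)
    finally have q: "p (t / 4) \<le> 512 * M\<^sup>2 / t\<^sup>2" .
    have "p t \<le> 2 * (p (t / 4))\<^sup>2" using True r by (intro step) auto
    also have "\<dots> \<le> 2 * (512 * M\<^sup>2 / t\<^sup>2)\<^sup>2"
      using q p_nonneg by (intro mult_left_mono power_mono) auto
    also have "\<dots> = 2 * (512 * M\<^sup>2)\<^sup>2 / t ^ 4" by (simp add: power_divide)
    also have "\<dots> \<le> C / t ^ 4" using t r by (intro divide_right_mono) (auto simp: C_def)
    finally show ?thesis .
  next
    case False
    then have "t ^ 4 \<le> (16 * r) ^ 4" using t by (intro power_mono) auto
    also have "\<dots> \<le> C" by (simp add: C_def)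
    finally have "1 \<le> C / t ^ 4" using t by simp
    then show ?thesis using p_le_1[of t] by simp
  qed
  then show ?thesis by (intro that[of C]) (simp add: p_def)
qed

text \<open>A weak form of Fernique's theorem; the fourth order decay of the tail is enough.\<close>

lemma integrable_norm_power2: "integrable \<gamma> (\<lambda>x. (norm x)\<^sup>2)"
proof -
  obtain C where C: "\<And>t. t > 0 \<Longrightarrow> prob {x. norm x > t} \<le> C / t ^ 4" by (rule norm_tail_le) blast
  have C0: "0 \<le> C" using C[of 1] measure_nonneg[of \<gamma> "{x. norm x > 1}"] by (simp del: measure_nonneg)
  \<comment> \<open>A discrete layer-cake formula: m^2 is the sum of the odd numbers 2 n + 1 with n
    < m, so the squared norm is dominated by the sum of 2 n + 1 over all n below the norm.\<close>
  define b where "b n x = (2 * real n + 1) * indicat_real {z :: 'a. norm z > real n} x" for n :: nat and x :: 'a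
  have "(\<integral>\<^sup>+x. ennreal ((norm x)\<^sup>2) \<partial>\<gamma>) \<le> (\<integral>\<^sup>+x. (\<Sum>n. ennreal (b n x)) \<partial>\<gamma>)"
  proof (rule nn_integral_mono)
    fix x :: 'a
    define m where "m = nat \<lceil>norm x\<rceil>"
    have m: "norm x \<le> real m" "\<And>n. n < m \<Longrightarrow> real n < norm x"
      unfolding m_def by (auto simp: real_nat_ceiling_ge) linarith
    have sq: "(\<Sum>n<k. 2 * real n + 1) = (real k)\<^sup>2" for k
      by (induction k) (auto simp: power2_eq_square algebra_simps)
    have "(norm x)\<^sup>2 \<le> (real m)\<^sup>2" using m(1) by (intro power_mono) auto
    also have "\<dots> = (\<Sum>n<m. b n x)" unfolding sq[symmetric] by (intro sum.cong) (auto simp: b_def m(2))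
    finally have "ennreal ((norm x)\<^sup>2) \<le> ennreal (\<Sum>n<m. b n x)" by (rule ennreal_leI)
    also have "\<dots> = (\<Sum>n<m. ennreal (b n x))" by (subst sum_ennreal) (auto simp: b_def)
    also have "\<dots> \<le> (\<Sum>n. ennreal (b n x))" by (intro sum_le_suminf) auto
    finally show "ennreal ((norm x)\<^sup>2) \<le> (\<Sum>n. ennreal (b n x))" .
  qed
  also have "\<dots> = (\<Sum>n. \<integral>\<^sup>+x. ennreal (b n x) \<partial>\<gamma>)"
    by (rule nn_integral_suminf) (auto simp: b_def)
  also have "\<dots> = (\<Sum>n. ennreal ((2 * real n + 1) * prob {x. norm x > real n}))"
  proof (rule suminf_cong)
    fix n
    have i: "integrable \<gamma> (b n)" unfolding b_def[abs_def]
      by (intro integrable_mult_right integrable_real_indicator) (auto simp: emeasure_eq_measure)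
    then have "(\<integral>\<^sup>+x. ennreal (b n x) \<partial>\<gamma>) = ennreal (LINT x|\<gamma>. b n x)"
      by (intro nn_integral_eq_integral[OF i]) (simp add: b_def)
    then show "(\<integral>\<^sup>+x. ennreal (b n x) \<partial>\<gamma>) = ennreal ((2 * real n + 1) * prob {x. norm x > real n})"
      by (simp add: b_def)
  qed
  also have "\<dots> < \<infinity>"
  proof -
    have "summable (\<lambda>n. (2 * real (Suc n) + 1) * prob {x. norm x > real (Suc n)})"
    proof (rule summable_comparison_test')
      show "summable (\<lambda>n. 3 * C * (1 / (real (Suc n))\<^sup>2))"
        by (intro summable_mult) (use inverse_squares_sums in \<open>auto simp: sums_iff add.commute\<close>)
      fix n :: nat
      have n: "real (Suc n) \<ge> 1" by simp
      have "(2 * real (Suc n) + 1) * prob {x. norm x > real (Suc n)} \<le> (3 * real (Suc n)) * (C / real (Suc n) ^ 4)"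
        using n C[of "real (Suc n)"] by (intro mult_mono) auto
      also have "\<dots> = 3 * C * (1 / real (Suc n) ^ 3)"
        using n by (simp add: field_simps eval_nat_numeral del: of_nat_Suc)
      also have "\<dots> \<le> 3 * C * (1 / (real (Suc n))\<^sup>2)"
        using C0 n by (intro mult_left_mono divide_left_mono power_increasing) (auto simp del: of_nat_Suc)
      finally show "norm ((2 * real (Suc n) + 1) * prob {x. norm x > real (Suc n)}) \<le> 3 * C * (1 / (real (Suc n))\<^sup>2)"
        by simp
    qed
    then have "summable (\<lambda>n. (2 * real n + 1) * prob {x. norm x > real n})" by (subst (asm) summable_Suc_iff)
    then show ?thesis by (subst suminf_ennreal2) auto
  qed
  finally show ?thesis by (intro integrableI_nonneg) auto
qed

end

section \<open>Square integrable functions and the Cameron-Martin space\<close>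

lemma discriminant_le:
  fixes A B C :: real
  assumes q: "\<And>t. 0 \<le> A + 2 * t * B + t\<^sup>2 * C" and C: "0 \<le> C"
  shows "B\<^sup>2 \<le> A * C"
proof (cases "C = 0")
  case True
  have "B = 0"
  proof (rule ccontr)
    assume "B \<noteq> 0"
    then have "2 * (- (A + 1) / (2 * B)) * B = - (A + 1)" by (simp add: field_simps)
    then show False using q[of "- (A + 1) / (2 * B)"] True by simp
  qed
  then show ?thesis using True by simp
next
  case False
  then have C: "C > 0" using C by simp
  have "0 \<le> C * (A + 2 * (- B / C) * B + (- B / C)\<^sup>2 * C)"
    by (rule mult_nonneg_nonneg[OF less_imp_le[OF C] q])
  also have "\<dots> = A * C - B\<^sup>2" using C by (simp add: power2_eq_square field_simps)
  finally show ?thesis by simp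
qed

context centered_gaussian
begin

lemma L2_iff: "f \<in> L2 \<gamma> \<longleftrightarrow> f \<in> borel_measurable borel \<and> integrable \<gamma> (\<lambda>x. (f x)\<^sup>2)"
  by (simp add: L2_def)

lemma L2_measurable: "f \<in> L2 \<gamma> \<Longrightarrow> f \<in> borel_measurable borel"
  and L2_power2: "f \<in> L2 \<gamma> \<Longrightarrow> integrable \<gamma> (\<lambda>x. (f x)\<^sup>2)"
  by (auto simp: L2_iff)

lemma L2_mult:
  assumes "f \<in> L2 \<gamma>" "g \<in> L2 \<gamma>"
  shows "integrable \<gamma> (\<lambda>x. f x * g x)"
proof (rule Bochner_Integration.integrable_bound)
  show "integrable \<gamma> (\<lambda>x. (f x)\<^sup>2 + (g x)\<^sup>2)" using assms by (simp add: L2_iff)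
  have "\<bar>a * b\<bar> \<le> a\<^sup>2 + b\<^sup>2" for a b :: real
  proof -
    have "2 * \<bar>a * b\<bar> \<le> a\<^sup>2 + b\<^sup>2" using sum_squares_bound[of "\<bar>a\<bar>" "\<bar>b\<bar>"] by (simp add: abs_mult)
    then show ?thesis using abs_ge_zero[of "a * b"] by linarith
  qed
  then show "AE x in \<gamma>. norm (f x * g x) \<le> norm ((f x)\<^sup>2 + (g x)\<^sup>2)" by simp
  show "(\<lambda>x. f x * g x) \<in> borel_measurable \<gamma>" using assms by (simp add: L2_iff borel_measurable_times)
qed

lemma L2_add: "f \<in> L2 \<gamma> \<Longrightarrow> g \<in> L2 \<gamma> \<Longrightarrow> (\<lambda>x. f x + g x) \<in> L2 \<gamma>"
  using L2_mult[of f g] by (auto simp: L2_iff power2_sum mult.assoc)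

lemma L2_scale: "f \<in> L2 \<gamma> \<Longrightarrow> (\<lambda>x. c * f x) \<in> L2 \<gamma>"
  by (auto simp: L2_iff power_mult_distrib)

lemma L2_diff: "f \<in> L2 \<gamma> \<Longrightarrow> g \<in> L2 \<gamma> \<Longrightarrow> (\<lambda>x. f x - g x) \<in> L2 \<gamma>"
  using L2_add[of f "\<lambda>x. (- 1) * g x"] L2_scale[of g "- 1"] by simp

lemma L2_blinfun [simp]: "blinfun_apply f \<in> L2 \<gamma>" for f :: "'a \<Rightarrow>\<^sub>L real"
  by (simp add: L2_iff)

lemma L2_const [simp]: "(\<lambda>x. c) \<in> L2 \<gamma>"
  by (simp add: L2_iff)

lemma L2_integrable: "f \<in> L2 \<gamma> \<Longrightarrow> integrable \<gamma> f"
  using L2_mult[of f "\<lambda>x. 1"] by simp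

lemma L2_abs: "f \<in> L2 \<gamma> \<Longrightarrow> (\<lambda>x. \<bar>f x\<bar>) \<in> L2 \<gamma>"
  by (auto simp: L2_iff)

lemma L2_scaleR_id:
  assumes "f \<in> L2 \<gamma>"
  shows "integrable \<gamma> (\<lambda>x. f x *\<^sub>R x)"
proof (rule Bochner_Integration.integrable_bound)
  show "integrable \<gamma> (\<lambda>x. \<bar>f x\<bar> * norm x)"
    using integrable_norm_power2 by (intro L2_mult L2_abs assms) (simp add: L2_iff)
  show "(\<lambda>x. f x *\<^sub>R x) \<in> borel_measurable \<gamma>"
    using assms by (simp add: L2_iff borel_measurable_scaleR)
qed simp

lemma blinfun_barycentre:
  fixes g :: "'a \<Rightarrow>\<^sub>L real"
  assumes "f \<in> L2 \<gamma>"
  shows "g (LINT x|\<gamma>. f x *\<^sub>R x) = (LINT x|\<gamma>. f x * g x)"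
  using integral_bounded_linear[OF blinfun.bounded_linear_right L2_scaleR_id[OF assms], of g]
  by (simp add: blinfun.scaleR_right)

lemma L2_Cauchy_Schwarz:
  assumes f: "f \<in> L2 \<gamma>" and g: "g \<in> L2 \<gamma>"
  shows "(LINT x|\<gamma>. f x * g x)\<^sup>2 \<le> (LINT x|\<gamma>. (f x)\<^sup>2) * (LINT x|\<gamma>. (g x)\<^sup>2)"
proof -
  define A B C where "A = (LINT x|\<gamma>. (f x)\<^sup>2)" and "B = (LINT x|\<gamma>. f x * g x)" and "C = (LINT x|\<gamma>. (g x)\<^sup>2)"
  have q: "0 \<le> A + 2 * t * B + t\<^sup>2 * C" for t
  proof -
    have "0 \<le> (LINT x|\<gamma>. (f x + t * g x)\<^sup>2)" by simp
    also have "\<dots> = (LINT x|\<gamma>. (f x)\<^sup>2 + 2 * t * (f x * g x) + t\<^sup>2 * (g x)\<^sup>2)"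
      by (simp add: power2_eq_square algebra_simps)
    also have "\<dots> = A + 2 * t * B + t\<^sup>2 * C"
      using L2_mult[OF f g] L2_power2[OF f] L2_power2[OF g] by (simp add: A_def B_def C_def)
    finally show ?thesis .
  qed
  have "B\<^sup>2 \<le> A * C" using q by (rule discriminant_le) (simp add: C_def)
  then show ?thesis by (simp add: A_def B_def C_def)
qed

lemma L2_L1: "f \<in> L2 \<gamma> \<Longrightarrow> (LINT x|\<gamma>. \<bar>f x\<bar>)\<^sup>2 \<le> (LINT x|\<gamma>. (f x)\<^sup>2)"
  using L2_Cauchy_Schwarz[of "\<lambda>x. \<bar>f x\<bar>" "\<lambda>x. 1"] by (simp add: L2_abs)

definition L2norm :: "('a \<Rightarrow> real) \<Rightarrow> real" where
  "L2norm f = sqrt (LINT x|\<gamma>. (f x)\<^sup>2)"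

lemma L2norm_power2: "(L2norm f)\<^sup>2 = (LINT x|\<gamma>. (f x)\<^sup>2)"
  by (simp add: L2norm_def)

lemma L2norm_nonneg: "0 \<le> L2norm f"
  by (simp add: L2norm_def)

lemma L2norm_triangle:
  assumes f: "f \<in> L2 \<gamma>" and g: "g \<in> L2 \<gamma>"
  shows "L2norm (\<lambda>x. f x + g x) \<le> L2norm f + L2norm g"
proof (rule power2_le_imp_le)
  have "(LINT x|\<gamma>. f x * g x) \<le> L2norm f * L2norm g"
  proof (rule power2_le_imp_le)
    show "(LINT x|\<gamma>. f x * g x)\<^sup>2 \<le> (L2norm f * L2norm g)\<^sup>2"
      using L2_Cauchy_Schwarz[OF f g] by (simp add: power_mult_distrib L2norm_power2)
  qed (simp add: L2norm_nonneg)
  moreover have "(L2norm (\<lambda>x. f x + g x))\<^sup>2 = (L2norm f)\<^sup>2 + (L2norm g)\<^sup>2 + 2 * (LINT x|\<gamma>. f x * g x)"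
    using L2_mult[OF f g] L2_power2[OF f] L2_power2[OF g]
    by (simp add: L2norm_power2 power2_sum mult.assoc)
  ultimately show "(L2norm (\<lambda>x. f x + g x))\<^sup>2 \<le> (L2norm f + L2norm g)\<^sup>2"
    by (simp add: power2_sum)
qed (simp add: L2norm_nonneg)

text \<open>Riesz-Fischer with a geometric rate: consecutive differences have L1 norm at most 2^-n,
  so they are absolutely summable almost everywhere, and Fatou's lemma hands the Cauchy bound on to
  the limit.\<close>

lemma L2_complete:
  assumes u: "\<And>n. u n \<in> L2 \<gamma>"
    and C: "\<And>n m. n \<le> m \<Longrightarrow> (LINT x|\<gamma>. (u n x - u m x)\<^sup>2) \<le> (1 / 4) ^ n"
  shows "\<exists>g\<in>L2 \<gamma>. \<forall>n. (LINT x|\<gamma>. (u n x - g x)\<^sup>2) \<le> (1 / 4) ^ n"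
proof -
  have um [measurable]: "u n \<in> borel_measurable borel" for n using u L2_measurable by blast
  define d where "d n x = u (Suc n) x - u n x" for n x
  have dL2: "d n \<in> L2 \<gamma>" for n unfolding d_def[abs_def] by (intro L2_diff u)
  have dm [measurable]: "d n \<in> borel_measurable borel" for n using dL2 L2_measurable by blast
  have L1: "(LINT x|\<gamma>. \<bar>d n x\<bar>) \<le> (1 / 2) ^ n" for n
  proof (rule power2_le_imp_le)
    have "(LINT x|\<gamma>. \<bar>d n x\<bar>)\<^sup>2 \<le> (LINT x|\<gamma>. (u n x - u (Suc n) x)\<^sup>2)"
      using L2_L1[OF dL2, of n] by (simp add: d_def power2_commute)
    also have "\<dots> \<le> (1 / 4) ^ n" by (rule C) simp
    also have "\<dots> = ((1 / 2) ^ n)\<^sup>2" by (simp add: power2_eq_square power_mult_distrib[symmetric])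
    finally show "(LINT x|\<gamma>. \<bar>d n x\<bar>)\<^sup>2 \<le> ((1 / 2) ^ n)\<^sup>2" .
  qed simp
  have "(\<integral>\<^sup>+x. (\<Sum>n. ennreal \<bar>d n x\<bar>) \<partial>\<gamma>) = (\<Sum>n. \<integral>\<^sup>+x. ennreal \<bar>d n x\<bar> \<partial>\<gamma>)"
    by (rule nn_integral_suminf) simp
  also have "\<dots> = (\<Sum>n. ennreal (LINT x|\<gamma>. \<bar>d n x\<bar>))"
    using L2_integrable[OF L2_abs[OF dL2]] by (intro suminf_cong nn_integral_eq_integral) auto
  also have "\<dots> \<le> (\<Sum>n. ennreal ((1 / 2) ^ n))"
    by (intro suminf_le ennreal_leI L1) auto
  also have "\<dots> < \<infinity>"
    using summable_geometric[of "1 / 2 :: real"] by (subst suminf_ennreal2) auto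
  finally have "AE x in \<gamma>. (\<Sum>n. ennreal \<bar>d n x\<bar>) \<noteq> \<infinity>"
    by (intro nn_integral_PInf_AE) auto
  then have conv: "AE x in \<gamma>. convergent (\<lambda>n. u n x)"
  proof eventually_elim
    case (elim x)
    then have "summable (\<lambda>n. \<bar>d n x\<bar>)"
      by (intro summable_suminf_not_top) (auto simp: top_ennreal_def[symmetric] infinity_ennreal_def)
    then have "summable (\<lambda>n. d n x)" by (rule summable_rabs_cancel)
    then have "convergent (\<lambda>n. (\<Sum>i<n. d i x) + u 0 x)"
      by (intro convergent_add convergent_const) (simp add: summable_iff_convergent)
    moreover have "(\<Sum>i<n. d i x) + u 0 x = u n x" for n
      unfolding d_def using sum_lessThan_telescope[of "\<lambda>i. u i x" n] by simp
    ultimately show ?case by simp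
  qed
  define g where "g x = lim (\<lambda>n. u n x)" for x
  have gm [measurable]: "g \<in> borel_measurable borel"
    unfolding g_def[abs_def] by (rule borel_measurable_lim_metric) simp
  have lim: "AE x in \<gamma>. (\<lambda>n. u n x) \<longlonglongrightarrow> g x"
    using conv by eventually_elim (simp add: g_def convergent_LIMSEQ_iff)
  have bound: "(\<integral>\<^sup>+x. ennreal ((u n x - g x)\<^sup>2) \<partial>\<gamma>) \<le> ennreal ((1 / 4) ^ n)" for n
  proof -
    have "(\<integral>\<^sup>+x. ennreal ((u n x - g x)\<^sup>2) \<partial>\<gamma>) = (\<integral>\<^sup>+x. liminf (\<lambda>m. ennreal ((u n x - u m x)\<^sup>2)) \<partial>\<gamma>)"
    proof (intro nn_integral_cong_AE)
      show "AE x in \<gamma>. ennreal ((u n x - g x)\<^sup>2) = liminf (\<lambda>m. ennreal ((u n x - u m x)\<^sup>2))"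
        using lim
      proof eventually_elim
        case (elim x)
        then have "(\<lambda>m. ennreal ((u n x - u m x)\<^sup>2)) \<longlonglongrightarrow> ennreal ((u n x - g x)\<^sup>2)"
          by (intro tendsto_ennrealI tendsto_intros)
        from lim_imp_Liminf[OF sequentially_bot this] show ?case by simp
      qed
    qed
    also have "\<dots> \<le> liminf (\<lambda>m. \<integral>\<^sup>+x. ennreal ((u n x - u m x)\<^sup>2) \<partial>\<gamma>)"
      by (rule nn_integral_liminf) simp
    also have "\<dots> \<le> ennreal ((1 / 4) ^ n)"
    proof -
      have "\<forall>\<^sub>F m in sequentially. (\<integral>\<^sup>+x. ennreal ((u n x - u m x)\<^sup>2) \<partial>\<gamma>) \<le> ennreal ((1 / 4) ^ n)"
        using eventually_ge_at_top[of n]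
      proof eventually_elim
        case (elim m)
        have "(\<integral>\<^sup>+x. ennreal ((u n x - u m x)\<^sup>2) \<partial>\<gamma>) = ennreal (LINT x|\<gamma>. (u n x - u m x)\<^sup>2)"
          using L2_power2[OF L2_diff[OF u u]] by (intro nn_integral_eq_integral) auto
        then show ?case using C[OF elim] by (simp add: ennreal_leI)
      qed
      then have "liminf (\<lambda>m. \<integral>\<^sup>+x. ennreal ((u n x - u m x)\<^sup>2) \<partial>\<gamma>) \<le> liminf (\<lambda>m. ennreal ((1 / 4) ^ n))"
        by (rule Liminf_mono)
      then show ?thesis by (simp add: Liminf_const)
    qed
    finally show ?thesis .
  qed
  have int: "integrable \<gamma> (\<lambda>x. (u n x - g x)\<^sup>2)" for n
    using bound[of n] by (intro integrableI_nonneg) (auto intro: le_less_trans)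
  have "(\<lambda>x. u 0 x - g x) \<in> L2 \<gamma>" using int by (simp add: L2_iff)
  from L2_diff[OF u[of 0] this] have "g \<in> L2 \<gamma>" by simp
  moreover have "(LINT x|\<gamma>. (u n x - g x)\<^sup>2) \<le> (1 / 4) ^ n" for n
    using bound[of n] nn_integral_eq_integral[OF int[of n]] by simp
  ultimately show ?thesis by blast
qed

section \<open>The closure of the dual in L2\<close>

lemma L2_dual_closureI:
  assumes "g \<in> L2 \<gamma>" "(\<lambda>n. LINT x|\<gamma>. (g x - blinfun_apply (f n) x)\<^sup>2) \<longlonglongrightarrow> 0"
  shows "g \<in> L2_dual_closure \<gamma>"
proof -
  have "(\<integral>\<^sup>+x. ennreal ((g x - blinfun_apply (f n) x)\<^sup>2) \<partial>\<gamma>) = ennreal (LINT x|\<gamma>. (g x - blinfun_apply (f n) x)\<^sup>2)" for n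
    using L2_power2[OF L2_diff[OF assms(1) L2_blinfun]] by (intro nn_integral_eq_integral) auto
  then have "(\<lambda>n. \<integral>\<^sup>+x. ennreal ((g x - blinfun_apply (f n) x)\<^sup>2) \<partial>\<gamma>) \<longlonglongrightarrow> 0"
    using tendsto_ennrealI[OF assms(2)] by simp
  then show ?thesis using assms(1) by (auto simp: L2_dual_closure_def)
qed

lemma L2_dual_closureD:
  assumes "g \<in> L2_dual_closure \<gamma>"
  shows "g \<in> L2 \<gamma>"
    and "\<exists>f :: nat \<Rightarrow> 'a \<Rightarrow>\<^sub>L real. (\<lambda>n. LINT x|\<gamma>. (g x - blinfun_apply (f n) x)\<^sup>2) \<longlonglongrightarrow> 0"
proof -
  show g: "g \<in> L2 \<gamma>" using assms by (simp add: L2_dual_closure_def)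
  obtain f :: "nat \<Rightarrow> 'a \<Rightarrow>\<^sub>L real"
    where f: "(\<lambda>n. \<integral>\<^sup>+x. ennreal ((g x - blinfun_apply (f n) x)\<^sup>2) \<partial>\<gamma>) \<longlonglongrightarrow> 0"
    using assms by (auto simp: L2_dual_closure_def)
  have "(\<integral>\<^sup>+x. ennreal ((g x - blinfun_apply (f n) x)\<^sup>2) \<partial>\<gamma>) = ennreal (LINT x|\<gamma>. (g x - blinfun_apply (f n) x)\<^sup>2)" for n
    using L2_power2[OF L2_diff[OF g L2_blinfun]] by (intro nn_integral_eq_integral) auto
  with f have "(\<lambda>n. ennreal (LINT x|\<gamma>. (g x - blinfun_apply (f n) x)\<^sup>2)) \<longlonglongrightarrow> ennreal 0" by simp
  then have "(\<lambda>n. LINT x|\<gamma>. (g x - blinfun_apply (f n) x)\<^sup>2) \<longlonglongrightarrow> 0"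
    by (rule tendsto_ennrealD) auto
  then show "\<exists>f :: nat \<Rightarrow> 'a \<Rightarrow>\<^sub>L real. (\<lambda>n. LINT x|\<gamma>. (g x - blinfun_apply (f n) x)\<^sup>2) \<longlonglongrightarrow> 0" by blast
qed

lemma blinfun_in_closure [simp]: "blinfun_apply f \<in> L2_dual_closure \<gamma>" for f :: "'a \<Rightarrow>\<^sub>L real"
  by (rule L2_dual_closureI[where f = "\<lambda>_. f"]) auto

lemma integral_tendsto_L2:
  assumes g: "g \<in> L2 \<gamma>" and f: "\<And>n. f n \<in> L2 \<gamma>" and v: "v \<in> L2 \<gamma>"
    and lim: "(\<lambda>n. LINT x|\<gamma>. (g x - f n x)\<^sup>2) \<longlonglongrightarrow> 0"
  shows "(\<lambda>n. LINT x|\<gamma>. f n x * v x) \<longlonglongrightarrow> (LINT x|\<gamma>. g x * v x)"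
proof -
  have "(\<lambda>n. LINT x|\<gamma>. (g x - f n x) * v x) \<longlonglongrightarrow> 0"
  proof (rule tendsto_norm_zero_cancel, rule tendsto_sandwich[OF _ _ tendsto_const])
    show "\<forall>\<^sub>F n in sequentially. norm (LINT x|\<gamma>. (g x - f n x) * v x)
        \<le> sqrt ((LINT x|\<gamma>. (g x - f n x)\<^sup>2) * (LINT x|\<gamma>. (v x)\<^sup>2))"
      using L2_Cauchy_Schwarz[OF L2_diff[OF g f] v] by (intro always_eventually allI) (simp add: real_le_rsqrt)
    show "(\<lambda>n. sqrt ((LINT x|\<gamma>. (g x - f n x)\<^sup>2) * (LINT x|\<gamma>. (v x)\<^sup>2))) \<longlonglongrightarrow> 0"
      using tendsto_real_sqrt[OF tendsto_mult[OF lim tendsto_const[of "LINT x|\<gamma>. (v x)\<^sup>2"]]] by simp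
  qed auto
  then have "(\<lambda>n. (LINT x|\<gamma>. g x * v x) - (LINT x|\<gamma>. f n x * v x)) \<longlonglongrightarrow> 0"
    using L2_mult[OF g v] L2_mult[OF f v] by (simp add: left_diff_distrib)
  from tendsto_diff[OF tendsto_const[of "LINT x|\<gamma>. g x * v x"] this] show ?thesis by simp
qed

lemma L2_dual_closure_diff:
  assumes g: "g \<in> L2_dual_closure \<gamma>" and k: "k \<in> L2_dual_closure \<gamma>"
  shows "(\<lambda>x. g x - k x) \<in> L2_dual_closure \<gamma>"
proof -
  note L = L2_dual_closureD(1)[OF g] L2_dual_closureD(1)[OF k]
  obtain f1 f2 :: "nat \<Rightarrow> 'a \<Rightarrow>\<^sub>L real"
    where f: "(\<lambda>n. LINT x|\<gamma>. (g x - f1 n x)\<^sup>2) \<longlonglongrightarrow> 0" "(\<lambda>n. LINT x|\<gamma>. (k x - f2 n x)\<^sup>2) \<longlonglongrightarrow> 0"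
    using L2_dual_closureD(2) g k by blast
  note i = L2_power2[OF L2_diff[OF L(1) L2_blinfun]] L2_power2[OF L2_diff[OF L(2) L2_blinfun]]
  show ?thesis
  proof (rule L2_dual_closureI[where f = "\<lambda>n. f1 n - f2 n"])
    show "(\<lambda>n. LINT x|\<gamma>. (g x - k x - blinfun_apply (f1 n - f2 n) x)\<^sup>2) \<longlonglongrightarrow> 0"
    proof (rule tendsto_sandwich[OF _ _ tendsto_const])
      show "\<forall>\<^sub>F n in sequentially. (LINT x|\<gamma>. (g x - k x - blinfun_apply (f1 n - f2 n) x)\<^sup>2)
          \<le> 2 * (LINT x|\<gamma>. (g x - f1 n x)\<^sup>2) + 2 * (LINT x|\<gamma>. (k x - f2 n x)\<^sup>2)"
      proof (intro always_eventually allI)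
        fix n
        have ineq: "(a - b - (c - d))\<^sup>2 \<le> 2 * (a - c)\<^sup>2 + 2 * (b - d)\<^sup>2" for a b c d :: real
          using zero_le_power2[of "(a - c) + (b - d)"] by (simp add: power2_eq_square algebra_simps)
        have "(LINT x|\<gamma>. (g x - k x - blinfun_apply (f1 n - f2 n) x)\<^sup>2)
            \<le> (LINT x|\<gamma>. 2 * (g x - f1 n x)\<^sup>2 + 2 * (k x - f2 n x)\<^sup>2)"
        proof (rule integral_mono)
          show "integrable \<gamma> (\<lambda>x. (g x - k x - blinfun_apply (f1 n - f2 n) x)\<^sup>2)"
            by (rule L2_power2[OF L2_diff[OF L2_diff[OF L] L2_blinfun]])
        qed (use i ineq in \<open>auto simp: blinfun.diff_left\<close>)
        then show "(LINT x|\<gamma>. (g x - k x - blinfun_apply (f1 n - f2 n) x)\<^sup>2)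
          \<le> 2 * (LINT x|\<gamma>. (g x - f1 n x)\<^sup>2) + 2 * (LINT x|\<gamma>. (k x - f2 n x)\<^sup>2)"
          using i by simp
      qed
      show "(\<lambda>n. 2 * (LINT x|\<gamma>. (g x - f1 n x)\<^sup>2) + 2 * (LINT x|\<gamma>. (k x - f2 n x)\<^sup>2)) \<longlonglongrightarrow> 0"
        using tendsto_add[OF tendsto_mult_left[OF f(1), of 2] tendsto_mult_left[OF f(2), of 2]] by simp
    qed auto
  qed (intro L2_diff L)
qed

text \<open>Orthogonal projection onto the closed dual: the parallelogram law makes a minimising
  sequence of functionals Cauchy, and minimality makes the error orthogonal to all functionals. It
  serves to replace the arbitrary density in the definition of \<open>CM\<close> by one in
  \<open>L2_dual_closure\<close>.\<close>

lemma L2_dual_projection: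
  assumes f: "f \<in> L2 \<gamma>"
  shows "\<exists>g\<in>L2_dual_closure \<gamma>. \<forall>v :: 'a \<Rightarrow>\<^sub>L real. (LINT x|\<gamma>. f x * v x) = (LINT x|\<gamma>. g x * v x)"
proof -
  define S where "S = range (\<lambda>v :: 'a \<Rightarrow>\<^sub>L real. LINT x|\<gamma>. (f x - v x)\<^sup>2)"
  define d where "d = Inf S"
  have bdd: "bdd_below S" unfolding S_def by (rule bdd_belowI2[of _ 0]) simp
  have d_le: "d \<le> (LINT x|\<gamma>. (f x - v x)\<^sup>2)" for v :: "'a \<Rightarrow>\<^sub>L real"
    unfolding d_def using bdd by (intro cInf_lower) (auto simp: S_def)
  \<comment> \<open>The additional division by 4 is made for the parallelogram law, where the errors
    of n and m enter with factor 2 each and must add up to at most (1 / 4) ^ n.\<close>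
  have "\<exists>v :: 'a \<Rightarrow>\<^sub>L real. (LINT x|\<gamma>. (f x - v x)\<^sup>2) < d + (1 / 4) ^ n / 4" for n :: nat
  proof -
    have "Inf S < d + (1 / 4) ^ n / 4" by (simp add: d_def)
    then show ?thesis using bdd by (subst (asm) cInf_less_iff) (auto simp: S_def)
  qed
  then obtain u :: "nat \<Rightarrow> 'a \<Rightarrow>\<^sub>L real"
    where u: "\<And>n. (LINT x|\<gamma>. (f x - u n x)\<^sup>2) < d + (1 / 4) ^ n / 4" by metis
  note i = L2_power2[OF L2_diff[OF f L2_blinfun]]
  have C: "(LINT x|\<gamma>. (u n x - u m x)\<^sup>2) \<le> (1 / 4) ^ n" if "n \<le> m" for n m
  proof -
    \<comment> \<open>The midpoint is a functional again, hence at squared distance at least d from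
      f.\<close>
    define w where "w = (1 / 2) *\<^sub>R (u n + u m)"
    have "(LINT x|\<gamma>. (u n x - u m x)\<^sup>2)
        = (LINT x|\<gamma>. 2 * (f x - u n x)\<^sup>2 + 2 * (f x - u m x)\<^sup>2 - 4 * (f x - w x)\<^sup>2)"
      by (intro Bochner_Integration.integral_cong refl)
        (simp add: w_def blinfun.add_left blinfun.scaleR_left power2_eq_square field_simps)
    also have "\<dots> = 2 * (LINT x|\<gamma>. (f x - u n x)\<^sup>2) + 2 * (LINT x|\<gamma>. (f x - u m x)\<^sup>2) - 4 * (LINT x|\<gamma>. (f x - w x)\<^sup>2)"
      using i by simp
    also have "\<dots> \<le> 2 * (d + (1 / 4) ^ n / 4) + 2 * (d + (1 / 4) ^ m / 4) - 4 * d"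
      by (intro diff_mono add_mono mult_left_mono less_imp_le[OF u] d_le) auto
    also have "\<dots> = (1 / 4) ^ n / 2 + (1 / 4) ^ m / 2" by simp
    also have "(1 / 4 :: real) ^ m \<le> (1 / 4) ^ n" using that by (intro power_decreasing) auto
    finally show ?thesis by simp
  qed
  obtain g where g: "g \<in> L2 \<gamma>" "\<And>n. (LINT x|\<gamma>. (u n x - g x)\<^sup>2) \<le> (1 / 4) ^ n"
    using L2_complete[of "\<lambda>n. blinfun_apply (u n)", OF _ C] by auto
  have geo: "(\<lambda>n. (1 / 4 :: real) ^ n) \<longlonglongrightarrow> 0" by (rule LIMSEQ_realpow_zero) auto
  have lim: "(\<lambda>n. LINT x|\<gamma>. (g x - u n x)\<^sup>2) \<longlonglongrightarrow> 0"
  proof (rule tendsto_sandwich[OF _ _ tendsto_const geo])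
    show "\<forall>\<^sub>F n in sequentially. (LINT x|\<gamma>. (g x - u n x)\<^sup>2) \<le> (1 / 4) ^ n"
      using g(2) by (simp add: power2_commute)
  qed simp
  have orth: "(LINT x|\<gamma>. f x * v x) = (LINT x|\<gamma>. g x * v x)" for v :: "'a \<Rightarrow>\<^sub>L real"
  proof -
    define b where "b n = (LINT x|\<gamma>. (f x - u n x) * v x)" for n
    have small: "(b n)\<^sup>2 \<le> (1 / 4) ^ n / 4 * cov v v" for n
    proof -
      have q: "0 \<le> (1 / 4) ^ n / 4 + 2 * t * b n + t\<^sup>2 * cov v v" for t
      proof -
        have "d \<le> (LINT x|\<gamma>. (f x - (u n - t *\<^sub>R v) x)\<^sup>2)" by (rule d_le)
        also have "\<dots> = (LINT x|\<gamma>. (f x - u n x)\<^sup>2 + 2 * t * ((f x - u n x) * v x) + t\<^sup>2 * (v x * v x))"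
          by (intro Bochner_Integration.integral_cong refl)
            (simp add: blinfun.diff_left blinfun.scaleR_left power2_eq_square algebra_simps)
        also have "\<dots> = (LINT x|\<gamma>. (f x - u n x)\<^sup>2) + 2 * t * b n + t\<^sup>2 * cov v v"
          using i[of "u n"] L2_mult[OF L2_diff[OF f L2_blinfun[of "u n"]] L2_blinfun[of v]]
          by (simp add: b_def cov_def)
        finally show ?thesis using u[of n] by simp
      qed
      show ?thesis using q by (rule discriminant_le) (rule cov_nonneg)
    qed
    have "(\<lambda>n. (b n)\<^sup>2) \<longlonglongrightarrow> 0"
    proof (rule tendsto_sandwich[OF _ _ tendsto_const])
      show "(\<lambda>n. (1 / 4) ^ n / 4 * cov v v) \<longlonglongrightarrow> 0"
        using tendsto_mult_right[OF geo, of "cov v v / 4"] by (simp add: mult.commute)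
    qed (use small in auto)
    then have "(\<lambda>n. sqrt ((b n)\<^sup>2)) \<longlonglongrightarrow> sqrt 0" by (rule tendsto_real_sqrt)
    then have b0: "b \<longlonglongrightarrow> 0" by (simp add: tendsto_rabs_zero_iff)
    have "(\<lambda>n. LINT x|\<gamma>. u n x * v x) \<longlonglongrightarrow> (LINT x|\<gamma>. g x * v x)"
      using g lim by (intro integral_tendsto_L2) auto
    from tendsto_add[OF b0 this]
    have "(\<lambda>n. LINT x|\<gamma>. f x * v x) \<longlonglongrightarrow> (LINT x|\<gamma>. g x * v x)"
      using L2_mult[OF f L2_blinfun[of v]] by (simp add: b_def left_diff_distrib)
    then show ?thesis by (simp add: LIMSEQ_const_iff)
  qed
  have "g \<in> L2_dual_closure \<gamma>" by (rule L2_dual_closureI[OF g(1) lim])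
  then show ?thesis using orth by blast
qed

text \<open>This justifies the choice in \<open>hat\<close>. Functionals separate points, and they
  see the barycentre of f only through the pairings of f with functionals, which the projection onto
  the closed dual preserves.\<close>

lemma CM_representative:
  assumes "h \<in> CM \<gamma>"
  shows "hat \<gamma> h \<in> L2_dual_closure \<gamma> \<and> h = (LINT x|\<gamma>. hat \<gamma> h x *\<^sub>R x)"
proof -
  obtain f where f: "f \<in> L2 \<gamma>" "h = (LINT x|\<gamma>. f x *\<^sub>R x)" using assms by (auto simp: CM_def)
  obtain g where g: "g \<in> L2_dual_closure \<gamma>" "\<And>v :: 'a \<Rightarrow>\<^sub>L real. (LINT x|\<gamma>. f x * v x) = (LINT x|\<gamma>. g x * v x)"
    using L2_dual_projection[OF f(1)] by blast
  have "h = (LINT x|\<gamma>. g x *\<^sub>R x)"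
    unfolding f(2)
    by (rule blinfun_separates)
      (simp only: blinfun_barycentre[OF f(1)] blinfun_barycentre[OF L2_dual_closureD(1)[OF g(1)]] g(2))
  with g(1) have "\<exists>g. g \<in> L2_dual_closure \<gamma> \<and> h = (LINT x|\<gamma>. g x *\<^sub>R x)" by blast
  then show ?thesis unfolding hat_def by (rule someI_ex)
qed

lemma barycentre_in_CM: "g \<in> L2 \<gamma> \<Longrightarrow> (LINT x|\<gamma>. g x *\<^sub>R x) \<in> CM \<gamma>"
  by (auto simp: CM_def)

text \<open>The difference is orthogonal to every functional because its barycentre vanishes; as an
  L2 limit of functionals it is then orthogonal to itself.\<close>

lemma dual_closure_eqI:
  assumes g: "g \<in> L2_dual_closure \<gamma>" and k: "k \<in> L2_dual_closure \<gamma>"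
    and eq: "(LINT x|\<gamma>. g x *\<^sub>R x) = (LINT x|\<gamma>. k x *\<^sub>R x)"
  shows "AE x in \<gamma>. g x = k x"
proof -
  define w where "w x = g x - k x" for x
  have w: "w \<in> L2_dual_closure \<gamma>" unfolding w_def[abs_def] using g k by (rule L2_dual_closure_diff)
  note L = L2_dual_closureD(1)[OF g] L2_dual_closureD(1)[OF k] L2_dual_closureD(1)[OF w]
  have 0: "(LINT x|\<gamma>. v x * w x) = 0" for v :: "'a \<Rightarrow>\<^sub>L real"
    using blinfun_barycentre[OF L(1), of v] blinfun_barycentre[OF L(2), of v] eq
      L2_mult[OF L2_blinfun[of v] L(1)] L2_mult[OF L2_blinfun[of v] L(2)]
    by (simp add: w_def right_diff_distrib mult.commute)
  obtain f :: "nat \<Rightarrow> 'a \<Rightarrow>\<^sub>L real" where "(\<lambda>n. LINT x|\<gamma>. (w x - f n x)\<^sup>2) \<longlonglongrightarrow> 0"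
    using L2_dual_closureD(2)[OF w] by blast
  from integral_tendsto_L2[OF L(3) _ L(3) this] have "(LINT x|\<gamma>. w x * w x) = 0"
    by (simp add: 0 LIMSEQ_const_iff)
  then have "AE x in \<gamma>. w x * w x = 0"
    using L2_mult[OF L(3) L(3)] by (subst (asm) integral_nonneg_eq_0_iff_AE) auto
  then show ?thesis by (simp add: w_def)
qed

lemma hat_barycentre:
  assumes "g \<in> L2_dual_closure \<gamma>"
  shows "AE x in \<gamma>. hat \<gamma> (LINT x|\<gamma>. g x *\<^sub>R x) x = g x"
  using CM_representative[OF barycentre_in_CM[OF L2_dual_closureD(1)[OF assms]]] assms
  by (intro dual_closure_eqI) auto

text \<open>Dominated convergence with a multiple of the squared norm; the finite second moment of
  \<gamma> enters here.\<close>

lemma blinfun_pointwise_L2: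
  fixes f :: "'a \<Rightarrow>\<^sub>L real" and u :: "nat \<Rightarrow> 'a \<Rightarrow>\<^sub>L real"
  assumes f: "norm f \<le> K" and u: "\<And>n. norm (u n) \<le> K" and lim: "\<And>x. (\<lambda>n. u n x) \<longlonglongrightarrow> f x"
  shows "(\<lambda>n. L2norm (\<lambda>x. f x - u n x)) \<longlonglongrightarrow> 0"
proof -
  have "(\<lambda>n. LINT x|\<gamma>. (f x - u n x)\<^sup>2) \<longlonglongrightarrow> (LINT x|\<gamma>. 0)"
  proof (rule integral_dominated_convergence[where w = "\<lambda>x. (2 * K)\<^sup>2 * (norm x)\<^sup>2"])
    show "integrable \<gamma> (\<lambda>x. (2 * K)\<^sup>2 * (norm x)\<^sup>2)" using integrable_norm_power2 by simp
    show "AE x in \<gamma>. (\<lambda>n. (f x - u n x)\<^sup>2) \<longlonglongrightarrow> 0"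
    proof (rule AE_I2)
      fix x
      show "(\<lambda>n. (f x - u n x)\<^sup>2) \<longlonglongrightarrow> 0"
        using tendsto_power[OF tendsto_diff[OF tendsto_const[of "f x"] lim[of x]], of 2] by simp
    qed
    show "AE x in \<gamma>. norm ((f x - u n x)\<^sup>2) \<le> (2 * K)\<^sup>2 * (norm x)\<^sup>2" for n
    proof (rule AE_I2)
      fix x
      have "\<bar>f x - u n x\<bar> \<le> norm (f - u n) * norm x"
        using norm_blinfun[of "f - u n" x] by (simp add: blinfun.diff_left)
      also have "norm (f - u n) \<le> 2 * K" using norm_triangle_ineq4[of f "u n"] f u[of n] by simp
      finally have "\<bar>f x - u n x\<bar> \<le> 2 * K * norm x" by (simp add: mult_right_mono)
      then have "\<bar>f x - u n x\<bar>\<^sup>2 \<le> (2 * K * norm x)\<^sup>2" by (intro power_mono) auto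
      then show "norm ((f x - u n x)\<^sup>2) \<le> (2 * K)\<^sup>2 * (norm x)\<^sup>2" by (simp add: power_mult_distrib)
    qed
  qed simp_all
  from tendsto_real_sqrt[OF this] show ?thesis by (simp add: L2norm_def)
qed

text \<open>A functional is approximated by one of countably many functionals that take nearly the
  same values at finitely many points of a dense sequence.\<close>

lemma dual_separable:
  obtains e :: "nat \<Rightarrow> 'a \<Rightarrow>\<^sub>L real"
  where "\<And>g r. g \<in> L2_dual_closure \<gamma> \<Longrightarrow> r > 0 \<Longrightarrow> \<exists>j. L2norm (\<lambda>x. g x - e j x) < r"
proof -
  obtain D :: "'a set" where D: "countable D" "\<And>X. open X \<Longrightarrow> X \<noteq> {} \<Longrightarrow> \<exists>d\<in>D. d \<in> X"
    by (rule countable_dense_setE) blast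
  then have "D \<noteq> {}" using D(2)[of UNIV] by auto
  define d where "d = from_nat_into D"
  have range_d: "range d = D" unfolding d_def using \<open>D \<noteq> {}\<close> D(1) by (rule range_from_nat_into)
  have dense: "\<exists>k. dist x (d k) < r" if "r > 0" for x r
    using D(2)[of "ball x r"] that range_d by (force simp: mem_ball)
  \<comment> \<open>An index consists of a bound K for the norm, a number n, and rational values at
    the sample points d 0, ..., d n. There are countably many indices, and \<open>\<phi>\<close>
    selects one functional for each index that some functional fits.\<close>
  define fits :: "nat \<times> nat \<times> rat list \<Rightarrow> ('a \<Rightarrow>\<^sub>L real) \<Rightarrow> bool"
    where "fits = (\<lambda>(K, n, q) f. norm f \<le> real K \<and> (\<forall>k\<le>n. \<bar>blinfun_apply f (d k) - of_rat (q ! k)\<bar> < 1 / real (Suc n)))"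
  define \<phi> where "\<phi> i = (SOME f. fits i f)" for i
  define e where "e j = \<phi> (from_nat j)" for j
  have approx_dual: "\<exists>j. L2norm (\<lambda>x. f x - e j x) < r" if r: "r > 0" for f :: "'a \<Rightarrow>\<^sub>L real" and r
  proof -
    obtain K :: nat where K: "norm f \<le> real K" using real_arch_simple by blast
    have "\<exists>q :: rat. \<bar>f (d k) - of_rat q\<bar> < 1 / real (Suc n)" for k n
    proof -
      have "f (d k) - 1 / real (Suc n) < f (d k) + 1 / real (Suc n)" by (simp add: add_pos_pos)
      then obtain q :: rat where "f (d k) - 1 / real (Suc n) < of_rat q" "of_rat q < f (d k) + 1 / real (Suc n)"
        using of_rat_dense by blast
      then show ?thesis by (intro exI[of _ q]) (simp add: abs_less_iff)
    qed
    then obtain Q :: "nat \<Rightarrow> nat \<Rightarrow> rat" where Q: "\<And>k n. \<bar>f (d k) - of_rat (Q k n)\<bar> < 1 / real (Suc n)" by metis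
    define i where "i n = (K, n, map (\<lambda>k. Q k n) [0..<Suc n])" for n
    have "fits (i n) f" for n
      using K Q by (auto simp: fits_def i_def simp del: upt_Suc)
    then have fit: "fits (i n) (\<phi> (i n))" for n unfolding \<phi>_def by (rule someI)
    have bd: "norm (\<phi> (i n)) \<le> real K" for n using fit[of n] by (simp add: fits_def i_def)
    have near: "\<bar>\<phi> (i n) (d k) - f (d k)\<bar> < 2 / real (Suc n)" if "k \<le> n" for k n
    proof -
      have "\<bar>\<phi> (i n) (d k) - of_rat (Q k n)\<bar> < 1 / real (Suc n)"
        using fit[of n] that by (auto simp: fits_def i_def simp del: upt_Suc)
      then show ?thesis using Q[of k n] by (simp add: abs_less_iff field_simps)
    qed
    have "(\<lambda>n. \<phi> (i n) x) \<longlonglongrightarrow> f x" for x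
    proof (rule LIMSEQ_I)
      fix s :: real assume s: "s > 0"
      define \<delta> where "\<delta> = s / (4 * (real K + 1))"
      have \<delta>: "\<delta> > 0" "real K * \<delta> \<le> s / 4" using s by (auto simp: \<delta>_def field_simps)
      obtain k where k: "norm (x - d k) < \<delta>" using dense[OF \<delta>(1), of x] by (auto simp: dist_norm)
      obtain N where N: "1 / real (Suc N) < s / 4" using nat_approx_posE[of "s / 4"] s by auto
      show "\<exists>n0. \<forall>n\<ge>n0. norm (\<phi> (i n) x - f x) < s"
      proof (intro exI[of _ "max k N"] allI impI)
        fix n assume n: "n \<ge> max k N"
        have lip: "\<bar>g (x - d k)\<bar> \<le> s / 4" if "norm g \<le> real K" for g :: "'a \<Rightarrow>\<^sub>L real"
        proof -
          have "\<bar>g (x - d k)\<bar> \<le> norm g * norm (x - d k)" using norm_blinfun[of g "x - d k"] by simp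
          also have "\<dots> \<le> real K * \<delta>" using that k by (intro mult_mono) auto
          finally show ?thesis using \<delta> by simp
        qed
        have "1 / real (Suc n) \<le> 1 / real (Suc N)" using n by (intro divide_left_mono) auto
        then have "\<bar>\<phi> (i n) (d k) - f (d k)\<bar> < s / 2" using near[of k n] n N by simp
        moreover have "\<phi> (i n) x - f x = \<phi> (i n) (x - d k) + (\<phi> (i n) (d k) - f (d k)) - f (x - d k)"
          by (simp add: blinfun.diff_right)
        ultimately show "norm (\<phi> (i n) x - f x) < s"
          using lip[OF bd[of n]] lip[OF K] s unfolding real_norm_def abs_le_iff abs_less_iff by linarith
      qed
    qed
    from blinfun_pointwise_L2[OF K bd this] r
    have "\<forall>\<^sub>F n in sequentially. L2norm (\<lambda>x. f x - \<phi> (i n) x) < r"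
      by (rule order_tendstoD)
    then obtain n where "L2norm (\<lambda>x. f x - \<phi> (i n) x) < r" by (auto simp: eventually_sequentially)
    then show ?thesis by (intro exI[of _ "to_nat (i n)"]) (simp add: e_def)
  qed
  show ?thesis
  proof (rule that[of e])
    fix g r assume g: "g \<in> L2_dual_closure \<gamma>" and r: "(r :: real) > 0"
    obtain f :: "nat \<Rightarrow> 'a \<Rightarrow>\<^sub>L real" where f: "(\<lambda>n. LINT x|\<gamma>. (g x - blinfun_apply (f n) x)\<^sup>2) \<longlonglongrightarrow> 0"
      using L2_dual_closureD(2)[OF g] by blast
    have "(\<lambda>n. L2norm (\<lambda>x. g x - f n x)) \<longlonglongrightarrow> 0"
      using tendsto_real_sqrt[OF f] by (simp add: L2norm_def)
    from order_tendstoD(2)[OF this, of "r / 2"] r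
    obtain n where n: "L2norm (\<lambda>x. g x - f n x) < r / 2" by (auto simp: eventually_sequentially)
    obtain j where j: "L2norm (\<lambda>x. f n x - e j x) < r / 2" using approx_dual[of "r / 2" "f n"] r by auto
    have "L2norm (\<lambda>x. (g x - f n x) + (f n x - e j x)) \<le> L2norm (\<lambda>x. g x - f n x) + L2norm (\<lambda>x. f n x - e j x)"
      using L2_dual_closureD(1)[OF g] by (intro L2norm_triangle L2_diff) auto
    then show "\<exists>j. L2norm (\<lambda>x. g x - e j x) < r" using n j by (intro exI[of _ j]) simp
  qed
qed

section \<open>Integrals and zero sets of elements of the closed dual\<close>

lemma L2_cos: "(\<lambda>x. cos (blinfun_apply g x + \<theta>)) \<in> L2 \<gamma>"
proof -
  have [measurable]: "(\<lambda>x. cos (blinfun_apply g x + \<theta>)) \<in> borel_measurable borel" by measurable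
  have "integrable \<gamma> (\<lambda>x. (cos (blinfun_apply g x + \<theta>))\<^sup>2)"
    by (intro integrable_const_bound[of _ 1]) (auto simp: abs_square_le_1)
  then show ?thesis by (simp add: L2_iff)
qed

lemma closure_cos_integral:
  fixes g :: "'a \<Rightarrow>\<^sub>L real"
  assumes w: "w \<in> L2_dual_closure \<gamma>"
  shows "(LINT x|\<gamma>. w x * cos (g x + \<theta>)) = - ((LINT x|\<gamma>. w x * g x) * sin \<theta> * exp (- cov g g / 2))"
proof -
  note L = L2_dual_closureD(1)[OF w]
  obtain f :: "nat \<Rightarrow> 'a \<Rightarrow>\<^sub>L real" where f: "(\<lambda>n. LINT x|\<gamma>. (w x - blinfun_apply (f n) x)\<^sup>2) \<longlonglongrightarrow> 0"
    using L2_dual_closureD(2)[OF w] by blast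
  have "(\<lambda>n. cov (f n) g) \<longlonglongrightarrow> (LINT x|\<gamma>. w x * g x)"
    unfolding cov_def by (rule integral_tendsto_L2[OF L _ _ f]) auto
  then have "(\<lambda>n. - (cov (f n) g * sin \<theta> * exp (- cov g g / 2))) \<longlonglongrightarrow>
      - ((LINT x|\<gamma>. w x * g x) * sin \<theta> * exp (- cov g g / 2))"
    by (intro tendsto_intros)
  moreover have "(\<lambda>n. - (cov (f n) g * sin \<theta> * exp (- cov g g / 2))) \<longlonglongrightarrow> (LINT x|\<gamma>. w x * cos (g x + \<theta>))"
    unfolding cov_cos_integral[symmetric] by (rule integral_tendsto_L2[OF L _ L2_cos f]) auto
  ultimately show ?thesis using LIMSEQ_unique by blast
qed

lemma closure_integral_0:
  assumes "w \<in> L2_dual_closure \<gamma>"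
  shows "(LINT x|\<gamma>. w x) = 0"
  using closure_cos_integral[OF assms, of 0 0] by simp

lemma normal_small_ball:
  fixes f :: "'a \<Rightarrow>\<^sub>L real"
  assumes c: "cov f f > 0" and r: "r > 0"
  shows "prob {x. \<bar>f x\<bar> < r} \<le> 2 * r / sqrt (cov f f)"
proof -
  have "\<not> (AE x in \<gamma>. f x = 0)"
  proof
    assume "AE x in \<gamma>. f x = 0"
    then have "cov f f = (LINT x|\<gamma>. 0)" unfolding cov_def by (intro integral_cong_AE) auto
    then show False using c by simp
  qed
  then obtain \<sigma> where s: "\<sigma> > 0" and D: "distributed \<gamma> lborel (blinfun_apply f) (normal_density 0 \<sigma>)"
    using blinfun_law by blast
  have \<sigma>: "sqrt (cov f f) = \<sigma>" using blinfun_law_moments(2)[OF s D] s by simp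
  have eq: "{x. \<bar>f x\<bar> < r} = blinfun_apply f -` {- r<..<r} \<inter> space \<gamma>" by auto
  have "emeasure \<gamma> {x. \<bar>f x\<bar> < r} = (\<integral>\<^sup>+y. ennreal (normal_density 0 \<sigma> y) * indicator {- r<..<r} y \<partial>lborel)"
    unfolding eq by (rule distributed_emeasure[OF D]) simp
  also have "\<dots> \<le> (\<integral>\<^sup>+y. ennreal (1 / \<sigma>) * indicator {- r<..<r} y \<partial>lborel)"
  proof (intro nn_integral_mono mult_right_mono ennreal_leI)
    fix y
    have "1 \<le> sqrt (2 * pi)" using pi_gt3 by simp
    then have "\<sigma> * 1 \<le> \<sigma> * sqrt (2 * pi)" using s by (intro mult_left_mono) auto
    then have "\<sigma> \<le> sqrt (2 * pi * \<sigma>\<^sup>2)" using s by (simp add: real_sqrt_mult mult.commute)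
    then have "1 / sqrt (2 * pi * \<sigma>\<^sup>2) * exp (- (y - 0)\<^sup>2 / (2 * \<sigma>\<^sup>2)) \<le> 1 / \<sigma> * 1"
      using s by (intro mult_mono divide_left_mono) auto
    then show "normal_density 0 \<sigma> y \<le> 1 / \<sigma>" by (simp add: normal_density_def)
  qed simp
  also have "\<dots> = ennreal (1 / \<sigma>) * ennreal (2 * r)"
    using r by (subst nn_integral_cmult_indicator) auto
  also have "\<dots> = ennreal (2 * r / \<sigma>)" using r s by (simp add: ennreal_mult[symmetric])
  finally show ?thesis unfolding \<sigma> using r s by (simp add: emeasure_eq_measure)
qed

text \<open>A normalised limit of Gaussian functionals has no atom at 0. Once an approximant has
  standard deviation at least 1/2, it lies in (-r, r) with probability at most 4 r; where w
  vanishes, either this happens or the approximation error is at least r.\<close>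

lemma closure_nonzero:
  assumes w: "w \<in> L2_dual_closure \<gamma>" and norm: "(LINT x|\<gamma>. (w x)\<^sup>2) = 1"
  shows "AE x in \<gamma>. w x \<noteq> 0"
proof -
  note L = L2_dual_closureD(1)[OF w]
  have wm [measurable]: "w \<in> borel_measurable borel" using L by (rule L2_measurable)
  obtain f :: "nat \<Rightarrow> 'a \<Rightarrow>\<^sub>L real" where f: "(\<lambda>n. LINT x|\<gamma>. (w x - blinfun_apply (f n) x)\<^sup>2) \<longlonglongrightarrow> 0"
    using L2_dual_closureD(2)[OF w] by blast
  have N: "(\<lambda>n. L2norm (\<lambda>x. w x - f n x)) \<longlonglongrightarrow> 0"
    using tendsto_real_sqrt[OF f] by (simp add: L2norm_def)
  have small: "prob {x. w x = 0} \<le> 4 * r" if r: "r > 0" for r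
  proof -
    have "\<forall>\<^sub>F n in sequentially. prob {x. w x = 0} \<le> 4 * r + (LINT x|\<gamma>. (w x - f n x)\<^sup>2) / r\<^sup>2"
      using order_tendstoD(2)[OF N, of "1/2", simplified]
    proof eventually_elim
      case (elim n)
      have "L2norm (\<lambda>x. (w x - f n x) + f n x) \<le> L2norm (\<lambda>x. w x - f n x) + L2norm (f n)"
        using L by (intro L2norm_triangle L2_diff) auto
      then have s: "1/2 \<le> sqrt (cov (f n) (f n))" using elim norm by (simp add: L2norm_def cov_def power2_eq_square)
      then have c: "cov (f n) (f n) > 0"
        by (metis half_gt_zero_iff less_le_trans real_sqrt_gt_0_iff zero_less_one)
      have "prob {x. w x = 0} \<le> prob ({x. \<bar>f n x\<bar> < r} \<union> {x \<in> space \<gamma>. (w x - f n x)\<^sup>2 \<ge> r\<^sup>2})"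
      proof (rule finite_measure_mono)
        show "{x. w x = 0} \<subseteq> {x. \<bar>f n x\<bar> < r} \<union> {x \<in> space \<gamma>. (w x - f n x)\<^sup>2 \<ge> r\<^sup>2}"
          using r by (auto simp: abs_le_square_iff[symmetric])
      qed (simp, measurable)
      also have "\<dots> \<le> prob {x. \<bar>f n x\<bar> < r} + prob {x \<in> space \<gamma>. (w x - f n x)\<^sup>2 \<ge> r\<^sup>2}"
        by (rule measure_Un_le) (simp_all, measurable)
      also have "prob {x. \<bar>f n x\<bar> < r} \<le> 2 * r / sqrt (cov (f n) (f n))" by (rule normal_small_ball[OF c r])
      also have "\<dots> \<le> 2 * r / (1/2)" using s r c by (intro divide_left_mono) auto
      also have "prob {x \<in> space \<gamma>. (w x - f n x)\<^sup>2 \<ge> r\<^sup>2} \<le> (LINT x|\<gamma>. (w x - f n x)\<^sup>2) / r\<^sup>2"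
        using r L2_power2[OF L2_diff[OF L L2_blinfun]]
        by (intro integral_Markov_inequality_measure[where A = "{}"]) auto
      finally show ?case by simp
    qed
    moreover have "(\<lambda>n. 4 * r + (LINT x|\<gamma>. (w x - f n x)\<^sup>2) / r\<^sup>2) \<longlonglongrightarrow> 4 * r + 0 / r\<^sup>2"
      using r by (intro tendsto_intros f) auto
    ultimately show ?thesis by (intro tendsto_lowerbound[of _ "4 * r"]) auto
  qed
  have "prob {x. w x = 0} \<le> 0"
  proof (rule field_le_epsilon)
    fix r :: real assume "r > 0"
    then show "prob {x. w x = 0} \<le> 0 + r" using small[of "r / 4"] by simp
  qed
  then have "prob {x. w x = 0} = 0" by (simp add: measure_le_0_iff)
  then show ?thesis by (subst AE_iff_measurable[of "{x. w x = 0}"]) (auto simp: emeasure_eq_measure)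
qed

end

section \<open>Rotations of the product\<close>

lemma fst_borel_measurable [measurable]:
  "fst \<in> measurable (borel :: ('a::second_countable_topology \<times> 'b::second_countable_topology) measure) borel"
  by (intro borel_measurable_continuous_onI continuous_intros)

lemma snd_borel_measurable [measurable]:
  "snd \<in> measurable (borel :: ('a::second_countable_topology \<times> 'b::second_countable_topology) measure) borel"
  by (intro borel_measurable_continuous_onI continuous_intros)

context centered_gaussian
begin

lemma measurable_gauss2 [simp]: "measurable GG N = measurable borel N"
  by (rule measurable_cong_sets) simp_all

lemma borel_measurable_partial_integral:
  fixes u :: "'a \<times> 'a \<Rightarrow> real"
  assumes "u \<in> borel_measurable borel"
  shows "(\<lambda>x. LINT y|\<gamma>. u (x, y)) \<in> borel_measurable borel"
proof -
  have "(\<lambda>(x, y). u (x, y)) \<in> borel_measurable (borel \<Otimes>\<^sub>M \<gamma>)"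
    using measurable_cong_sets[OF sets_pair_measure_cong[OF refl sets_gauss, of "borel :: 'a measure"] refl, of "borel :: real measure"] assms
    by (simp add: borel_prod case_prod_unfold)
  then show ?thesis by (rule borel_measurable_lebesgue_integral)
qed

lemma gauss2_integrable:
  fixes u :: "'a \<times> 'a \<Rightarrow> real"
  assumes "u \<in> borel_measurable borel" "\<And>p. \<bar>u p\<bar> \<le> K"
  shows "integrable GG u"
  using assms by (intro pp.P.integrable_const_bound[of _ K]) auto

lemma mix_measurable [measurable]:
  "(\<lambda>p :: 'a \<times> 'a. c *\<^sub>R fst p + s *\<^sub>R snd p) \<in> measurable borel borel"
  by (intro borel_measurable_continuous_onI continuous_intros)

lemma integrable_mix:
  fixes u :: "'a \<Rightarrow> real"
  assumes "c\<^sup>2 + s\<^sup>2 = 1" "u \<in> borel_measurable borel"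
  shows "integrable GG (\<lambda>p. u (c *\<^sub>R fst p + s *\<^sub>R snd p)) \<longleftrightarrow> integrable \<gamma> u"
proof -
  have "(\<lambda>p. c *\<^sub>R fst p + s *\<^sub>R snd p) \<in> measurable GG borel" by simp
  from integrable_distr_eq[OF this assms(2)] show ?thesis
    by (simp add: distr_gauss_mix[OF assms(1)])
qed

lemma integral_mix:
  fixes u :: "'a \<Rightarrow> real"
  assumes "c\<^sup>2 + s\<^sup>2 = 1" "u \<in> borel_measurable borel"
  shows "(LINT p|GG. u (c *\<^sub>R fst p + s *\<^sub>R snd p)) = (LINT x|\<gamma>. u x)"
proof -
  have "(\<lambda>p. c *\<^sub>R fst p + s *\<^sub>R snd p) \<in> measurable GG borel" by simp
  from integral_distr[OF this assms(2)] show ?thesis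
    by (simp add: distr_gauss_mix[OF assms(1)])
qed

lemma integral_rot:
  fixes u :: "'a \<times> 'a \<Rightarrow> real"
  assumes "c\<^sup>2 + s\<^sup>2 = 1" "u \<in> borel_measurable borel"
  shows "(LINT p|GG. u (rot c s p)) = (LINT p|GG. u p)"
proof -
  have "rot c s \<in> measurable GG borel" by simp
  from integral_distr[OF this assms(2)] show ?thesis
    by (simp add: distr_rot[OF assms(1)])
qed

end

text \<open>\<open>M\<close> plays the role of the perimeter measure of \<open>E\<close>, and \<open>W (x, y)\<close> that of the value at
  \<open>y\<close> of the element of the closed dual space that represents the normal at \<open>x\<close>; \<open>ibp\<close> is the
  defining integration by parts, tested on trigonometric functions and on directions
  represented by continuous functionals.\<close>

locale gauss_boundary = centered_gaussian \<gamma> for \<gamma> :: "'a::{banach, second_countable_topology} measure" +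
  fixes E :: "'a set" and M :: "'a measure" and W :: "'a \<times> 'a \<Rightarrow> real"
  assumes E [measurable]: "E \<in> sets borel"
    and finite_M: "finite_measure M" and sets_M [simp, measurable_cong]: "sets M = sets borel"
    and W_measurable [measurable]: "W \<in> borel_measurable borel"
    and W_closure: "\<And>x. (\<lambda>y. W (x, y)) \<in> L2_dual_closure \<gamma>"
    and W_norm: "AE x in M. (LINT y|\<gamma>. (W (x, y))\<^sup>2) = 1"
    and ibp: "\<And>f g \<theta>. cov f g * (LINT x|\<gamma>. indicat_real E x * cos (f x + \<theta>)) =
      - (LINT x|M. sin (f x + \<theta>) * (LINT y|\<gamma>. W (x, y) * g y))
      + (LINT x|\<gamma>. indicat_real E x * (sin (f x + \<theta>) * g x))"
begin

sublocale M: finite_measure M by (rule finite_M)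

sublocale MG: pair_sigma_finite M \<gamma> ..

abbreviation MG :: "('a \<times> 'a) measure" where "MG \<equiv> M \<Otimes>\<^sub>M \<gamma>"

lemma space_M [simp]: "space M = UNIV"
  using sets_eq_imp_space_eq[OF sets_M] by simp

lemma measurable_M [simp]: "measurable M N = measurable borel N"
  by (rule measurable_cong_sets) simp_all

lemma sets_MG [simp]: "sets MG = sets borel"
  unfolding borel_prod[symmetric] by (rule sets_pair_measure_cong) simp_all

lemma space_MG [simp]: "space MG = UNIV"
  by (simp add: space_pair_measure)

lemma measurable_MG [simp]: "measurable MG N = measurable borel N"
  by (rule measurable_cong_sets) simp_all

sublocale fMG: finite_measure MG
  by (rule finite_measureI) (simp add: space_pair_measure emeasure_pair_measure_Times
      M.emeasure_eq_measure emeasure_eq_measure ennreal_mult_less_top flip: UNIV_Times_UNIV)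

text \<open>In terms of representatives, the Cameron-Martin inner product of the normal at x with
  the vector \<open>cm_shift g\<close>.\<close>

definition pairing :: "'a \<Rightarrow> ('a \<Rightarrow>\<^sub>L real) \<Rightarrow> real" where
  "pairing x g = (LINT y|\<gamma>. W (x, y) * g y)"

lemma pairing_measurable [measurable]: "(\<lambda>x. pairing x g) \<in> borel_measurable borel"
proof -
  have "(\<lambda>p. W p * g (snd p)) \<in> borel_measurable borel" by measurable
  from borel_measurable_partial_integral[OF this] show ?thesis by (simp add: pairing_def)
qed

lemma pairing_bound: "AE x in M. \<bar>pairing x g\<bar> \<le> sqrt (cov g g)"
  using W_norm
proof eventually_elim
  case (elim x)
  then have "(pairing x g)\<^sup>2 \<le> cov g g"
    using L2_Cauchy_Schwarz[OF L2_dual_closureD(1)[OF W_closure] L2_blinfun, of x g]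
    by (simp add: pairing_def cov_def power2_eq_square)
  then show ?case by (simp add: real_le_rsqrt)
qed

lemma pairing_integrable:
  assumes [measurable]: "u \<in> borel_measurable borel" and u: "\<And>x. \<bar>u x\<bar> \<le> 1"
  shows "integrable M (\<lambda>x. u x * pairing x g)"
proof (rule M.integrable_const_bound[of _ "sqrt (cov g g)"])
  show "AE x in M. norm (u x * pairing x g) \<le> sqrt (cov g g)"
    using pairing_bound[of g]
  proof eventually_elim
    case (elim x)
    then have "\<bar>u x\<bar> * \<bar>pairing x g\<bar> \<le> 1 * sqrt (cov g g)" using u[of x] by (intro mult_mono) auto
    then show ?case by (simp add: abs_mult)
  qed
qed simp

lemma W_integrable: "integrable MG W"
proof (rule MG.Fubini_integrable)
  show "AE x in M. integrable \<gamma> (\<lambda>y. W (x, y))"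
    using L2_integrable[OF L2_dual_closureD(1)[OF W_closure]] by simp
  have "(\<lambda>p. norm (W p)) \<in> borel_measurable borel" by measurable
  then have m: "(\<lambda>x. LINT y|\<gamma>. norm (W (x, y))) \<in> borel_measurable borel"
    by (rule borel_measurable_partial_integral)
  show "integrable M (\<lambda>x. LINT y|\<gamma>. norm (W (x, y)))"
  proof (rule M.integrable_const_bound[of _ 1])
    show "AE x in M. norm (LINT y|\<gamma>. norm (W (x, y))) \<le> 1"
      using W_norm
    proof eventually_elim
      case (elim x)
      have "(LINT y|\<gamma>. \<bar>W (x, y)\<bar>)\<^sup>2 \<le> 1\<^sup>2"
        using L2_L1[OF L2_dual_closureD(1)[OF W_closure], of x] elim by simp
      then have "(LINT y|\<gamma>. \<bar>W (x, y)\<bar>) \<le> 1" by (rule power2_le_imp_le) simp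
      then show ?case by simp
    qed
  qed (use m in simp)
qed simp

lemma W_mult_integrable:
  assumes u: "u \<in> borel_measurable borel" and K: "\<And>p. \<bar>u p\<bar> \<le> K"
  shows "integrable MG (\<lambda>p. u p * W p)"
proof (rule Bochner_Integration.integrable_bound)
  show "integrable MG (\<lambda>p. K * W p)" using W_integrable by simp
  show "AE p in MG. norm (u p * W p) \<le> norm (K * W p)"
  proof (rule AE_I2)
    fix p show "norm (u p * W p) \<le> norm (K * W p)"
      using K[of p] by (simp add: abs_mult mult_right_mono)
  qed
qed (use u in simp)

lemma sin_integral:
  fixes f :: "'a \<Rightarrow>\<^sub>L real"
  shows "(LINT x|\<gamma>. sin (f x + \<theta>)) = sin \<theta> * exp (- cov f f / 2)"
  using cos_integral[of f "\<theta> - pi/2"] by (simp add: cos_diff cos_add sin_diff algebra_simps)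

text \<open>The infinitesimal rotation at angle 0: the velocity of \<open>rot\<close> is (y, -x), so
  the left side is minus the derivative of the integral of the cosine over E \<times> X. Integrating
  out y leaves \<open>ibp\<close> times the factor e; on the right, the integral over y turns W into
  the pairing with the same factor.\<close>

lemma rotation_static:
  fixes f g :: "'a \<Rightarrow>\<^sub>L real"
  shows "(LINT p|GG. indicat_real E (fst p) * ((f (snd p) - g (fst p)) * sin (f (fst p) + g (snd p) + \<theta>)))
    = (LINT p|MG. cos (f (fst p) + g (snd p) + \<theta>) * W p)"
proof -
  define e where "e = exp (- cov g g / 2)"
  let ?L = "\<lambda>p. indicat_real E (fst p) * ((f (snd p) - g (fst p)) * sin (f (fst p) + g (snd p) + \<theta>))"
  have i1: "integrable GG (\<lambda>p. f (snd p))" and i2: "integrable GG (\<lambda>p. g (fst p))"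
    using integrable_mix[of 0 1 "blinfun_apply f"] integrable_mix[of 1 0 "blinfun_apply g"] integrable_blinfun by auto
  have "integrable GG ?L"
  proof (rule Bochner_Integration.integrable_bound)
    show "integrable GG (\<lambda>p. \<bar>f (snd p)\<bar> + \<bar>g (fst p)\<bar>)" using i1 i2 by simp
    show "AE p in GG. norm (?L p) \<le> norm (\<bar>f (snd p)\<bar> + \<bar>g (fst p)\<bar>)"
    proof (rule AE_I2)
      fix p :: "'a \<times> 'a"
      have "\<bar>?L p\<bar> \<le> 1 * (\<bar>f (snd p) - g (fst p)\<bar> * 1)"
        unfolding abs_mult by (intro mult_mono) auto
      then show "norm (?L p) \<le> norm (\<bar>f (snd p)\<bar> + \<bar>g (fst p)\<bar>)" by simp
    qed
  qed simp
  from pp.integral_fst'[OF this]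
  have "(LINT p|GG. ?L p)
      = (LINT x|\<gamma>. LINT y|\<gamma>. indicat_real E x * ((f y - g x) * sin (g y + (f x + \<theta>))))"
    by (simp add: add_ac)
  also have "\<dots> = (LINT x|\<gamma>. indicat_real E x * (cov f g * cos (f x + \<theta>) * e - g x * (sin (f x + \<theta>) * e)))"
  proof (intro Bochner_Integration.integral_cong refl)
    fix x
    have a: "integrable \<gamma> (\<lambda>y. f y * sin (g y + (f x + \<theta>)))"
      by (rule Bochner_Integration.integrable_bound[OF integrable_blinfun[of f]])
        (auto simp: abs_mult intro!: mult_left_le)
    have b: "integrable \<gamma> (\<lambda>y. sin (g y + (f x + \<theta>)))"
      by (rule integrable_const_bound[of _ 1]) auto
    show "(LINT y|\<gamma>. indicat_real E x * ((f y - g x) * sin (g y + (f x + \<theta>))))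
        = indicat_real E x * (cov f g * cos (f x + \<theta>) * e - g x * (sin (f x + \<theta>) * e))"
      using a b by (simp add: left_diff_distrib cov_sin_integral sin_integral e_def)
  qed
  also have "\<dots> = (LINT x|\<gamma>. e * cov f g * (indicat_real E x * cos (f x + \<theta>)) - e * (indicat_real E x * (sin (f x + \<theta>) * g x)))"
    by (simp add: algebra_simps)
  also have "\<dots> = e * (cov f g * (LINT x|\<gamma>. indicat_real E x * cos (f x + \<theta>)) - (LINT x|\<gamma>. indicat_real E x * (sin (f x + \<theta>) * g x)))"
  proof -
    have a: "integrable \<gamma> (\<lambda>x. indicat_real E x * cos (f x + \<theta>))"
      by (rule integrable_const_bound[of _ 1]) (auto simp: indicator_def)
    have b: "integrable \<gamma> (\<lambda>x. indicat_real E x * (sin (f x + \<theta>) * g x))"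
      by (rule Bochner_Integration.integrable_bound[OF integrable_blinfun[of g]])
        (auto simp: abs_mult indicator_def intro!: mult_left_le_one_le)
    show ?thesis
      by (subst Bochner_Integration.integral_diff) (use a b in \<open>simp_all add: right_diff_distrib mult.assoc\<close>)
  qed
  also have "\<dots> = - e * (LINT x|M. sin (f x + \<theta>) * pairing x g)"
    unfolding ibp pairing_def by simp
  also have "\<dots> = (LINT x|M. LINT y|\<gamma>. cos (f x + g y + \<theta>) * W (x, y))"
  proof -
    have "(LINT y|\<gamma>. cos (f x + g y + \<theta>) * W (x, y)) = - e * (sin (f x + \<theta>) * pairing x g)" for x
      using closure_cos_integral[OF W_closure, of x g "f x + \<theta>"]
      by (simp add: e_def pairing_def algebra_simps)
    then show ?thesis by simp
  qed
  also have "\<dots> = (LINT p|MG. cos (f (fst p) + g (snd p) + \<theta>) * W p)"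
  proof -
    have "integrable MG (\<lambda>p. cos (f (fst p) + g (snd p) + \<theta>) * W p)"
      by (rule W_mult_integrable[of _ 1]) auto
    from MG.integral_fst'[OF this] show ?thesis by simp
  qed
  finally show ?thesis .
qed

end

section \<open>Motion of the rotated set\<close>

lemma integrable_indicator_Icc: "integrable lborel (\<lambda>b. c * indicat_real {0..a} b)" for a c :: real
  by (intro integrable_mult_right integrable_real_indicator) (auto simp: emeasure_lborel_Icc_eq)

context gauss_boundary
begin

text \<open>By \<open>rotation_identity\<close> this is the density, in the angle b, of the loss
  that the integral of u over E \<times> X suffers when u is rotated.\<close>

definition flux :: "('a \<times> 'a \<Rightarrow> real) \<Rightarrow> real \<Rightarrow> real" where
  "flux u b = (LINT p|MG. u (rot (cos b) (sin b) p) * W p)"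

lemma rot_family_measurable:
  "(\<lambda>q :: real \<times> ('a \<times> 'a). rot (cos (fst q)) (sin (fst q)) (snd q)) \<in> borel_measurable borel"
  unfolding rot_def by (intro borel_measurable_continuous_onI continuous_intros)

lemma flux_measurable:
  assumes [measurable]: "u \<in> borel_measurable borel"
  shows "flux u \<in> borel_measurable borel"
proof -
  have m: "sets ((borel :: real measure) \<Otimes>\<^sub>M MG) = sets (borel :: (real \<times> ('a \<times> 'a)) measure)"
    unfolding borel_prod[symmetric] by (rule sets_pair_measure_cong) (simp_all add: borel_prod)
  have "(\<lambda>q :: real \<times> ('a \<times> 'a). u (rot (cos (fst q)) (sin (fst q)) (snd q)) * W (snd q)) \<in> borel_measurable borel"
    using rot_family_measurable by measurable
  then have "(\<lambda>(b, p). u (rot (cos b) (sin b) p) * W p) \<in> borel_measurable (borel \<Otimes>\<^sub>M MG)"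
    by (simp add: case_prod_unfold measurable_cong_sets[OF m refl])
  from MG.P.borel_measurable_lebesgue_integral[OF this] show ?thesis unfolding flux_def .
qed

lemma flux_integrable_integrand:
  assumes "u \<in> borel_measurable borel" "\<And>p. \<bar>u p\<bar> \<le> K"
  shows "integrable MG (\<lambda>p. u (rot (cos b) (sin b) p) * W p)"
proof -
  have "(\<lambda>p. u (rot (cos b) (sin b) p)) \<in> borel_measurable borel"
    using assms(1) by measurable
  then show ?thesis using assms(2) by (rule W_mult_integrable)
qed

lemma flux_bound:
  assumes "u \<in> borel_measurable borel" "\<And>p. \<bar>u p\<bar> \<le> K"
  shows "\<bar>flux u b\<bar> \<le> K * (LINT p|MG. \<bar>W p\<bar>)"
proof -
  have "\<bar>flux u b\<bar> \<le> (LINT p|MG. \<bar>u (rot (cos b) (sin b) p) * W p\<bar>)"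
    unfolding flux_def using integral_norm_bound by simp
  also have "\<dots> \<le> (LINT p|MG. K * \<bar>W p\<bar>)"
  proof (rule integral_mono)
    show "integrable MG (\<lambda>p. \<bar>u (rot (cos b) (sin b) p) * W p\<bar>)"
      using flux_integrable_integrand[OF assms] by (rule integrable_abs)
    show "integrable MG (\<lambda>p. K * \<bar>W p\<bar>)" using W_integrable by simp
    show "\<bar>u (rot (cos b) (sin b) p) * W p\<bar> \<le> K * \<bar>W p\<bar>" for p
      unfolding abs_mult using assms(2) by (rule mult_right_mono) simp
  qed
  finally show ?thesis by simp
qed

lemma flux_integrable:
  assumes u: "u \<in> borel_measurable borel" "\<And>p. \<bar>u p\<bar> \<le> K"
  shows "integrable lborel (\<lambda>b. indicat_real {0..a} b * flux u b)"
proof (rule Bochner_Integration.integrable_bound)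
  show "integrable lborel (\<lambda>b. K * (LINT p|MG. \<bar>W p\<bar>) * indicat_real {0..a} b)"
    by (rule integrable_indicator_Icc)
  show "(\<lambda>b. indicat_real {0..a} b * flux u b) \<in> borel_measurable lborel"
    using flux_measurable[OF u(1)] by simp
  show "AE b in lborel. norm (indicat_real {0..a} b * flux u b) \<le> norm (K * (LINT p|MG. \<bar>W p\<bar>) * indicat_real {0..a} b)"
  proof (rule AE_I2)
    fix b show "norm (indicat_real {0..a} b * flux u b) \<le> norm (K * (LINT p|MG. \<bar>W p\<bar>) * indicat_real {0..a} b)"
      using flux_bound[OF u, of b] by (auto simp: indicator_def)
  qed
qed

text \<open>A rotated cosine is again a cosine, with rotated functionals f' and g', so
  \<open>rotation_static\<close> applies at every angle b; the fundamental theorem of calculus and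
  Fubini integrate the result over [0, a].\<close>

lemma rotation_identity_cos:
  fixes f g :: "'a \<Rightarrow>\<^sub>L real" and \<theta> :: real
  assumes a: "0 \<le> a"
  defines "u \<equiv> \<lambda>p. cos (f (fst p) + g (snd p) + \<theta>)"
  shows "(LINT p|GG. indicat_real E (fst p) * (u (rot (cos a) (sin a) p) - u p))
    = - (LINT b|lborel. indicat_real {0..a} b * flux u b)"
proof -
  \<comment> \<open>\<open>k b\<close> is minus the derivative of the rotated cosine in b;
    \<open>F\<close> will dominate it uniformly in the angle.\<close>
  define k where "k b p = (cos b * f (snd p) + - sin b * g (snd p) - (sin b * f (fst p) + cos b * g (fst p))) *
      sin (cos b * f (fst p) - sin b * g (fst p) + (sin b * f (snd p) + cos b * g (snd p)) + \<theta>)" for b p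
  define K where "K p b = - (indicat_real E (fst p) * (indicat_real {0..a} b * k b p))" for p b
  define F where "F p = \<bar>f (fst p)\<bar> + \<bar>g (fst p)\<bar> + \<bar>f (snd p)\<bar> + \<bar>g (snd p)\<bar>" for p
  interpret L: pair_sigma_finite "GG" lborel ..
  have u_rot: "u (rot (cos b) (sin b) p) = cos (cos b * f (fst p) - sin b * g (fst p) + (sin b * f (snd p) + cos b * g (snd p)) + \<theta>)" for b p
    by (simp add: u_def rot_def blinfun.add_right blinfun.diff_right blinfun.scaleR_right algebra_simps)
  have cont: "continuous_on UNIV (\<lambda>q. k (fst q) (snd q))"
    unfolding k_def by (intro continuous_intros)
  have k_cont: "continuous_on S (\<lambda>b. k b p)" for S p
    unfolding k_def by (intro continuous_intros)
  have F0: "0 \<le> F p" for p by (simp add: F_def)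
  have F_int: "integrable GG F"
    unfolding F_def
    using integrable_mix[of 0 1 "blinfun_apply f"] integrable_mix[of 1 0 "blinfun_apply g"]
      integrable_mix[of 0 1 "blinfun_apply g"] integrable_mix[of 1 0 "blinfun_apply f"] integrable_blinfun by auto
  have k_bound: "\<bar>k b p\<bar> \<le> F p" for b p
  proof -
    have c: "\<bar>cos b * y\<bar> \<le> \<bar>y\<bar>" and s: "\<bar>sin b * y\<bar> \<le> \<bar>y\<bar>" for y
      by (auto simp: abs_mult intro!: mult_left_le_one_le)
    have "\<bar>cos b * f (snd p) + - sin b * g (snd p) - (sin b * f (fst p) + cos b * g (fst p))\<bar> \<le> F p"
      using c[of "f (snd p)"] s[of "g (snd p)"] s[of "f (fst p)"] c[of "g (fst p)"]
      unfolding F_def minus_mult_left[symmetric] by linarith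
    then have "\<bar>k b p\<bar> \<le> F p * 1" unfolding k_def abs_mult by (intro mult_mono) (auto simp: F_def)
    then show ?thesis by simp
  qed
  have K_meas: "(\<lambda>(p, b). K p b) \<in> borel_measurable (GG \<Otimes>\<^sub>M lborel)"
  proof -
    have m: "sets (GG \<Otimes>\<^sub>M lborel) = sets (borel :: (('a \<times> 'a) \<times> real) measure)"
      unfolding borel_prod[symmetric] by (rule sets_pair_measure_cong) (simp_all add: borel_prod)
    have "continuous_on UNIV (\<lambda>q. k (snd q) (fst q))" unfolding k_def by (intro continuous_intros)
    then have [measurable]: "(\<lambda>q. k (snd q) (fst q)) \<in> borel_measurable borel"
      by (rule borel_measurable_continuous_onI)
    have "(\<lambda>q. K (fst q) (snd q)) \<in> borel_measurable borel"
      unfolding K_def by measurable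
    then show ?thesis by (simp add: case_prod_unfold measurable_cong_sets[OF m refl])
  qed
  have K_bound: "\<bar>K p b\<bar> \<le> F p * indicat_real {0..a} b" for p b
    using k_bound[of b p] by (auto simp: K_def indicator_def abs_mult F_def)
  have K_slice: "integrable lborel (\<lambda>b. K p b)" for p
  proof (rule Bochner_Integration.integrable_bound)
    show "integrable lborel (\<lambda>b. F p * indicat_real {0..a} b)"
      by (rule integrable_indicator_Icc)
    show "K p \<in> borel_measurable lborel"
      using measurable_Pair2[OF K_meas, of p] by simp
    show "AE b in lborel. norm (K p b) \<le> norm (F p * indicat_real {0..a} b)"
      using K_bound F0 by (intro AE_I2) (simp add: abs_mult)
  qed
  have K_int: "integrable (GG \<Otimes>\<^sub>M lborel) (\<lambda>(p, b). K p b)"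
  proof (rule L.Fubini_integrable[OF K_meas])
    show "AE p in GG. integrable lborel (\<lambda>b. case (p, b) of (p, b) \<Rightarrow> K p b)"
      using K_slice by simp
    show "integrable GG (\<lambda>p. LINT b|lborel. norm (case (p, b) of (p, b) \<Rightarrow> K p b))"
    proof (rule Bochner_Integration.integrable_bound)
      show "integrable GG (\<lambda>p. a * F p)" using F_int by simp
      have "(\<lambda>(p, b). norm (K p b)) \<in> borel_measurable (GG \<Otimes>\<^sub>M lborel)"
        using measurable_compose[OF K_meas borel_measurable_norm] by (simp add: case_prod_unfold)
      from lborel.borel_measurable_lebesgue_integral[OF this]
      show "(\<lambda>p. LINT b|lborel. norm (case (p, b) of (p, b) \<Rightarrow> K p b)) \<in> borel_measurable GG" by simp
      show "AE p in GG. norm (LINT b|lborel. norm (case (p, b) of (p, b) \<Rightarrow> K p b)) \<le> norm (a * F p)"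
      proof (rule AE_I2)
        fix p
        have "(LINT b|lborel. norm (K p b)) \<le> (LINT b|lborel. F p * indicat_real {0..a} b)"
          using K_bound by (intro integral_mono integrable_indicator_Icc integrable_norm[OF K_slice]) simp
        also have "\<dots> = a * F p" using a by simp
        finally show "norm (LINT b|lborel. norm (case (p, b) of (p, b) \<Rightarrow> K p b)) \<le> norm (a * F p)" by simp
      qed
    qed
  qed
  have "(LINT p|GG. indicat_real E (fst p) * (u (rot (cos a) (sin a) p) - u p))
      = (LINT p|GG. LINT b|lborel. K p b)"
  proof (intro Bochner_Integration.integral_cong refl)
    fix p
    have "(LINT b|lborel. indicat_real {0..a} b *\<^sub>R (- k b p)) = u (rot (cos a) (sin a) p) - u (rot (cos 0) (sin 0) p)"
    proof (rule integral_FTC_atLeastAtMost[OF a])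
      show "((\<lambda>b. u (rot (cos b) (sin b) p)) has_vector_derivative - k b p) (at b within {0..a})" for b
        unfolding u_rot k_def
        by (auto intro!: derivative_eq_intros simp: has_real_derivative_iff_has_vector_derivative[symmetric] algebra_simps)
      show "continuous_on {0..a} (\<lambda>b. - k b p)" by (intro continuous_intros k_cont)
    qed
    also have "rot (cos 0) (sin 0) p = p" by (simp add: rot_def)
    finally have *: "u (rot (cos a) (sin a) p) - u p = (LINT b|lborel. - (indicat_real {0..a} b * k b p))" by simp
    show "indicat_real E (fst p) * (u (rot (cos a) (sin a) p) - u p) = (LINT b|lborel. K p b)"
      unfolding * K_def by (simp flip: integral_mult_right_zero)
  qed
  also have "\<dots> = (LINT b|lborel. LINT p|GG. K p b)"
    by (rule L.Fubini_integral[OF K_int, symmetric])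
  also have "\<dots> = (LINT b|lborel. - (indicat_real {0..a} b * flux u b))"
  proof (intro Bochner_Integration.integral_cong refl)
    fix b
    define f' g' where "f' = cos b *\<^sub>R f - sin b *\<^sub>R g" and "g' = sin b *\<^sub>R f + cos b *\<^sub>R g"
    have "(LINT p|GG. indicat_real E (fst p) * k b p)
        = (LINT p|GG. indicat_real E (fst p) * ((f' (snd p) - g' (fst p)) * sin (f' (fst p) + g' (snd p) + \<theta>)))"
      by (simp add: k_def f'_def g'_def blinfun.add_left blinfun.diff_left blinfun.scaleR_left)
    also have "\<dots> = (LINT p|MG. cos (f' (fst p) + g' (snd p) + \<theta>) * W p)" by (rule rotation_static)
    also have "\<dots> = flux u b"
      unfolding flux_def u_rot by (simp add: f'_def g'_def blinfun.add_left blinfun.diff_left blinfun.scaleR_left)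
    finally have *: "(LINT p|GG. indicat_real E (fst p) * k b p) = flux u b" .
    have "(LINT p|GG. K p b) = (LINT p|GG. - indicat_real {0..a} b * (indicat_real E (fst p) * k b p))"
      by (simp add: K_def mult_ac)
    then show "(LINT p|GG. K p b) = - (indicat_real {0..a} b * flux u b)" by (simp add: *)
  qed
  finally show ?thesis by simp
qed

text \<open>The infinitesimal generator of the rotations is antisymmetric, so that the rotated measure
  \<open>\<chi>\<^sub>E \<gamma> \<otimes> \<gamma>\<close> moves with velocity given by the rotated perimeter measure \<open>W M \<otimes> \<gamma>\<close>.\<close>

lemma rotation_identity:
  fixes u :: "'a \<times> 'a \<Rightarrow> real"
  assumes u: "u \<in> borel_measurable borel" "\<And>p. \<bar>u p\<bar> \<le> K" and a: "0 \<le> a"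
  shows "(LINT p|GG. indicat_real E (fst p) * (u (rot (cos a) (sin a) p) - u p))
    = - (LINT b|lborel. indicat_real {0..a} b * flux u b)"
  using u
proof (induction u rule: trig_monotone_class)
  case (cos f \<theta>)
  obtain f1 f2 :: "'a \<Rightarrow>\<^sub>L real" where f: "\<And>x y. f (x, y) = f1 x + f2 y" using blinfun_prod_split[of f] by blast
  have "f p = f1 (fst p) + f2 (snd p)" for p using f[of "fst p" "snd p"] by simp
  then show ?case using rotation_identity_cos[OF a, of f1 f2 \<theta>] by simp
next
  case (add u v A B)
  have ri: "integrable GG (\<lambda>p. indicat_real E (fst p) * (w (rot (cos a) (sin a) p) - w p))"
    if [measurable]: "w \<in> borel_measurable borel" and b: "\<And>p. \<bar>w p\<bar> \<le> C" for w C
  proof (rule pp.P.integrable_const_bound[of _ "C + C"])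
    show "AE p in GG. norm (indicat_real E (fst p) * (w (rot (cos a) (sin a) p) - w p)) \<le> C + C"
    proof (rule AE_I2)
      fix p show "norm (indicat_real E (fst p) * (w (rot (cos a) (sin a) p) - w p)) \<le> C + C"
        using b[of p] b[of "rot (cos a) (sin a) p"] by (auto simp: indicator_def)
    qed
  qed simp
  have "flux (\<lambda>p. u p + v p) b = flux u b + flux v b" for b
    using flux_integrable_integrand[OF add(1,3)] flux_integrable_integrand[OF add(2,4)]
    unfolding flux_def by (simp add: distrib_right)
  moreover have "(\<lambda>p. indicat_real E (fst p) * (u (rot (cos a) (sin a) p) + v (rot (cos a) (sin a) p) - (u p + v p)))
      = (\<lambda>p. indicat_real E (fst p) * (u (rot (cos a) (sin a) p) - u p) + indicat_real E (fst p) * (v (rot (cos a) (sin a) p) - v p))"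
    by (auto simp: algebra_simps)
  ultimately show ?case
    using ri[OF add(1,3)] ri[OF add(2,4)] flux_integrable[OF add(1,3), of a] flux_integrable[OF add(2,4), of a] add(5,6)
    by (simp add: distrib_left)
next
  case (scale c u A)
  have "flux (\<lambda>p. c * u p) b = c * flux u b" for b
    unfolding flux_def by (simp add: mult.assoc)
  moreover have "(\<lambda>p. indicat_real E (fst p) * (c * u (rot (cos a) (sin a) p) - c * u p))
      = (\<lambda>p. c * (indicat_real E (fst p) * (u (rot (cos a) (sin a) p) - u p)))"
    by (simp add: algebra_simps)
  ultimately show ?case using scale(3) by (simp add: mult.left_commute)
next
  case (lim U v A)
  note [measurable] = lim(1,2)
  have c1: "(\<lambda>n. LINT p|GG. indicat_real E (fst p) * (U n (rot (cos a) (sin a) p) - U n p))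
      \<longlonglongrightarrow> (LINT p|GG. indicat_real E (fst p) * (v (rot (cos a) (sin a) p) - v p))"
  proof (rule integral_dominated_convergence[where w = "\<lambda>_. A + A"])
    show "AE p in GG. (\<lambda>n. indicat_real E (fst p) * (U n (rot (cos a) (sin a) p) - U n p))
        \<longlonglongrightarrow> indicat_real E (fst p) * (v (rot (cos a) (sin a) p) - v p)"
      by (intro AE_I2 tendsto_intros lim(4))
    show "AE p in GG. norm (indicat_real E (fst p) * (U n (rot (cos a) (sin a) p) - U n p)) \<le> A + A" for n
    proof (rule AE_I2)
      fix p show "norm (indicat_real E (fst p) * (U n (rot (cos a) (sin a) p) - U n p)) \<le> A + A"
        using lim(3)[of n p] lim(3)[of n "rot (cos a) (sin a) p"] by (auto simp: indicator_def)
    qed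
  qed simp_all
  have c2: "(\<lambda>n. LINT b|lborel. indicat_real {0..a} b * flux (U n) b)
      \<longlonglongrightarrow> (LINT b|lborel. indicat_real {0..a} b * flux v b)"
  proof (rule integral_dominated_convergence[where w = "\<lambda>b. A * (LINT p|MG. \<bar>W p\<bar>) * indicat_real {0..a} b"])
    show "AE b in lborel. (\<lambda>n. indicat_real {0..a} b * flux (U n) b) \<longlonglongrightarrow> indicat_real {0..a} b * flux v b"
    proof (intro AE_I2 tendsto_mult tendsto_const)
      fix b
      show "(\<lambda>n. flux (U n) b) \<longlonglongrightarrow> flux v b"
        unfolding flux_def
      proof (rule integral_dominated_convergence[where w = "\<lambda>p. A * \<bar>W p\<bar>"])
        show "AE p in MG. (\<lambda>n. U n (rot (cos b) (sin b) p) * W p) \<longlonglongrightarrow> v (rot (cos b) (sin b) p) * W p"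
          by (intro AE_I2 tendsto_intros lim(4))
        show "AE p in MG. norm (U n (rot (cos b) (sin b) p) * W p) \<le> A * \<bar>W p\<bar>" for n
          using lim(3) by (intro AE_I2) (simp add: abs_mult mult_right_mono)
      qed (use W_integrable in simp_all)
    qed
    show "integrable lborel (\<lambda>b. A * (LINT p|MG. \<bar>W p\<bar>) * indicat_real {0..a} b)"
      by (rule integrable_indicator_Icc)
    show "AE b in lborel. norm (indicat_real {0..a} b * flux (U n) b) \<le> A * (LINT p|MG. \<bar>W p\<bar>) * indicat_real {0..a} b" for n
      using flux_bound[OF lim(1,3)] by (intro AE_I2) (auto simp: indicator_def)
  qed (use flux_measurable[OF lim(1)] flux_measurable[OF lim(2)] in simp_all)
  show ?case by (rule LIMSEQ_unique[OF c1[unfolded lim(5)] tendsto_minus[OF c2]])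
qed

section \<open>Overlap of a set with its rotated copy\<close>

definition overlap :: "real \<Rightarrow> real" where
  "overlap a = (LINT p|GG. indicat_real E (fst p) * indicat_real E (fst (rot (cos a) (sin a) p)))"

definition E_flux :: "real \<Rightarrow> real" where
  "E_flux = flux (\<lambda>p. indicat_real E (fst p))"

definition max_flux :: real where
  "max_flux = (LINT p|MG. max 0 (W p))"

lemma E_indicator: "(\<lambda>p :: 'a \<times> 'a. indicat_real E (fst p)) \<in> borel_measurable borel"
    "\<And>p :: 'a \<times> 'a. \<bar>indicat_real E (fst p)\<bar> \<le> 1"
proof -
  show "(\<lambda>p :: 'a \<times> 'a. indicat_real E (fst p)) \<in> borel_measurable borel"
    by (rule measurable_compose[OF fst_borel_measurable borel_measurable_indicator[OF E]])
  show "\<bar>indicat_real E (fst p)\<bar> \<le> 1" for p :: "'a \<times> 'a" by (simp add: indicator_def)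
qed

lemma W_mean: "(LINT p|MG. W p) = 0"
  using MG.integral_fst'[OF W_integrable] closure_integral_0[OF W_closure] by simp

text \<open>W (x, .) has mean zero as an element of the closed dual, so the positive and the
  negative part of W carry the same mass.\<close>

lemma abs_W_integral: "(LINT p|MG. \<bar>W p\<bar>) = 2 * max_flux"
proof -
  have i: "integrable MG (\<lambda>p. max 0 (W p))" using W_integrable by simp
  have "(LINT p|MG. \<bar>W p\<bar>) = (LINT p|MG. 2 * max 0 (W p) - W p)"
    by (intro Bochner_Integration.integral_cong) auto
  also have "\<dots> = 2 * max_flux"
    using i W_integrable by (simp add: max_flux_def W_mean)
  finally show ?thesis .
qed

lemma E_flux_le: "E_flux b \<le> max_flux"
  unfolding E_flux_def flux_def max_flux_def
  using flux_integrable_integrand[OF E_indicator] W_integrable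
  by (intro integral_mono) (auto simp: indicator_def)

lemma E_flux_integrable: "integrable lborel (\<lambda>b. indicat_real {0..a} b * E_flux b)"
  unfolding E_flux_def by (rule flux_integrable[OF E_indicator])

lemma E_measure_fst: "(LINT p|GG. indicat_real E (fst p)) = prob E"
  using integral_mix[of 1 0 "indicat_real E"] by simp

lemma E_measure_rot:
  "(LINT p|GG. indicat_real E (fst (rot (cos a) (sin a) p))) = prob E"
  using integral_rot[of "cos a" "sin a" "\<lambda>p. indicat_real E (fst p)"] E_measure_fst by simp

lemma overlap_deficit:
  assumes "0 \<le> a"
  shows "prob E - overlap a = (LINT b|lborel. indicat_real {0..a} b * E_flux b)"
proof -
  have "(LINT p|GG. indicat_real E (fst p) * (indicat_real E (fst (rot (cos a) (sin a) p)) - indicat_real E (fst p)))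
      = (LINT p|GG. indicat_real E (fst p) * indicat_real E (fst (rot (cos a) (sin a) p)) - indicat_real E (fst p))"
    by (intro Bochner_Integration.integral_cong) (auto simp: indicator_def)
  also have "\<dots> = overlap a - prob E"
    unfolding overlap_def E_measure_fst[symmetric]
    by (intro Bochner_Integration.integral_diff gauss2_integrable[of _ 1]) (auto simp: indicator_def)
  finally show ?thesis
    using rotation_identity[OF E_indicator assms] by (simp add: E_flux_def)
qed

lemma overlap_diff:
  assumes "0 \<le> a" "a \<le> a'"
  shows "overlap a - overlap a' = (LINT b|lborel. indicat_real {a<..a'} b * E_flux b)"
proof -
  have "overlap a - overlap a' = (LINT b|lborel. indicat_real {0..a'} b * E_flux b) - (LINT b|lborel. indicat_real {0..a} b * E_flux b)"
    using overlap_deficit[of a] overlap_deficit[of a'] assms by simp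
  also have "\<dots> = (LINT b|lborel. indicat_real {0..a'} b * E_flux b - indicat_real {0..a} b * E_flux b)"
    by (simp add: E_flux_integrable)
  also have "\<dots> = (LINT b|lborel. indicat_real {a<..a'} b * E_flux b)"
    using assms by (intro Bochner_Integration.integral_cong) (auto simp: indicator_def)
  finally show ?thesis .
qed

lemma overlap_upper:
  assumes "0 \<le> a"
  shows "prob E - overlap a \<le> a * max_flux"
proof -
  have "(LINT b|lborel. indicat_real {0..a} b * E_flux b) \<le> (LINT b|lborel. max_flux * indicat_real {0..a} b)"
    using E_flux_le by (intro integral_mono E_flux_integrable integrable_indicator_Icc) (auto simp: indicator_def)
  also have "\<dots> = a * max_flux" using assms by simp
  finally show ?thesis using overlap_deficit[OF assms] by simp
qed

lemma symmetric_difference_rot: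
  "(LINT p|GG. \<bar>indicat_real E (fst p) - indicat_real E (fst (rot (cos a) (sin a) p))\<bar>)
    = 2 * (prob E - overlap a)"
proof -
  let ?r = "\<lambda>p. indicat_real E (fst (rot (cos a) (sin a) p))"
  have i: "integrable GG (\<lambda>p. indicat_real E (fst p))" "integrable GG ?r"
    "integrable GG (\<lambda>p. indicat_real E (fst p) * ?r p)"
    by (intro gauss2_integrable[of _ 1]; auto simp: indicator_def)+
  have "(LINT p|GG. \<bar>indicat_real E (fst p) - ?r p\<bar>)
      = (LINT p|GG. indicat_real E (fst p) + ?r p - 2 * (indicat_real E (fst p) * ?r p))"
    by (intro Bochner_Integration.integral_cong) (auto simp: indicator_def)
  also have "\<dots> = 2 * (prob E - overlap a)"
    using i by (simp add: E_measure_fst E_measure_rot overlap_def)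
  finally show ?thesis .
qed

text \<open>Invariance of \<open>GG\<close> rewrites the integral of u over E \<times> X as that of
  u \<circ> rot over the rotated copy. The rotation identity then compares the set with its copy
  under one common weight u \<circ> rot of absolute value at most 1. In this way each test function
  yields a lower bound for the loss of overlap.\<close>

lemma flux_le_overlap:
  assumes u [measurable]: "u \<in> borel_measurable borel" and K: "\<And>p. \<bar>u p\<bar> \<le> 1" and a: "0 \<le> a"
  shows "(LINT b|lborel. indicat_real {0..a} b * flux u b) \<le> 2 * (prob E - overlap a)"
proof -
  let ?R = "rot (cos a) (sin a)"
  have b: "\<bar>indicat_real E x * u p\<bar> \<le> 1" for x p using K[of p] by (auto simp: indicator_def)
  have i: "integrable GG (\<lambda>p. indicat_real E (fst p) * u (?R p))"
    "integrable GG (\<lambda>p. indicat_real E (fst p) * u p)"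
    "integrable GG (\<lambda>p. indicat_real E (fst (?R p)) * u (?R p))"
    using b by (intro gauss2_integrable[of _ 1]; simp)+
  have "(LINT p|GG. indicat_real E (fst p) * u p) = (LINT p|GG. indicat_real E (fst (?R p)) * u (?R p))"
    using integral_rot[of "cos a" "sin a" "\<lambda>p. indicat_real E (fst p) * u p"] by simp
  then have "- (LINT b|lborel. indicat_real {0..a} b * flux u b)
      = (LINT p|GG. indicat_real E (fst p) * u (?R p)) - (LINT p|GG. indicat_real E (fst (?R p)) * u (?R p))"
    using rotation_identity[OF u K a] i by (simp add: right_diff_distrib)
  also have "\<dots> = (LINT p|GG. (indicat_real E (fst p) - indicat_real E (fst (?R p))) * u (?R p))"
    using i by (simp add: left_diff_distrib)
  finally have "(LINT b|lborel. indicat_real {0..a} b * flux u b)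
      = (LINT p|GG. - ((indicat_real E (fst p) - indicat_real E (fst (?R p))) * u (?R p)))" by simp
  also have "\<dots> \<le> (LINT p|GG. \<bar>indicat_real E (fst p) - indicat_real E (fst (?R p))\<bar>)"
  proof (rule integral_mono)
    have "\<bar>- ((indicat_real E (fst p) - indicat_real E (fst (?R p))) * u (?R p))\<bar> \<le> 1" for p
      using K[of "?R p"] by (auto simp: indicator_def)
    then show "integrable GG (\<lambda>p. - ((indicat_real E (fst p) - indicat_real E (fst (?R p))) * u (?R p)))"
      by (intro gauss2_integrable[of _ 1]) simp
    show "integrable GG (\<lambda>p. \<bar>indicat_real E (fst p) - indicat_real E (fst (?R p))\<bar>)"
      by (intro gauss2_integrable[of _ 1]) (auto simp: indicator_def)
    show "- ((indicat_real E (fst p) - indicat_real E (fst (?R p))) * u (?R p)) \<le> \<bar>indicat_real E (fst p) - indicat_real E (fst (?R p))\<bar>" for p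
      using K[of "?R p"] by (auto simp: indicator_def abs_le_iff)
  qed
  finally show ?thesis by (simp add: symmetric_difference_rot)
qed

text \<open>Density of the bounded continuous functions in L1 of |W| M \<otimes> \<gamma>. The
  monotone class argument applies because the cosines are continuous themselves; the bound C may
  grow as r shrinks.\<close>

lemma continuous_approximation:
  fixes v :: "'a \<times> 'a \<Rightarrow> real"
  assumes v: "v \<in> borel_measurable borel" "\<And>p. \<bar>v p\<bar> \<le> K"
  shows "\<forall>r>0. \<exists>\<psi> C. continuous_on UNIV \<psi> \<and> (\<forall>p. \<bar>\<psi> p\<bar> \<le> C) \<and> (LINT p|MG. \<bar>v p - \<psi> p\<bar> * \<bar>W p\<bar>) \<le> r"
  using v
proof (induction v rule: trig_monotone_class)
  case (cos f \<theta>)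
  have "continuous_on UNIV (\<lambda>x. cos (f x + \<theta>))" by (intro continuous_intros)
  moreover have "\<forall>p. \<bar>cos (f p + \<theta>)\<bar> \<le> 1" by simp
  ultimately show ?case by (intro allI impI exI[of _ "\<lambda>x. cos (f x + \<theta>)"] exI[of _ 1]) simp
next
  case (add u v A B)
  show ?case
  proof (intro allI impI)
    fix r :: real assume "r > 0"
    then have r2: "r / 2 > 0" by simp
    obtain \<psi> C where p: "continuous_on UNIV \<psi>" "\<And>p. \<bar>\<psi> p\<bar> \<le> C" "(LINT p|MG. \<bar>u p - \<psi> p\<bar> * \<bar>W p\<bar>) \<le> r / 2"
      using add(5) r2 by blast
    obtain \<phi> D where q: "continuous_on UNIV \<phi>" "\<And>p. \<bar>\<phi> p\<bar> \<le> D" "(LINT p|MG. \<bar>v p - \<phi> p\<bar> * \<bar>W p\<bar>) \<le> r / 2"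
      using add(6) r2 by blast
    have [measurable]: "\<psi> \<in> borel_measurable borel" "\<phi> \<in> borel_measurable borel"
      using p q by (auto intro: borel_measurable_continuous_onI)
    note [measurable] = add(1,2)
    have i: "integrable MG (\<lambda>p. \<bar>w p - \<eta> p\<bar> * \<bar>W p\<bar>)"
      if [measurable]: "w \<in> borel_measurable borel" "\<eta> \<in> borel_measurable borel"
        and b: "\<And>p. \<bar>w p\<bar> \<le> c" "\<And>p. \<bar>\<eta> p\<bar> \<le> d" for w \<eta> c d
    proof -
      have "\<bar>w p - \<eta> p\<bar> \<le> c + d" for p using b[of p] by linarith
      from integrable_abs[OF W_mult_integrable[OF _ this]] show ?thesis by (simp add: abs_mult)
    qed
    have "(LINT p|MG. \<bar>u p + v p - (\<psi> p + \<phi> p)\<bar> * \<bar>W p\<bar>) \<le> (LINT p|MG. \<bar>u p - \<psi> p\<bar> * \<bar>W p\<bar> + \<bar>v p - \<phi> p\<bar> * \<bar>W p\<bar>)"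
    proof (rule integral_mono)
      have "\<bar>u p + v p\<bar> \<le> A + B" for p using add(3)[of p] add(4)[of p] by linarith
      moreover have "\<bar>\<psi> p + \<phi> p\<bar> \<le> C + D" for p using p(2)[of p] q(2)[of p] by linarith
      ultimately show "integrable MG (\<lambda>p. \<bar>u p + v p - (\<psi> p + \<phi> p)\<bar> * \<bar>W p\<bar>)" by (intro i) simp_all
      show "integrable MG (\<lambda>p. \<bar>u p - \<psi> p\<bar> * \<bar>W p\<bar> + \<bar>v p - \<phi> p\<bar> * \<bar>W p\<bar>)"
        using i[OF add(1) _ add(3) p(2)] i[OF add(2) _ add(4) q(2)] by simp
      show "\<bar>u p + v p - (\<psi> p + \<phi> p)\<bar> * \<bar>W p\<bar> \<le> \<bar>u p - \<psi> p\<bar> * \<bar>W p\<bar> + \<bar>v p - \<phi> p\<bar> * \<bar>W p\<bar>" for p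
        unfolding distrib_right[symmetric] by (rule mult_right_mono) auto
    qed
    also have "\<dots> \<le> r" using p(3) q(3) i[OF add(1) _ add(3) p(2)] i[OF add(2) _ add(4) q(2)] by simp
    finally have "(LINT p|MG. \<bar>u p + v p - (\<psi> p + \<phi> p)\<bar> * \<bar>W p\<bar>) \<le> r" .
    moreover have "\<bar>\<psi> p + \<phi> p\<bar> \<le> C + D" for p using p(2)[of p] q(2)[of p] by linarith
    moreover have "continuous_on UNIV (\<lambda>p. \<psi> p + \<phi> p)" using p q by (intro continuous_intros)
    ultimately show "\<exists>\<psi> C. continuous_on UNIV \<psi> \<and> (\<forall>p. \<bar>\<psi> p\<bar> \<le> C) \<and> (LINT p|MG. \<bar>u p + v p - \<psi> p\<bar> * \<bar>W p\<bar>) \<le> r"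
      by (intro exI[of _ "\<lambda>p. \<psi> p + \<phi> p"] exI[of _ "C + D"]) simp
  qed
next
  case (scale c u A)
  show ?case
  proof (intro allI impI)
    fix r :: real assume "r > 0"
    then have "r / (\<bar>c\<bar> + 1) > 0" by simp
    then obtain \<psi> C where p: "continuous_on UNIV \<psi>" "\<And>p. \<bar>\<psi> p\<bar> \<le> C" "(LINT p|MG. \<bar>u p - \<psi> p\<bar> * \<bar>W p\<bar>) \<le> r / (\<bar>c\<bar> + 1)"
      using scale(3) by blast
    have "(LINT p|MG. \<bar>c * u p - c * \<psi> p\<bar> * \<bar>W p\<bar>) = (LINT p|MG. \<bar>c\<bar> * (\<bar>u p - \<psi> p\<bar> * \<bar>W p\<bar>))"
      by (simp add: right_diff_distrib[symmetric] abs_mult mult.assoc)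
    also have "\<dots> = \<bar>c\<bar> * (LINT p|MG. \<bar>u p - \<psi> p\<bar> * \<bar>W p\<bar>)" by simp
    also have "\<dots> \<le> \<bar>c\<bar> * (r / (\<bar>c\<bar> + 1))" using p(3) by (rule mult_left_mono) simp
    also have "\<dots> \<le> r" using \<open>r > 0\<close> by (simp add: field_simps)
    finally have "(LINT p|MG. \<bar>c * u p - c * \<psi> p\<bar> * \<bar>W p\<bar>) \<le> r" .
    moreover have "\<bar>c * \<psi> p\<bar> \<le> \<bar>c\<bar> * C" for p using p(2)[of p] by (simp add: abs_mult mult_left_mono)
    moreover have "continuous_on UNIV (\<lambda>p. c * \<psi> p)" using p by (intro continuous_intros)
    ultimately show "\<exists>\<psi> C. continuous_on UNIV \<psi> \<and> (\<forall>p. \<bar>\<psi> p\<bar> \<le> C) \<and> (LINT p|MG. \<bar>c * u p - \<psi> p\<bar> * \<bar>W p\<bar>) \<le> r"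
      by blast
  qed
next
  case (lim U v A)
  note [measurable] = lim(1,2)
  have vA: "\<bar>v p\<bar> \<le> A" for p
    using lim(3) by (intro LIMSEQ_le_const2[OF tendsto_rabs[OF lim(4)[of p]]]) auto
  have conv: "(\<lambda>n. LINT p|MG. \<bar>v p - U n p\<bar> * \<bar>W p\<bar>) \<longlonglongrightarrow> (LINT p|MG. 0)"
  proof (rule integral_dominated_convergence[where w = "\<lambda>p. (A + A) * \<bar>W p\<bar>"])
    show "AE p in MG. (\<lambda>n. \<bar>v p - U n p\<bar> * \<bar>W p\<bar>) \<longlonglongrightarrow> 0"
    proof (rule AE_I2)
      fix p
      show "(\<lambda>n. \<bar>v p - U n p\<bar> * \<bar>W p\<bar>) \<longlonglongrightarrow> 0"
        using tendsto_mult_right[OF tendsto_rabs[OF tendsto_diff[OF tendsto_const[of "v p"] lim(4)[of p]]], of "\<bar>W p\<bar>"] by simp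
    qed
    show "AE p in MG. norm (\<bar>v p - U n p\<bar> * \<bar>W p\<bar>) \<le> (A + A) * \<bar>W p\<bar>" for n
    proof (rule AE_I2)
      fix p
      have "\<bar>v p - U n p\<bar> \<le> A + A" using vA[of p] lim(3)[of n p] by linarith
      then show "norm (\<bar>v p - U n p\<bar> * \<bar>W p\<bar>) \<le> (A + A) * \<bar>W p\<bar>" by (simp add: abs_mult mult_right_mono)
    qed
  qed (use W_integrable in simp_all)
  show ?case
  proof (intro allI impI)
    fix r :: real assume r: "r > 0"
    have "\<forall>\<^sub>F n in sequentially. (LINT p|MG. \<bar>v p - U n p\<bar> * \<bar>W p\<bar>) < r / 2"
      using conv r by (intro order_tendstoD(2)[OF conv]) simp
    then obtain n where n: "(LINT p|MG. \<bar>v p - U n p\<bar> * \<bar>W p\<bar>) < r / 2" by (auto simp: eventually_sequentially)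
    obtain \<psi> C where p: "continuous_on UNIV \<psi>" "\<And>p. \<bar>\<psi> p\<bar> \<le> C" "(LINT p|MG. \<bar>U n p - \<psi> p\<bar> * \<bar>W p\<bar>) \<le> r / 2"
      using lim(5)[of n] r by (meson half_gt_zero)
    have [measurable]: "\<psi> \<in> borel_measurable borel" using p by (auto intro: borel_measurable_continuous_onI)
    have i: "integrable MG (\<lambda>p. \<bar>w p - \<eta> p\<bar> * \<bar>W p\<bar>)"
      if [measurable]: "w \<in> borel_measurable borel" "\<eta> \<in> borel_measurable borel"
        and b: "\<And>p. \<bar>w p\<bar> \<le> c" "\<And>p. \<bar>\<eta> p\<bar> \<le> d" for w \<eta> c d
    proof -
      have "\<bar>w p - \<eta> p\<bar> \<le> c + d" for p using b[of p] by linarith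
      from integrable_abs[OF W_mult_integrable[OF _ this]] show ?thesis by (simp add: abs_mult)
    qed
    have "(LINT p|MG. \<bar>v p - \<psi> p\<bar> * \<bar>W p\<bar>) \<le> (LINT p|MG. \<bar>v p - U n p\<bar> * \<bar>W p\<bar> + \<bar>U n p - \<psi> p\<bar> * \<bar>W p\<bar>)"
    proof (rule integral_mono)
      show "integrable MG (\<lambda>p. \<bar>v p - \<psi> p\<bar> * \<bar>W p\<bar>)" using i[OF lim(2) _ vA p(2)] by simp
      show "integrable MG (\<lambda>p. \<bar>v p - U n p\<bar> * \<bar>W p\<bar> + \<bar>U n p - \<psi> p\<bar> * \<bar>W p\<bar>)"
        using i[OF lim(2,1) vA lim(3)] i[OF lim(1) _ lim(3) p(2)] by simp
      show "\<bar>v p - \<psi> p\<bar> * \<bar>W p\<bar> \<le> \<bar>v p - U n p\<bar> * \<bar>W p\<bar> + \<bar>U n p - \<psi> p\<bar> * \<bar>W p\<bar>" for p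
        unfolding distrib_right[symmetric] by (rule mult_right_mono) auto
    qed
    also have "\<dots> \<le> r" using n p(3) i[OF lim(2,1) vA lim(3)] i[OF lim(1) _ lim(3) p(2)] by simp
    finally show "\<exists>\<psi> C. continuous_on UNIV \<psi> \<and> (\<forall>p. \<bar>\<psi> p\<bar> \<le> C) \<and> (LINT p|MG. \<bar>v p - \<psi> p\<bar> * \<bar>W p\<bar>) \<le> r"
      using p by blast
  qed
qed

lemma continuous_sign_approximation:
  assumes r: "r > 0"
  obtains \<psi> where "continuous_on UNIV \<psi>" "\<And>p. \<bar>\<psi> p\<bar> \<le> 1" "(LINT p|MG. \<psi> p * W p) \<ge> 2 * max_flux - r"
proof -
  define v where "v p = indicat_real {p. W p > 0} p - indicat_real {p. W p < 0} p" for p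
  have [measurable]: "v \<in> borel_measurable borel" unfolding v_def by measurable
  have v1: "\<bar>v p\<bar> \<le> 1" and vW: "v p * W p = \<bar>W p\<bar>" for p by (auto simp: v_def indicator_def)
  obtain \<psi> C where p: "continuous_on UNIV \<psi>" "\<And>p. \<bar>\<psi> p\<bar> \<le> C" "(LINT p|MG. \<bar>v p - \<psi> p\<bar> * \<bar>W p\<bar>) \<le> r"
    using continuous_approximation[of v 1] v1 r by (metis \<open>v \<in> borel_measurable borel\<close>)
  \<comment> \<open>Truncation to [-1, 1] only brings \<psi> closer to v, whose values lie in this
    interval.\<close>
  define \<phi> where "\<phi> p = max (- 1) (min 1 (\<psi> p))" for p
  have [measurable]: "\<psi> \<in> borel_measurable borel" using p by (auto intro: borel_measurable_continuous_onI)
  have [measurable]: "\<phi> \<in> borel_measurable borel" unfolding \<phi>_def by measurable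
  have \<phi>1: "\<bar>\<phi> p\<bar> \<le> 1" for p by (auto simp: \<phi>_def)
  have closer: "\<bar>v p - \<phi> p\<bar> \<le> \<bar>v p - \<psi> p\<bar>" for p using v1[of p] by (auto simp: \<phi>_def)
  have "\<bar>v p - \<psi> p\<bar> \<le> 1 + C" for p using v1[of p] p(2)[of p] by linarith
  from integrable_abs[OF W_mult_integrable[OF _ this]]
  have i: "integrable MG (\<lambda>p. \<bar>v p - \<psi> p\<bar> * \<bar>W p\<bar>)" by (simp add: abs_mult)
  have "2 * max_flux - (LINT p|MG. \<phi> p * W p) = (LINT p|MG. \<bar>W p\<bar> - \<phi> p * W p)"
    using W_mult_integrable[OF _ \<phi>1] W_integrable abs_W_integral by simp
  also have "\<dots> \<le> (LINT p|MG. \<bar>v p - \<psi> p\<bar> * \<bar>W p\<bar>)"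
  proof (rule integral_mono)
    show "integrable MG (\<lambda>p. \<bar>W p\<bar> - \<phi> p * W p)" using W_mult_integrable[OF _ \<phi>1] W_integrable by simp
    show "\<bar>W p\<bar> - \<phi> p * W p \<le> \<bar>v p - \<psi> p\<bar> * \<bar>W p\<bar>" for p
    proof -
      have "\<bar>W p\<bar> - \<phi> p * W p = (v p - \<phi> p) * W p" by (simp add: left_diff_distrib vW)
      also have "\<dots> \<le> \<bar>v p - \<phi> p\<bar> * \<bar>W p\<bar>" unfolding abs_mult[symmetric] by simp
      also have "\<dots> \<le> \<bar>v p - \<psi> p\<bar> * \<bar>W p\<bar>" using closer by (rule mult_right_mono) simp
      finally show ?thesis .
    qed
  qed (rule i)
  also have "\<dots> \<le> r" by (rule p(3))
  finally have "(LINT p|MG. \<phi> p * W p) \<ge> 2 * max_flux - r" by simp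
  moreover have "continuous_on UNIV \<phi>" unfolding \<phi>_def using p by (intro continuous_intros)
  ultimately show ?thesis using that \<phi>1 by blast
qed

text \<open>Continuity of \<psi> makes its flux continuous at angle 0 by dominated convergence. Near
  0 the flux stays above 2 (max_flux - r), and \<open>flux_le_overlap\<close> bounds its integral by
  twice the loss of overlap.\<close>

lemma overlap_lower:
  assumes r: "r > 0"
  shows "\<forall>\<^sub>F a in at_right 0. prob E - overlap a \<ge> a * (max_flux - r)"
proof -
  obtain \<psi> where c: "continuous_on UNIV \<psi>" and b: "\<And>p. \<bar>\<psi> p\<bar> \<le> 1" and i: "(LINT p|MG. \<psi> p * W p) \<ge> 2 * max_flux - r"
    using continuous_sign_approximation[OF r] by blast
  have [measurable]: "\<psi> \<in> borel_measurable borel" using c by (rule borel_measurable_continuous_onI)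
  have "continuous (at 0) (flux \<psi>)"
    unfolding continuous_at_sequentially comp_def
  proof (intro allI impI)
    fix X :: "nat \<Rightarrow> real" assume X: "X \<longlonglongrightarrow> 0"
    show "(\<lambda>n. flux \<psi> (X n)) \<longlonglongrightarrow> flux \<psi> 0"
      unfolding flux_def
    proof (rule integral_dominated_convergence[where w = "\<lambda>p. \<bar>W p\<bar>"])
      show "AE p in MG. (\<lambda>n. \<psi> (rot (cos (X n)) (sin (X n)) p) * W p) \<longlonglongrightarrow> \<psi> (rot (cos 0) (sin 0) p) * W p"
      proof (intro AE_I2 tendsto_mult tendsto_const)
        fix p
        have "(\<lambda>n. rot (cos (X n)) (sin (X n)) p) \<longlonglongrightarrow> rot (cos 0) (sin 0) p"
          unfolding rot_def by (intro tendsto_intros X)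
        moreover have "isCont \<psi> (rot (cos 0) (sin 0) p)"
          using c unfolding continuous_on_eq_continuous_at[OF open_UNIV] by blast
        ultimately show "(\<lambda>n. \<psi> (rot (cos (X n)) (sin (X n)) p)) \<longlonglongrightarrow> \<psi> (rot (cos 0) (sin 0) p)"
          by (rule isCont_tendsto_compose[rotated])
      qed
      show "AE p in MG. norm (\<psi> (rot (cos (X n)) (sin (X n)) p) * W p) \<le> \<bar>W p\<bar>" for n
        using b by (intro AE_I2) (simp add: abs_mult mult_left_le_one_le)
    qed (use W_integrable in simp_all)
  qed
  then have "flux \<psi> \<midarrow>0\<rightarrow> flux \<psi> 0" by (simp add: isCont_def)
  moreover have "flux \<psi> 0 \<ge> 2 * max_flux - r" using i by (simp add: flux_def rot_def)
  ultimately have "\<forall>\<^sub>F b in at 0. flux \<psi> b > 2 * max_flux - 2 * r"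
    using r by (intro order_tendstoD(1)) auto
  then obtain \<delta> where \<delta>: "\<delta> > 0" "\<And>b. b \<noteq> 0 \<Longrightarrow> \<bar>b\<bar> < \<delta> \<Longrightarrow> flux \<psi> b > 2 * max_flux - 2 * r"
    by (auto simp: eventually_at dist_real_def)
  have "prob E - overlap a \<ge> a * (max_flux - r)" if a: "0 < a" "a < \<delta>" for a
  proof -
    have "2 * (a * (max_flux - r)) = (LINT b|lborel. (2 * max_flux - 2 * r) * indicat_real {0..a} b)"
      using a by (simp add: algebra_simps)
    also have "\<dots> \<le> (LINT b|lborel. indicat_real {0..a} b * flux \<psi> b)"
    proof (rule integral_mono_AE)
      show "integrable lborel (\<lambda>b. indicat_real {0..a} b * flux \<psi> b)" using b by (intro flux_integrable) auto
      \<comment> \<open>The limit at 0 gives no information at b = 0 itself, which is a null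
        set.\<close>
      have "AE b in lborel. b \<noteq> (0 :: real)" by (rule AE_lborel_singleton)
      then show "AE b in lborel. (2 * max_flux - 2 * r) * indicat_real {0..a} b \<le> indicat_real {0..a} b * flux \<psi> b"
      proof eventually_elim
        case (elim b)
        then show ?case using \<delta>(2)[of b] a by (auto simp: indicator_def)
      qed
    qed (rule integrable_indicator_Icc)
    also have "\<dots> \<le> 2 * (prob E - overlap a)" using a b by (intro flux_le_overlap) auto
    finally show ?thesis by simp
  qed
  then show ?thesis using \<delta>(1) by (auto simp: eventually_at_right_field)
qed

end

section \<open>Cameron-Martin shifts\<close>

lemma integrable_mult_bounded:
  fixes w k :: "'b \<Rightarrow> real"
  assumes w: "integrable M w" and k: "k \<in> borel_measurable M" "\<And>x. \<bar>k x\<bar> \<le> C"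
  shows "integrable M (\<lambda>x. w x * k x)"
proof (rule Bochner_Integration.integrable_bound)
  show "integrable M (\<lambda>x. C * w x)" using w by simp
  show "AE x in M. norm (w x * k x) \<le> norm (C * w x)"
  proof (rule AE_I2)
    fix x
    have "\<bar>k x\<bar> * \<bar>w x\<bar> \<le> \<bar>C\<bar> * \<bar>w x\<bar>" using k(2)[of x] by (intro mult_right_mono) auto
    then show "norm (w x * k x) \<le> norm (C * w x)" by (simp add: abs_mult mult.commute)
  qed
qed (use w k in \<open>auto intro: borel_measurable_times\<close>)

text \<open>The uniqueness theorem for signed measures given as images: Z1 and Z2 push w1 M1 and w2
  M2 forward, and the sum of the images is zero once all cosines say so. The two base spaces are
  independent of each other because the applications compare integrals over products of different
  measures.\<close>

lemma trig_functional_zero: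
  fixes Z1 :: "'b \<Rightarrow> 'a::{real_normed_vector, second_countable_topology}" and Z2 :: "'c \<Rightarrow> 'a"
    and w1 :: "'b \<Rightarrow> real" and w2 :: "'c \<Rightarrow> real"
  assumes w: "integrable M1 w1" "integrable M2 w2"
    and Z: "Z1 \<in> measurable M1 borel" "Z2 \<in> measurable M2 borel"
    and zero: "\<And>f (\<theta> :: real). (LINT x|M1. w1 x * cos (blinfun_apply f (Z1 x) + \<theta>)) + (LINT x|M2. w2 x * cos (blinfun_apply f (Z2 x) + \<theta>)) = 0"
    and u: "u \<in> borel_measurable borel" "\<And>x. \<bar>u x\<bar> \<le> K"
  shows "(LINT x|M1. w1 x * u (Z1 x)) + (LINT x|M2. w2 x * u (Z2 x)) = 0"
  using u
proof (induction u rule: trig_monotone_class)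
  case (cos f \<theta>)
  then show ?case by (rule zero)
next
  case (add u v A B)
  have int: "integrable M1 (\<lambda>x. w1 x * k (Z1 x))" "integrable M2 (\<lambda>x. w2 x * k (Z2 x))"
    if k: "k \<in> borel_measurable borel" "\<And>x. \<bar>k x\<bar> \<le> C" for k C
    by (rule integrable_mult_bounded[OF w(1) measurable_compose[OF Z(1) k(1)] k(2)]
        integrable_mult_bounded[OF w(2) measurable_compose[OF Z(2) k(1)] k(2)])+
  show ?case using int[OF add(1,3)] int[OF add(2,4)] add(5,6) by (simp add: distrib_left)
next
  case (scale c u A)
  then show ?case by (simp add: mult.left_commute[of _ c] distrib_left[symmetric])
next
  case (lim U v A)
  have A: "\<bar>U n x\<bar> \<le> \<bar>A\<bar>" for n x using lim(3)[of n x] by simp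
  have "(\<lambda>n. LINT x|M1. w1 x * U n (Z1 x)) \<longlonglongrightarrow> (LINT x|M1. w1 x * v (Z1 x))"
  proof (rule integral_dominated_convergence[where w = "\<lambda>x. \<bar>w1 x\<bar> * \<bar>A\<bar>"])
    show "AE x in M1. norm (w1 x * U n (Z1 x)) \<le> \<bar>w1 x\<bar> * \<bar>A\<bar>" for n
      using A by (intro AE_I2) (simp add: abs_mult mult_left_mono)
  qed (use w Z lim(1,2,4) in \<open>auto intro!: tendsto_intros borel_measurable_times intro: measurable_compose\<close>)
  moreover have "(\<lambda>n. LINT x|M2. w2 x * U n (Z2 x)) \<longlonglongrightarrow> (LINT x|M2. w2 x * v (Z2 x))"
  proof (rule integral_dominated_convergence[where w = "\<lambda>x. \<bar>w2 x\<bar> * \<bar>A\<bar>"])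
    show "AE x in M2. norm (w2 x * U n (Z2 x)) \<le> \<bar>w2 x\<bar> * \<bar>A\<bar>" for n
      using A by (intro AE_I2) (simp add: abs_mult mult_left_mono)
  qed (use w Z lim(1,2,4) in \<open>auto intro!: tendsto_intros borel_measurable_times intro: measurable_compose\<close>)
  ultimately have "(\<lambda>n. (LINT x|M1. w1 x * U n (Z1 x)) + (LINT x|M2. w2 x * U n (Z2 x)))
      \<longlonglongrightarrow> (LINT x|M1. w1 x * v (Z1 x)) + (LINT x|M2. w2 x * v (Z2 x))" by (rule tendsto_add)
  then show ?case unfolding lim(5) by (simp add: LIMSEQ_const_iff)
qed

context centered_gaussian
begin

text \<open>The covariance operator of \<gamma>: it maps the dual into \<open>CM\<close>, and f
  itself represents the vector \<open>cm_shift f\<close>.\<close>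

definition cm_shift :: "('a \<Rightarrow>\<^sub>L real) \<Rightarrow> 'a" where
  "cm_shift f = (LINT x|\<gamma>. f x *\<^sub>R x)"

lemma blinfun_cm_shift: "blinfun_apply g (cm_shift f) = cov f g"
  unfolding cm_shift_def cov_def by (rule blinfun_barycentre) simp

lemma cov_Cauchy_Schwarz: "(cov f g)\<^sup>2 \<le> cov f f * cov g g"
  using L2_Cauchy_Schwarz[of "blinfun_apply f" "blinfun_apply g"] by (simp add: cov_def power2_eq_square)

text \<open>Along the direction of \<open>cm_shift f\<close> the measure \<open>\<gamma>\<close> is a product with a one-dimensional
  normal distribution, which is quasi-invariant under translations.\<close>

lemma cm_shift_null:
  assumes N [measurable]: "N \<in> sets borel" and null: "prob N = 0"
  shows "prob {x. x + t *\<^sub>R cm_shift f \<in> N} = 0"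
proof (cases "cov f f = 0")
  case True
  have "cm_shift f = 0"
  proof (rule blinfun_separates)
    fix g :: "'a \<Rightarrow>\<^sub>L real"
    show "g (cm_shift f) = g 0"
      using cov_Cauchy_Schwarz[of f g] True by (simp add: blinfun_cm_shift blinfun.zero_right)
  qed
  then show ?thesis using null by simp
next
  case False
  then have s: "cov f f > 0" using cov_nonneg[of f] by simp
  \<comment> \<open>Normalised so that f h = 1; the vector x - f(x) h is then independent of
    f(x).\<close>
  define h where "h = (1 / cov f f) *\<^sub>R cm_shift f"
  have gh: "blinfun_apply g h = cov f g / cov f f" for g by (simp add: h_def blinfun.scaleR_right blinfun_cm_shift)
  \<comment> \<open>By this independence the law is unchanged when the coordinate f(x) is replaced
    by that of an independent copy.\<close>
  define T where "T p = fst p - f (fst p) *\<^sub>R h + f (snd p) *\<^sub>R h" for p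
  have T_cont: "continuous_on UNIV T" unfolding T_def by (intro continuous_intros)
  have T_meas [measurable]: "T \<in> measurable borel borel"
    using T_cont by (rule borel_measurable_continuous_onI)
  then have T_meas': "T \<in> measurable GG borel" by simp
  have law: "distr GG borel T = \<gamma>"
  proof (rule measure_eqI_cos)
    show "finite_measure (distr GG borel T)" using T_meas' by (rule pp.P.finite_measure_distr)
    show "finite_measure \<gamma>" by (rule finite_measure_axioms)
    fix g :: "'a \<Rightarrow>\<^sub>L real" and \<theta> :: real
    define k where "k = cov f g / cov f f"
    have "(LINT x|distr GG borel T. cos (g x + \<theta>)) = (LINT p|GG. cos (g (T p) + \<theta>))"
      by (rule integral_distr[OF T_meas']) simp
    also have "\<dots> = (LINT p|GG. cos ((g - k *\<^sub>R f) (fst p) + (k *\<^sub>R f) (snd p) + \<theta>))"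
      by (simp add: T_def blinfun.add_right blinfun.diff_right blinfun.scaleR_right gh k_def
          blinfun.diff_left blinfun.scaleR_left mult.commute)
    also have "\<dots> = cos \<theta> * exp (- cov g g / 2)"
      unfolding cos_integral_pair using s
      by (simp add: cov_simps cov_commute[of g f] k_def field_simps)
    also have "\<dots> = (LINT x|\<gamma>. cos (g x + \<theta>))" by (simp only: cos_integral)
    finally show "(LINT x|distr GG borel T. cos (g x + \<theta>)) = (LINT x|\<gamma>. cos (g x + \<theta>))" .
  qed simp_all
  define c where "c = t * cov f f"
  have shift: "t *\<^sub>R cm_shift f = c *\<^sub>R h" using s by (simp add: h_def c_def)
  define S where "S x = {r. x - f x *\<^sub>R h + r *\<^sub>R h \<in> N}" for x
  have S_meas [measurable]: "S x \<in> sets borel" for x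
  proof -
    have "(\<lambda>r. x - f x *\<^sub>R h + r *\<^sub>R h) \<in> measurable borel borel"
      by (intro borel_measurable_continuous_onI continuous_intros)
    from measurable_sets[OF this N] show ?thesis by (simp add: S_def vimage_def)
  qed
  have "\<not> (AE x in \<gamma>. f x = 0)"
  proof
    assume "AE x in \<gamma>. f x = 0"
    then have "cov f f = (LINT x|\<gamma>. 0)" unfolding cov_def by (intro integral_cong_AE) auto
    then show False using s by simp
  qed
  then obtain \<sigma> where \<sigma>: "\<sigma> > 0" and D: "distributed \<gamma> lborel (blinfun_apply f) (normal_density 0 \<sigma>)"
    using blinfun_law by blast
  have dens: "distr \<gamma> lborel (blinfun_apply f) = density lborel (normal_density 0 \<sigma>)"
    using distributed_distr_eq_density[OF D] by simp
  have null_iff: "(AE w in \<gamma>. f w \<notin> B) \<longleftrightarrow> emeasure lborel B = 0" if B: "B \<in> sets borel" for B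
  proof -
    have "(AE w in \<gamma>. f w \<notin> B) \<longleftrightarrow> (AE r in distr \<gamma> lborel (blinfun_apply f). r \<notin> B)"
      using B by (subst AE_distr_iff) auto
    also have "\<dots> \<longleftrightarrow> (AE r in lborel. r \<notin> B)"
      unfolding dens using normal_density_pos[OF \<sigma>] by (subst AE_density) auto
    also have "\<dots> \<longleftrightarrow> emeasure lborel B = 0"
      using B by (subst AE_iff_measurable[of B]) auto
    finally show ?thesis .
  qed
  have "AE x in distr GG borel T. x \<notin> N"
    unfolding law using null by (subst AE_iff_measurable[of N]) (auto simp: emeasure_eq_measure)
  then have "AE p in GG. T p \<notin> N"
    by (subst (asm) AE_distr_iff[OF T_meas']) auto
  then have "AE x in \<gamma>. AE w in \<gamma>. f w \<notin> S x"
    using pp.AE_pair[of "\<lambda>p. T p \<notin> N"] by (simp add: T_def S_def)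
  \<comment> \<open>For almost all x the section S x is null for the normal law of f, hence for
    Lebesgue measure because the normal density is positive, and Lebesgue null sets survive the
    translation by c.\<close>
  then have "AE x in \<gamma>. AE w in \<gamma>. f w \<notin> {r. r + c \<in> S x}"
  proof eventually_elim
    case (elim x)
    then have "emeasure lborel (S x) = 0" using null_iff[OF S_meas] by simp
    moreover have "emeasure lborel {r. r + c \<in> S x} = emeasure lborel (S x)"
    proof -
      have "emeasure lborel (S x) = emeasure (distr lborel borel ((+) c)) (S x)"
        by (simp add: lborel_distr_plus)
      also have "\<dots> = emeasure lborel {r. r + c \<in> S x}"
        by (subst emeasure_distr) (auto simp: vimage_def add.commute)
      finally show ?thesis by simp
    qed
    moreover have "{r. r + c \<in> S x} \<in> sets borel" by measurable
    ultimately show ?case using null_iff[of "{r. r + c \<in> S x}"] by simp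
  qed
  then have "AE x in \<gamma>. AE w in \<gamma>. T (x, w) + c *\<^sub>R h \<notin> N"
    by (simp add: T_def S_def algebra_simps)
  then have "AE p in GG. T p + c *\<^sub>R h \<notin> N"
    by (intro pp.AE_pair_measure) auto
  then have "AE x in distr GG borel T. x + c *\<^sub>R h \<notin> N"
    by (subst AE_distr_iff[OF T_meas']) auto
  then have "AE x in \<gamma>. x + c *\<^sub>R h \<notin> N" by (simp only: law)
  then show ?thesis unfolding shift
    by (subst (asm) AE_iff_measurable[of "{x. x + c *\<^sub>R h \<in> N}"]) (auto simp: emeasure_eq_measure)
qed

end

context gauss_boundary
begin

text \<open>Integration by parts along h = \<open>cm_shift g\<close> for the average of u over the
  random translations g(y) h. The derivative falls on the Gaussian law of g(y) and shows up as the
  factor g(y), which admits a merely bounded Borel function u.\<close>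

lemma shift_identity:
  fixes u :: "'a \<Rightarrow> real" and g :: "'a \<Rightarrow>\<^sub>L real"
  assumes u: "u \<in> borel_measurable borel" "\<And>x. \<bar>u x\<bar> \<le> K"
  shows "(LINT p|GG. indicat_real E (fst p) * (g (snd p) - cov g g * g (fst p)) * u (fst p + g (snd p) *\<^sub>R cm_shift g))
    + (LINT p|MG. cov g g * pairing (fst p) g * u (fst p + g (snd p) *\<^sub>R cm_shift g)) = 0"
proof -
  let ?h = "cm_shift g"
  have Zm: "(\<lambda>p. fst p + g (snd p) *\<^sub>R ?h) \<in> measurable borel borel"
    by (intro borel_measurable_continuous_onI continuous_intros)
  have i1: "integrable GG (\<lambda>p. g (snd p))" and i2: "integrable GG (\<lambda>p. g (fst p))"
    using integrable_mix[of 0 1 "blinfun_apply g"] integrable_mix[of 1 0 "blinfun_apply g"] integrable_blinfun by auto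
  have ig: "integrable GG (\<lambda>p. indicat_real E (fst p) * (g (snd p) - cov g g * g (fst p)))"
  proof (rule Bochner_Integration.integrable_bound)
    show "integrable GG (\<lambda>p. g (snd p) - cov g g * g (fst p))" using i1 i2 by simp
  qed (auto simp: indicator_def)
  have pair_fst: "(\<lambda>p :: 'a \<times> 'a. pairing (fst p) g) \<in> borel_measurable borel"
    by (rule measurable_compose[OF fst_borel_measurable pairing_measurable])
  have im: "integrable MG (\<lambda>p. cov g g * pairing (fst p) g)"
  proof (rule integrable_mult_right, rule fMG.integrable_const_bound[of _ "sqrt (cov g g)"])
    have "AE x in M. AE y in \<gamma>. norm (pairing (fst (x, y)) g) \<le> sqrt (cov g g)"
      using pairing_bound[of g] by eventually_elim simp
    then show "AE p in MG. norm (pairing (fst p) g) \<le> sqrt (cov g g)"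
      using pair_fst by (intro MG.AE_pair_measure) auto
  qed (use pair_fst in simp)
  show ?thesis
  proof (rule trig_functional_zero[OF ig im _ _ _ u])
    show "(\<lambda>p. fst p + g (snd p) *\<^sub>R ?h) \<in> measurable GG borel"
      "(\<lambda>p. fst p + g (snd p) *\<^sub>R ?h) \<in> measurable MG borel" using Zm by simp_all
    fix f :: "'a \<Rightarrow>\<^sub>L real" and \<theta> :: real
    define c e where "c = cov f g" and "e = exp (- cov (c *\<^sub>R g) (c *\<^sub>R g) / 2)"
    have val: "cos (f (x + g y *\<^sub>R ?h) + \<theta>) = cos ((c *\<^sub>R g) y + (f x + \<theta>))" for x y
      by (simp add: blinfun.add_right blinfun.scaleR_right blinfun.scaleR_left blinfun_cm_shift c_def
          cov_commute[of g f] algebra_simps)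
    have cm: "(\<lambda>p. cos (f (fst p + g (snd p) *\<^sub>R ?h) + \<theta>)) \<in> borel_measurable borel"
      by (intro borel_measurable_continuous_onI continuous_intros)
    have i3: "integrable GG (\<lambda>p. indicat_real E (fst p) * (g (snd p) - cov g g * g (fst p)) * cos (f (fst p + g (snd p) *\<^sub>R ?h) + \<theta>))"
      by (rule Bochner_Integration.integrable_bound[OF ig]) (use cm in \<open>auto simp: abs_mult intro!: mult_left_le\<close>)
    have i4: "integrable MG (\<lambda>p. cov g g * pairing (fst p) g * cos (f (fst p + g (snd p) *\<^sub>R ?h) + \<theta>))"
      by (rule Bochner_Integration.integrable_bound[OF im]) (use cm pair_fst in \<open>auto simp: abs_mult intro!: mult_left_le\<close>)
    have a: "integrable \<gamma> (\<lambda>x. indicat_real E x * sin (f x + \<theta>))"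
      by (rule integrable_const_bound[of _ 1]) (auto simp: indicator_def)
    have b: "integrable \<gamma> (\<lambda>x. indicat_real E x * (cos (f x + \<theta>) * g x))"
      by (rule Bochner_Integration.integrable_bound[OF integrable_blinfun[of g]])
        (auto simp: abs_mult indicator_def intro!: mult_left_le_one_le)
    have ib: "(LINT x|M. cos (f x + \<theta>) * pairing x g) = (LINT x|\<gamma>. indicat_real E x * (cos (f x + \<theta>) * g x)) + c * (LINT x|\<gamma>. indicat_real E x * sin (f x + \<theta>))"
    proof -
      have "cos (y + (\<theta> + pi/2)) = - sin (y + \<theta>)" "sin (y + (\<theta> + pi/2)) = cos (y + \<theta>)" for y
        unfolding add.assoc[symmetric] by (simp_all add: sin_add cos_add)
      with ibp[of f g "\<theta> + pi/2"] show ?thesis by (simp add: pairing_def c_def)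
    qed
    have "(LINT p|GG. indicat_real E (fst p) * (g (snd p) - cov g g * g (fst p)) * cos (f (fst p + g (snd p) *\<^sub>R ?h) + \<theta>))
        = (LINT x|\<gamma>. LINT y|\<gamma>. indicat_real E x * (g y - cov g g * g x) * cos ((c *\<^sub>R g) y + (f x + \<theta>)))"
      using pp.integral_fst'[OF i3] by (simp only: val fst_conv snd_conv)
    also have "\<dots> = (LINT x|\<gamma>. - cov g g * e * (c * (indicat_real E x * sin (f x + \<theta>)) + indicat_real E x * (cos (f x + \<theta>) * g x)))"
    proof (intro Bochner_Integration.integral_cong refl)
      fix x
      have "integrable \<gamma> (\<lambda>y. g y * cos ((c *\<^sub>R g) y + (f x + \<theta>)))"
        by (rule Bochner_Integration.integrable_bound[OF integrable_blinfun[of g]]) (auto simp: abs_mult intro!: mult_left_le)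
      moreover have "integrable \<gamma> (\<lambda>y. cos ((c *\<^sub>R g) y + (f x + \<theta>)))"
        by (rule integrable_const_bound[of _ 1]) auto
      ultimately have "(LINT y|\<gamma>. indicat_real E x * (g y - cov g g * g x) * cos ((c *\<^sub>R g) y + (f x + \<theta>)))
          = indicat_real E x * ((LINT y|\<gamma>. g y * cos ((c *\<^sub>R g) y + (f x + \<theta>))) - cov g g * g x * (LINT y|\<gamma>. cos ((c *\<^sub>R g) y + (f x + \<theta>))))"
        by (simp add: left_diff_distrib mult.assoc)
      also have "\<dots> = - cov g g * e * (c * (indicat_real E x * sin (f x + \<theta>)) + indicat_real E x * (cos (f x + \<theta>) * g x))"
        unfolding cov_cos_integral cos_integral e_def cov_simps by (simp add: algebra_simps)
      finally show "(LINT y|\<gamma>. indicat_real E x * (g y - cov g g * g x) * cos ((c *\<^sub>R g) y + (f x + \<theta>)))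
          = - cov g g * e * (c * (indicat_real E x * sin (f x + \<theta>)) + indicat_real E x * (cos (f x + \<theta>) * g x))" .
    qed
    also have "\<dots> = - cov g g * e * (LINT x|M. cos (f x + \<theta>) * pairing x g)"
      unfolding ib using a b by simp
    finally have 1: "(LINT p|GG. indicat_real E (fst p) * (g (snd p) - cov g g * g (fst p)) * cos (f (fst p + g (snd p) *\<^sub>R ?h) + \<theta>))
        = - cov g g * e * (LINT x|M. cos (f x + \<theta>) * pairing x g)" .
    have "(LINT p|MG. cov g g * pairing (fst p) g * cos (f (fst p + g (snd p) *\<^sub>R ?h) + \<theta>))
        = (LINT x|M. LINT y|\<gamma>. cov g g * pairing x g * cos ((c *\<^sub>R g) y + (f x + \<theta>)))"
      using MG.integral_fst'[OF i4] by (simp only: val fst_conv snd_conv)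
    also have "\<dots> = (LINT x|M. cov g g * e * (cos (f x + \<theta>) * pairing x g))"
      by (simp add: cos_integral e_def mult_ac)
    also have "\<dots> = cov g g * e * (LINT x|M. cos (f x + \<theta>) * pairing x g)" by simp
    finally show "(LINT p|GG. indicat_real E (fst p) * (g (snd p) - cov g g * g (fst p)) * cos (f (fst p + g (snd p) *\<^sub>R ?h) + \<theta>))
      + (LINT p|MG. cov g g * pairing (fst p) g * cos (f (fst p + g (snd p) *\<^sub>R ?h) + \<theta>)) = 0"
      using 1 by simp
  qed
qed

text \<open>A unit vector has distance less than 1 to some member of the countable dense family,
  whereas a functional orthogonal to it has distance at least 1. Countability permits the union of
  one exceptional set per functional.\<close>

lemma pairing_null_imp:
  obtains e :: "nat \<Rightarrow> 'a \<Rightarrow>\<^sub>L real"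
  where "\<And>x. (LINT y|\<gamma>. (W (x, y))\<^sup>2) = 1 \<Longrightarrow> \<exists>j. pairing x (e j) \<noteq> 0"
proof -
  obtain e :: "nat \<Rightarrow> 'a \<Rightarrow>\<^sub>L real"
    where e: "\<And>g r. g \<in> L2_dual_closure \<gamma> \<Longrightarrow> r > 0 \<Longrightarrow> \<exists>j. L2norm (\<lambda>x. g x - e j x) < r"
    using dual_separable by blast
  show ?thesis
  proof (rule that[of e])
    fix x assume n: "(LINT y|\<gamma>. (W (x, y))\<^sup>2) = 1"
    note L = L2_dual_closureD(1)[OF W_closure, of x]
    obtain j where j: "L2norm (\<lambda>y. W (x, y) - e j y) < 1" using e[OF W_closure[of x], of 1] by auto
    have "pairing x (e j) \<noteq> 0"
    proof
      assume z: "pairing x (e j) = 0"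
      have "(L2norm (\<lambda>y. W (x, y) - e j y))\<^sup>2 = (LINT y|\<gamma>. (W (x, y))\<^sup>2 - 2 * (W (x, y) * e j y) + (e j y)\<^sup>2)"
        unfolding L2norm_power2 by (simp add: power2_diff algebra_simps)
      also have "\<dots> = 1 - 2 * pairing x (e j) + (LINT y|\<gamma>. (e j y)\<^sup>2)"
        using L2_power2[OF L] L2_mult[OF L L2_blinfun[of "e j"]] n by (simp add: pairing_def)
      finally have "1 \<le> (L2norm (\<lambda>y. W (x, y) - e j y))\<^sup>2" using z by simp
      moreover have "(L2norm (\<lambda>y. W (x, y) - e j y))\<^sup>2 < 1\<^sup>2"
        using j L2norm_nonneg by (intro power_strict_mono) auto
      ultimately show False by simp
    qed
    then show "\<exists>j. pairing x (e j) \<noteq> 0" by blast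
  qed
qed

text \<open>Insert a cosine times the indicator of Z into \<open>shift_identity\<close>. Invariance
  lets the indicator pass through the random translation, and the term with \<gamma> vanishes
  because Z is null. What remains says that the signed measure with density
  \<open>indicat_real Z x * pairing x g\<close> against M annihilates all cosines.\<close>

lemma invariant_null_pairing:
  assumes Z [measurable]: "Z \<in> sets borel" and null: "prob Z = 0"
    and inv: "\<And>t x. x + t *\<^sub>R cm_shift g \<in> Z \<longleftrightarrow> x \<in> Z"
  shows "AE x in M. indicat_real Z x * pairing x g = 0"
proof (cases "cov g g = 0")
  case True
  show ?thesis using pairing_bound[of g] by eventually_elim (simp add: True)
next
  case False
  then have s: "cov g g > 0" using cov_nonneg[of g] by simp
  have Z_ae: "AE x in \<gamma>. x \<notin> Z"
    using null by (subst AE_iff_measurable[of Z]) (auto simp: emeasure_eq_measure)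
  have Z_fst: "(\<lambda>p :: 'a \<times> 'a. indicat_real Z (fst p)) \<in> borel_measurable borel"
    by (rule measurable_compose[OF fst_borel_measurable borel_measurable_indicator[OF Z]])
  have pair_fst: "(\<lambda>p :: 'a \<times> 'a. pairing (fst p) g) \<in> borel_measurable borel"
    by (rule measurable_compose[OF fst_borel_measurable pairing_measurable])
  have ip: "integrable M (\<lambda>x. indicat_real Z x * pairing x g)"
    by (rule pairing_integrable) (auto simp: indicator_def)
  have "(LINT x|M. (indicat_real Z x * pairing x g) * cos (f x + \<theta>)) = 0" for f :: "'a \<Rightarrow>\<^sub>L real" and \<theta> :: real
  proof -
    define u where "u x = indicat_real Z x * cos (f x + \<theta>)" for x
    have um [measurable]: "u \<in> borel_measurable borel" unfolding u_def by measurable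
    have u1: "\<bar>u x\<bar> \<le> 1" for x by (auto simp: u_def indicator_def)
    define c where "c = cov f g"
    have u_shift: "u (x + g y *\<^sub>R cm_shift g) = indicat_real Z x * cos ((c *\<^sub>R g) y + (f x + \<theta>))" for x y
      using inv[of x "g y"]
      by (simp add: u_def indicator_def blinfun.add_right blinfun.scaleR_right blinfun.scaleR_left blinfun_cm_shift c_def
          cov_commute[of g f] algebra_simps)
    have "AE x in \<gamma>. AE y in \<gamma>. fst (x, y) \<notin> Z" using Z_ae by eventually_elim simp
    then have "AE p in GG. fst p \<notin> Z"
      by (intro pp.AE_pair_measure) (auto intro: measurable_sets[OF fst_borel_measurable, of "- Z", simplified vimage_def])
    then have "(LINT p|GG. indicat_real E (fst p) * (g (snd p) - cov g g * g (fst p)) * u (fst p + g (snd p) *\<^sub>R cm_shift g)) = 0"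
      by (intro integral_eq_zero_AE) (auto simp: u_shift)
    then have "(LINT p|MG. cov g g * pairing (fst p) g * u (fst p + g (snd p) *\<^sub>R cm_shift g)) = 0"
      using shift_identity[OF um u1, of g] by simp
    moreover have "integrable MG (\<lambda>p. cov g g * pairing (fst p) g * u (fst p + g (snd p) *\<^sub>R cm_shift g))"
    proof (rule integrable_mult_bounded[OF _ _ u1])
      have "(\<lambda>p :: 'a \<times> 'a. fst p + g (snd p) *\<^sub>R cm_shift g) \<in> measurable borel borel"
        by (intro borel_measurable_continuous_onI continuous_intros)
      from measurable_compose[OF this um]
      show "(\<lambda>p. u (fst p + g (snd p) *\<^sub>R cm_shift g)) \<in> borel_measurable MG" by simp
      show "integrable MG (\<lambda>p. cov g g * pairing (fst p) g)"
      proof (rule integrable_mult_right, rule fMG.integrable_const_bound[of _ "sqrt (cov g g)"])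
        have "AE x in M. AE y in \<gamma>. norm (pairing (fst (x, y)) g) \<le> sqrt (cov g g)"
          using pairing_bound[of g] by eventually_elim simp
        then show "AE p in MG. norm (pairing (fst p) g) \<le> sqrt (cov g g)"
          using pair_fst by (intro MG.AE_pair_measure) auto
      qed (use pair_fst in simp)
    qed
    note MG.integral_fst'[OF this]
    ultimately have "0 = (LINT x|M. LINT y|\<gamma>. cov g g * pairing x g * (indicat_real Z x * cos ((c *\<^sub>R g) y + (f x + \<theta>))))"
      by (simp add: u_shift)
    also have "\<dots> = (LINT x|M. (cov g g * exp (- cov (c *\<^sub>R g) (c *\<^sub>R g) / 2)) * ((indicat_real Z x * pairing x g) * cos (f x + \<theta>)))"
      by (simp add: cos_integral mult_ac)
    also have "\<dots> = (cov g g * exp (- cov (c *\<^sub>R g) (c *\<^sub>R g) / 2)) * (LINT x|M. (indicat_real Z x * pairing x g) * cos (f x + \<theta>))"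
      by simp
    finally show ?thesis using s by simp
  qed
  then have zero: "(LINT x|M. (indicat_real Z x * pairing x g) * cos (f x + \<theta>)) + (LINT x|M. 0 * cos (f x + \<theta>)) = 0"
    for f :: "'a \<Rightarrow>\<^sub>L real" and \<theta> :: real by simp
  \<comment> \<open>Testing a vanishing signed measure with the sign of its density yields its total
    variation.\<close>
  define sg where "sg x = indicat_real {x. pairing x g > 0} x - indicat_real {x. pairing x g < 0} x" for x
  have sg [measurable]: "sg \<in> borel_measurable borel" unfolding sg_def by measurable
  have sg1: "\<bar>sg x\<bar> \<le> 1" and sgp: "indicat_real Z x * pairing x g * sg x = \<bar>indicat_real Z x * pairing x g\<bar>" for x
    by (auto simp: sg_def indicator_def)
  have "(LINT x|M. (indicat_real Z x * pairing x g) * sg x) + (LINT x|M. 0 * sg x) = 0"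
    by (rule trig_functional_zero[where ?Z1.0 = "\<lambda>x. x" and ?Z2.0 = "\<lambda>x. x", OF ip _ _ _ zero sg sg1]) auto
  then have "(LINT x|M. \<bar>indicat_real Z x * pairing x g\<bar>) = 0" by (simp add: sgp)
  then have "AE x in M. \<bar>indicat_real Z x * pairing x g\<bar> = 0"
    using ip by (subst (asm) integral_nonneg_eq_0_iff_AE) auto
  then show ?thesis by simp
qed

text \<open>Although \<open>M\<close> itself is singular, the points \<open>x\<close> for which \<open>c x + s y\<close> lies in \<open>N\<close> with positive
  probability form a \<open>\<gamma>\<close>-null set invariant under the translations by \<^const>\<open>cm_shift\<close>, and such sets
  do not carry \<open>M\<close>.\<close>

lemma mix_absolutely_continuous:
  assumes cs: "c\<^sup>2 + s\<^sup>2 = 1" and s: "s \<noteq> 0" and N [measurable]: "N \<in> sets borel" and null: "prob N = 0"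
  shows "AE p in MG. c *\<^sub>R fst p + s *\<^sub>R snd p \<notin> N"
proof -
  have N_ae: "AE x in \<gamma>. x \<notin> N"
    using null by (subst AE_iff_measurable[of N]) (auto simp: emeasure_eq_measure)
  have mN: "{p :: 'a \<times> 'a. c *\<^sub>R fst p + s *\<^sub>R snd p \<in> N} \<in> sets borel"
    using measurable_sets[OF mix_measurable N, of c s] by (simp add: vimage_def)
  define S where "S x = {y. c *\<^sub>R x + s *\<^sub>R y \<in> N}" for x
  have S_meas: "S x \<in> sets borel" for x
  proof -
    have "(\<lambda>y. c *\<^sub>R x + s *\<^sub>R y) \<in> measurable borel borel"
      by (intro borel_measurable_continuous_onI continuous_intros)
    from measurable_sets[OF this N] show ?thesis by (simp add: S_def vimage_def)
  qed
  define Z where "Z = {x. prob (S x) > 0}"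
  have pm: "(\<lambda>x. prob (S x)) \<in> borel_measurable borel"
  proof -
    have "{p :: 'a \<times> 'a. c *\<^sub>R fst p + s *\<^sub>R snd p \<in> N} \<in> sets (borel \<Otimes>\<^sub>M \<gamma>)"
      using mN sets_pair_measure_cong[OF refl sets_gauss, of "borel :: 'a measure"] by simp
    from measurable_compose[OF measurable_emeasure_Pair[OF this], of enn2real borel]
    show ?thesis by (simp add: measure_def S_def vimage_def)
  qed
  have Z_meas [measurable]: "Z \<in> sets borel" unfolding Z_def using pm by measurable
  have S_ae: "prob (S x) = 0 \<longleftrightarrow> (AE y in \<gamma>. c *\<^sub>R x + s *\<^sub>R y \<notin> N)" for x
    using S_meas[of x] by (subst AE_iff_measurable[of "S x"]) (auto simp: emeasure_eq_measure S_def)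
  have notZ: "x \<notin> Z \<longleftrightarrow> prob (S x) = 0" for x
    by (simp add: Z_def not_less measure_le_0_iff)
  have "AE x in distr GG borel (\<lambda>p. c *\<^sub>R fst p + s *\<^sub>R snd p). x \<notin> N"
    unfolding distr_gauss_mix[OF cs] by (rule N_ae)
  then have "AE p in GG. c *\<^sub>R fst p + s *\<^sub>R snd p \<notin> N"
    by (subst (asm) AE_distr_iff) auto
  then have "AE x in \<gamma>. AE y in \<gamma>. c *\<^sub>R x + s *\<^sub>R y \<notin> N"
    using pp.AE_pair[of "\<lambda>p. c *\<^sub>R fst p + s *\<^sub>R snd p \<notin> N"] by simp
  then have "AE x in \<gamma>. x \<notin> Z" by (simp add: notZ S_ae)
  then have Z_null: "prob Z = 0" by (subst (asm) AE_iff_measurable[of Z]) (auto simp: emeasure_eq_measure)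
  \<comment> \<open>As s \<noteq> 0, a translation of x by t h is absorbed by the translation of y
    by (c t / s) h, and the latter preserves \<gamma>-null sets.\<close>
  have sub: "prob (S x) = 0 \<Longrightarrow> prob (S (x + t *\<^sub>R cm_shift g)) = 0" for x t g
  proof -
    assume "prob (S x) = 0"
    moreover have "c *\<^sub>R (x + t *\<^sub>R cm_shift g) + s *\<^sub>R y = c *\<^sub>R x + s *\<^sub>R (y + (c * t / s) *\<^sub>R cm_shift g)" for y
      using s by (simp add: scaleR_add_right)
    ultimately show ?thesis
      using cm_shift_null[OF S_meas, of x "c * t / s" g] by (simp add: S_def)
  qed
  have inv: "x + t *\<^sub>R cm_shift g \<in> Z \<longleftrightarrow> x \<in> Z" for x t g
    using sub[of x t g] sub[of "x + t *\<^sub>R cm_shift g" "- t" g] notZ by auto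
  obtain e :: "nat \<Rightarrow> 'a \<Rightarrow>\<^sub>L real"
    where e: "\<And>x. (LINT y|\<gamma>. (W (x, y))\<^sup>2) = 1 \<Longrightarrow> \<exists>j. pairing x (e j) \<noteq> 0" using pairing_null_imp by blast
  have "AE x in M. \<forall>j. indicat_real Z x * pairing x (e j) = 0"
    unfolding AE_all_countable using invariant_null_pairing[OF Z_meas Z_null inv] by blast
  then have "AE x in M. x \<notin> Z"
    using W_norm
  proof eventually_elim
    case (elim x)
    then show ?case using e[of x] by (auto simp: indicator_def split: if_splits)
  qed
  then have "AE x in M. AE y in \<gamma>. c *\<^sub>R fst (x, y) + s *\<^sub>R snd (x, y) \<notin> N"
    by (simp add: notZ S_ae)
  then show ?thesis
    using sets.compl_sets[OF mN]
    by (intro MG.AE_pair_measure) (simp_all add: Compl_eq_Diff_UNIV[symmetric] Collect_neg_eq[symmetric])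
qed

end

context centered_gaussian
begin

section \<open>The Ornstein-Uhlenbeck semigroup\<close>

text \<open>Mehler's formula with c = exp (- t) as the parameter: the semigroup law becomes
  multiplication of parameters, and c is the cosine of the rotation angle.\<close>

definition ou :: "real \<Rightarrow> ('a \<Rightarrow> real) \<Rightarrow> 'a \<Rightarrow> real" where
  "ou c u x = (LINT y|\<gamma>. u (c *\<^sub>R x + sqrt (1 - c\<^sup>2) *\<^sub>R y))"

lemma circle_sqrt: "0 \<le> c \<Longrightarrow> c \<le> 1 \<Longrightarrow> c\<^sup>2 + (sqrt (1 - c\<^sup>2))\<^sup>2 = 1" for c :: real
  by (simp add: power_le_one)

lemma slice_measurable:
  fixes u :: "'a \<Rightarrow> real"
  assumes "u \<in> borel_measurable borel"
  shows "(\<lambda>y. u (x + s *\<^sub>R y)) \<in> borel_measurable borel"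
proof -
  have "(\<lambda>y. x + s *\<^sub>R y) \<in> measurable borel borel"
    by (intro borel_measurable_continuous_onI continuous_intros)
  from measurable_compose[OF this assms] show ?thesis .
qed

lemma mix_compose_measurable:
  fixes u :: "'a \<Rightarrow> real"
  assumes "u \<in> borel_measurable borel"
  shows "(\<lambda>p :: 'a \<times> 'a. u (c *\<^sub>R fst p + s *\<^sub>R snd p)) \<in> borel_measurable borel"
  by (rule measurable_compose[OF mix_measurable assms])

lemma ou_measurable:
  assumes "u \<in> borel_measurable borel"
  shows "ou c u \<in> borel_measurable borel"
proof -
  have "(\<lambda>(x, y). u (c *\<^sub>R x + sqrt (1 - c\<^sup>2) *\<^sub>R y)) \<in> borel_measurable (borel \<Otimes>\<^sub>M \<gamma>)"
    using mix_compose_measurable[OF assms, of c "sqrt (1 - c\<^sup>2)"]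
      measurable_cong_sets[OF sets_pair_measure_cong[OF refl sets_gauss, of "borel :: 'a measure"] refl, of "borel :: real measure"]
    by (simp add: borel_prod case_prod_unfold)
  from borel_measurable_lebesgue_integral[OF this] show ?thesis unfolding ou_def .
qed

lemma bounded_integrable:
  fixes u :: "'a \<Rightarrow> real"
  assumes "u \<in> borel_measurable borel" "\<And>x. \<bar>u x\<bar> \<le> K"
  shows "integrable \<gamma> u"
  using assms by (intro integrable_const_bound[of _ K]) auto

lemma bounded_integral_bound:
  fixes u :: "'a \<Rightarrow> real"
  assumes "u \<in> borel_measurable borel" "\<And>x. \<bar>u x\<bar> \<le> K"
  shows "\<bar>LINT x|\<gamma>. u x\<bar> \<le> K"
proof -
  have "\<bar>LINT x|\<gamma>. u x\<bar> \<le> (LINT x|\<gamma>. \<bar>u x\<bar>)" using integral_norm_bound[of \<gamma> u] by simp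
  also have "\<dots> \<le> (LINT x|\<gamma>. K)"
    using bounded_integrable[OF assms] assms(2) by (intro integral_mono) auto
  finally show ?thesis by simp
qed

lemma ou_bound:
  assumes "u \<in> borel_measurable borel" "\<And>x. \<bar>u x\<bar> \<le> K"
  shows "\<bar>ou c u x\<bar> \<le> K"
  unfolding ou_def by (rule bounded_integral_bound[OF slice_measurable[OF assms(1)] assms(2)])

lemma ou_pairing:
  assumes u: "u \<in> borel_measurable borel" "\<And>x. \<bar>u x\<bar> \<le> K" and v: "v \<in> borel_measurable borel" "\<And>x. \<bar>v x\<bar> \<le> L"
  shows "(LINT x|\<gamma>. v x * ou c u x) = (LINT p|GG. v (fst p) * u (c *\<^sub>R fst p + sqrt (1 - c\<^sup>2) *\<^sub>R snd p))"
proof -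
  have "integrable GG (\<lambda>p. v (fst p) * u (c *\<^sub>R fst p + sqrt (1 - c\<^sup>2) *\<^sub>R snd p))"
  proof (rule gauss2_integrable)
    show "(\<lambda>p. v (fst p) * u (c *\<^sub>R fst p + sqrt (1 - c\<^sup>2) *\<^sub>R snd p)) \<in> borel_measurable borel"
      by (intro borel_measurable_times mix_compose_measurable[OF u(1)] measurable_compose[OF fst_borel_measurable v(1)])
    show "\<bar>v (fst p) * u (c *\<^sub>R fst p + sqrt (1 - c\<^sup>2) *\<^sub>R snd p)\<bar> \<le> L * K" for p
      unfolding abs_mult using u(2)[of "c *\<^sub>R fst p + sqrt (1 - c\<^sup>2) *\<^sub>R snd p"] v(2)[of "fst p"] by (intro mult_mono) auto
  qed
  from pp.integral_fst'[OF this] show ?thesis by (simp add: ou_def)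
qed

lemma integral_reflect:
  fixes u :: "'a \<Rightarrow> real"
  assumes "u \<in> borel_measurable borel"
  shows "(LINT y|\<gamma>. u (- y)) = (LINT y|\<gamma>. u y)"
proof -
  have m: "(\<lambda>y. u (- y)) \<in> borel_measurable borel" using slice_measurable[OF assms, of 0 "- 1"] by simp
  show ?thesis
    using integral_mix[OF _ assms, of "- 1" 0] integral_mix[OF _ m, of 1 0] by simp
qed

text \<open>The pair (x, c x + s y) is exchangeable. Rotating the product by the opposite angle
  swaps the two entries up to the reflection of y, which preserves \<gamma>.\<close>

lemma ou_selfadjoint:
  assumes c: "0 \<le> c" "c \<le> 1"
    and u: "u \<in> borel_measurable borel" "\<And>x. \<bar>u x\<bar> \<le> K" and v: "v \<in> borel_measurable borel" "\<And>x. \<bar>v x\<bar> \<le> L"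
  shows "(LINT x|\<gamma>. v x * ou c u x) = (LINT x|\<gamma>. ou c v x * u x)"
proof -
  define s where "s = sqrt (1 - c\<^sup>2)"
  have cs: "c\<^sup>2 + s\<^sup>2 = 1" unfolding s_def by (rule circle_sqrt[OF c])
  let ?k = "\<lambda>p. v (fst p) * u (c *\<^sub>R fst p + s *\<^sub>R snd p)"
  have km: "?k \<in> borel_measurable borel"
    by (intro borel_measurable_times mix_compose_measurable[OF u(1)] measurable_compose[OF fst_borel_measurable v(1)])
  have rotated: "?k (rot c (- s) p) = v (c *\<^sub>R fst p - s *\<^sub>R snd p) * u (fst p)" for p
  proof -
    have "c *\<^sub>R (c *\<^sub>R fst p - s *\<^sub>R snd p) + s *\<^sub>R (c *\<^sub>R snd p + s *\<^sub>R fst p) = (c\<^sup>2 + s\<^sup>2) *\<^sub>R fst p"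
      by (simp add: power2_eq_square algebra_simps)
    then show ?thesis by (simp add: rot_def cs)
  qed
  have "(LINT x|\<gamma>. v x * ou c u x) = (LINT p|GG. ?k p)"
    unfolding s_def by (rule ou_pairing[OF u v])
  also have "\<dots> = (LINT p|GG. ?k (rot c (- s) p))"
    using cs km by (intro integral_rot[symmetric]) auto
  also have "\<dots> = (LINT p|GG. v (c *\<^sub>R fst p - s *\<^sub>R snd p) * u (fst p))" by (simp only: rotated)
  also have "\<dots> = (LINT x|\<gamma>. LINT y|\<gamma>. v (c *\<^sub>R x - s *\<^sub>R y) * u x)"
  proof -
    have "integrable GG (\<lambda>p. v (c *\<^sub>R fst p - s *\<^sub>R snd p) * u (fst p))"
    proof (rule gauss2_integrable)
      show "(\<lambda>p. v (c *\<^sub>R fst p - s *\<^sub>R snd p) * u (fst p)) \<in> borel_measurable borel"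
        using mix_compose_measurable[OF v(1), of c "- s"]
        by (intro borel_measurable_times measurable_compose[OF fst_borel_measurable u(1)]) simp
      show "\<bar>v (c *\<^sub>R fst p - s *\<^sub>R snd p) * u (fst p)\<bar> \<le> L * K" for p
        unfolding abs_mult using v(2)[of "c *\<^sub>R fst p - s *\<^sub>R snd p"] u(2)[of "fst p"] by (intro mult_mono) auto
    qed
    from pp.integral_fst'[OF this] show ?thesis by simp
  qed
  also have "\<dots> = (LINT x|\<gamma>. ou c v x * u x)"
  proof (intro Bochner_Integration.integral_cong refl)
    fix x
    have "(LINT y|\<gamma>. v (c *\<^sub>R x + s *\<^sub>R (- y))) = ou c v x"
      unfolding ou_def s_def[symmetric] by (rule integral_reflect[OF slice_measurable[OF v(1)]])
    then show "(LINT y|\<gamma>. v (c *\<^sub>R x - s *\<^sub>R y) * u x) = ou c v x * u x" by simp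
  qed
  finally show ?thesis .
qed

lemma ou_semigroup:
  assumes c: "0 \<le> c" "c \<le> 1" and d: "0 \<le> d" "d \<le> 1"
    and u: "u \<in> borel_measurable borel" "\<And>x. \<bar>u x\<bar> \<le> K"
  shows "ou c (ou d u) x = ou (c * d) u x"
proof -
  define s t S where "s = sqrt (1 - c\<^sup>2)" and "t = sqrt (1 - d\<^sup>2)" and "S = sqrt (1 - (c * d)\<^sup>2)"
  have sq: "c\<^sup>2 + s\<^sup>2 = 1" "d\<^sup>2 + t\<^sup>2 = 1" "(c * d)\<^sup>2 + S\<^sup>2 = 1"
    unfolding s_def t_def S_def using c d by (auto intro!: circle_sqrt mult_le_one simp del: real_sqrt_pow2_iff)
  have S2: "(d * s)\<^sup>2 + t\<^sup>2 = S\<^sup>2"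
  proof -
    have "(d * s)\<^sup>2 + t\<^sup>2 = d\<^sup>2 * s\<^sup>2 + (1 - d\<^sup>2)" using sq by (simp add: power_mult_distrib)
    also have "\<dots> = 1 - d\<^sup>2 * (1 - s\<^sup>2)" by (simp add: algebra_simps)
    also have "1 - s\<^sup>2 = c\<^sup>2" using sq(1) by simp
    also have "1 - d\<^sup>2 * c\<^sup>2 = S\<^sup>2" using sq(3) by (simp add: power_mult_distrib mult.commute)
    finally show ?thesis .
  qed
  \<comment> \<open>The independent noises d s y and t z have squared weights adding up to S^2, so
    they merge into S w with w = \<alpha> y + \<beta> z of law \<gamma>. For S = 0 both noises
    vanish and any unit vector (\<alpha>, \<beta>) serves.\<close>
  obtain \<alpha> \<beta> where ab: "\<alpha>\<^sup>2 + \<beta>\<^sup>2 = 1" "S * \<alpha> = d * s" "S * \<beta> = t"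
  proof (cases "S = 0")
    case True
    then have "d * s = 0" "t = 0" using S2 sum_power2_eq_zero_iff[of "d * s" t] by auto
    then show ?thesis using True by (intro that[of 1 0]) auto
  next
    case False
    have "(d * s / S)\<^sup>2 + (t / S)\<^sup>2 = ((d * s)\<^sup>2 + t\<^sup>2) / S\<^sup>2" by (simp add: power_divide add_divide_distrib)
    also have "\<dots> = 1" using S2 False by simp
    finally show ?thesis using False by (intro that[of "d * s / S" "t / S"]) auto
  qed
  define k where "k w = u ((c * d) *\<^sub>R x + S *\<^sub>R w)" for w
  have km: "k \<in> borel_measurable borel" unfolding k_def by (rule slice_measurable[OF u(1)])
  have "ou c (ou d u) x = (LINT y|\<gamma>. LINT z|\<gamma>. k (\<alpha> *\<^sub>R y + \<beta> *\<^sub>R z))"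
    unfolding ou_def s_def[symmetric] t_def[symmetric] k_def
    by (simp add: scaleR_add_right add.assoc[symmetric] ab mult.commute[of d])
  also have "\<dots> = (LINT p|GG. k (\<alpha> *\<^sub>R fst p + \<beta> *\<^sub>R snd p))"
    using pp.integral_fst'[OF gauss2_integrable[OF mix_compose_measurable[OF km, of \<alpha> \<beta>], of K]] u(2)
    by (simp add: k_def)
  also have "\<dots> = (LINT w|\<gamma>. k w)" by (rule integral_mix[OF ab(1) km])
  also have "\<dots> = ou (c * d) u x" unfolding ou_def k_def S_def ..
  finally show ?thesis .
qed

lemma ou_diff:
  assumes u: "u \<in> borel_measurable borel" "\<And>x. \<bar>u x\<bar> \<le> K" and v: "v \<in> borel_measurable borel" "\<And>x. \<bar>v x\<bar> \<le> L"
  shows "ou c (\<lambda>x. u x - v x) x = ou c u x - ou c v x"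
  unfolding ou_def
  using bounded_integrable[OF slice_measurable[OF u(1)] u(2)] bounded_integrable[OF slice_measurable[OF v(1)] v(2)]
  by simp

text \<open>The absolute value of an average is at most the average of the absolute value, and
  averaging preserves the integral since c x + s y has law \<gamma>.\<close>

lemma ou_contraction:
  assumes c: "0 \<le> c" "c \<le> 1" and u: "u \<in> borel_measurable borel" "\<And>x. \<bar>u x\<bar> \<le> K"
  shows "(LINT x|\<gamma>. \<bar>ou c u x\<bar>) \<le> (LINT x|\<gamma>. \<bar>u x\<bar>)"
proof -
  have au: "(\<lambda>x. \<bar>u x\<bar>) \<in> borel_measurable borel" "\<And>x. \<bar>\<bar>u x\<bar>\<bar> \<le> K" using u by auto
  have "(LINT x|\<gamma>. \<bar>ou c u x\<bar>) \<le> (LINT x|\<gamma>. 1 * ou c (\<lambda>x. \<bar>u x\<bar>) x)"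
  proof (rule integral_mono)
    have "\<bar>\<bar>ou c u x\<bar>\<bar> \<le> K" for x using ou_bound[OF u] by simp
    then show "integrable \<gamma> (\<lambda>x. \<bar>ou c u x\<bar>)"
      using ou_measurable[OF u(1)] by (intro bounded_integrable[of _ K]) auto
    show "integrable \<gamma> (\<lambda>x. 1 * ou c (\<lambda>x. \<bar>u x\<bar>) x)"
      using ou_measurable[OF au(1)] ou_bound[OF au] by (intro bounded_integrable[of _ K]) auto
    show "\<bar>ou c u x\<bar> \<le> 1 * ou c (\<lambda>x. \<bar>u x\<bar>) x" for x
      unfolding ou_def using integral_norm_bound[of \<gamma> "\<lambda>y. u (c *\<^sub>R x + sqrt (1 - c\<^sup>2) *\<^sub>R y)"] by simp
  qed
  also have "\<dots> = (LINT p|GG. 1 * \<bar>u (c *\<^sub>R fst p + sqrt (1 - c\<^sup>2) *\<^sub>R snd p)\<bar>)"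
    by (rule ou_pairing[OF au, of "\<lambda>_. 1" 1]) auto
  also have "\<dots> = (LINT x|\<gamma>. \<bar>u x\<bar>)"
    using integral_mix[OF circle_sqrt[OF c] au(1)] by simp
  finally show ?thesis .
qed

text \<open>Convexity of \<open>\<langle>u, T\<^sub>t u\<rangle>\<close> in \<open>t\<close>, where \<open>c = exp (- t)\<close>: the difference of the two sides is
  the squared distance of \<open>T\<^sub>q u\<close> and its image under \<open>T\<^sub>d\<close>, for \<open>q = sqrt c\<close>.\<close>

lemma ou_midpoint_convex:
  assumes c: "0 \<le> c" "c \<le> 1" and d: "0 \<le> d" "d \<le> 1" and u: "u \<in> borel_measurable borel" "\<And>x. \<bar>u x\<bar> \<le> K"
  shows "2 * (LINT x|\<gamma>. u x * ou (c * d) u x) \<le> (LINT x|\<gamma>. u x * ou c u x) + (LINT x|\<gamma>. u x * ou (c * d\<^sup>2) u x)"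
proof -
  define q where "q = sqrt c"
  have q: "0 \<le> q" "q \<le> 1" "q * q = c" using c by (auto simp: q_def)
  define v w where "v = ou q u" and "w = ou d v"
  have v: "v \<in> borel_measurable borel" "\<And>x. \<bar>v x\<bar> \<le> K"
    unfolding v_def by (intro ou_measurable u) (rule ou_bound[OF u])
  have w: "w \<in> borel_measurable borel" "\<And>x. \<bar>w x\<bar> \<le> K"
    unfolding w_def by (intro ou_measurable v) (rule ou_bound[OF v])
  have 1: "(LINT x|\<gamma>. u x * ou c u x) = (LINT x|\<gamma>. v x * v x)"
    using ou_selfadjoint[OF q(1,2) v u] ou_semigroup[OF q(1,2) q(1,2) u] by (simp add: q(3) v_def)
  have wq: "w x = ou (d * q) u x" for x unfolding w_def v_def by (rule ou_semigroup[OF d q(1,2) u])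
  have dq: "0 \<le> d * q" "d * q \<le> 1" using d q by (auto intro: mult_le_one)
  have 2: "(LINT x|\<gamma>. u x * ou (c * d) u x) = (LINT x|\<gamma>. v x * w x)"
  proof -
    have "ou q w x = ou (c * d) u x" for x
    proof -
      have "ou q w x = ou q (ou (d * q) u) x" using wq by (simp add: ou_def)
      also have "\<dots> = ou (q * (d * q)) u x" by (rule ou_semigroup[OF q(1,2) dq u])
      also have "q * (d * q) = c * d" using q(3) by (simp add: mult_ac)
      finally show ?thesis .
    qed
    then show ?thesis using ou_selfadjoint[OF q(1,2) w u] by (simp add: v_def)
  qed
  have 3: "(LINT x|\<gamma>. u x * ou (c * d\<^sup>2) u x) = (LINT x|\<gamma>. w x * w x)"
  proof -
    have w_eq: "w = ou (d * q) u" using wq by blast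
    have "ou (d * q) (ou (d * q) u) x = ou (c * d\<^sup>2) u x" for x
    proof -
      have "ou (d * q) (ou (d * q) u) x = ou ((d * q) * (d * q)) u x" by (rule ou_semigroup[OF dq dq u])
      also have "(d * q) * (d * q) = (q * q) * d\<^sup>2" by (simp add: power2_eq_square mult_ac)
      finally show ?thesis by (simp only: q(3))
    qed
    then show ?thesis
      using ou_selfadjoint[OF dq ou_measurable[OF u(1)] ou_bound[OF u] u, of "d * q"] by (simp add: w_eq)
  qed
  have i: "integrable \<gamma> (\<lambda>x. v x * w x)" "integrable \<gamma> (\<lambda>x. v x * v x)" "integrable \<gamma> (\<lambda>x. w x * w x)"
    using integrable_mult_bounded[OF bounded_integrable[OF v] _ v(2)] integrable_mult_bounded[OF bounded_integrable[OF v] _ w(2)]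
      integrable_mult_bounded[OF bounded_integrable[OF w] _ w(2)] v(1) w(1) by simp_all
  have "0 \<le> (LINT x|\<gamma>. (v x - w x)\<^sup>2)" by simp
  also have "\<dots> = (LINT x|\<gamma>. v x * v x - 2 * (v x * w x) + w x * w x)"
    by (simp add: power2_eq_square algebra_simps)
  also have "\<dots> = (LINT x|\<gamma>. v x * v x) - 2 * (LINT x|\<gamma>. v x * w x) + (LINT x|\<gamma>. w x * w x)"
    using i by simp
  finally show ?thesis unfolding 1 2 3 by simp
qed

end

context gauss_boundary
begin

section \<open>Overlap and flux in terms of the semigroup\<close>

lemma overlap_ou:
  assumes a: "0 \<le> a" "a \<le> pi"
  shows "overlap a = (LINT x|\<gamma>. indicat_real E x * ou (cos a) (indicat_real E) x)"
proof -
  have "sqrt (1 - (cos a)\<^sup>2) = sin a" using sin_ge_zero[OF a] by (simp add: sin_squared_eq[symmetric])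
  then show ?thesis
    using ou_pairing[of "indicat_real E" 1 "indicat_real E" 1 "cos a"]
    by (simp add: overlap_def rot_def indicator_def)
qed

text \<open>W is correlated with the noise s y only, through f scaled by s; the prefactor s obtained
  in this way decides the ratio in \<open>E_flux_scaling\<close>.\<close>

lemma cos_mix_W:
  fixes f :: "'a \<Rightarrow>\<^sub>L real"
  shows "(LINT p|MG. W p * cos (f (c *\<^sub>R fst p + s *\<^sub>R snd p) + \<theta>))
    = - (s * exp (- s\<^sup>2 * cov f f / 2) * (LINT x|M. pairing x f * sin (c * f x + \<theta>)))"
proof -
  have "(\<lambda>p. cos (f (c *\<^sub>R fst p + s *\<^sub>R snd p) + \<theta>)) \<in> borel_measurable borel"
    by (intro borel_measurable_continuous_onI continuous_intros)
  then have "integrable MG (\<lambda>p. cos (f (c *\<^sub>R fst p + s *\<^sub>R snd p) + \<theta>) * W p)"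
    by (rule W_mult_integrable[of _ 1]) simp
  from MG.integral_fst'[OF this]
  have "(LINT p|MG. W p * cos (f (c *\<^sub>R fst p + s *\<^sub>R snd p) + \<theta>))
      = (LINT x|M. LINT y|\<gamma>. W (x, y) * cos ((s *\<^sub>R f) y + (c * f x + \<theta>)))"
    by (simp add: blinfun.add_right blinfun.scaleR_right blinfun.scaleR_left mult.commute add_ac)
  also have "\<dots> = (LINT x|M. - (s * exp (- s\<^sup>2 * cov f f / 2)) * (pairing x f * sin (c * f x + \<theta>)))"
  proof (intro Bochner_Integration.integral_cong refl)
    fix x
    have "(LINT y|\<gamma>. W (x, y) * (s *\<^sub>R f) y) = s * pairing x f"
      unfolding pairing_def by (simp add: blinfun.scaleR_left mult.left_commute)
    moreover have "cov (s *\<^sub>R f) (s *\<^sub>R f) = s\<^sup>2 * cov f f" by (simp add: cov_simps power2_eq_square)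
    ultimately show "(LINT y|\<gamma>. W (x, y) * cos ((s *\<^sub>R f) y + (c * f x + \<theta>)))
        = - (s * exp (- s\<^sup>2 * cov f f / 2)) * (pairing x f * sin (c * f x + \<theta>))"
      unfolding closure_cos_integral[OF W_closure] by simp
  qed
  finally show ?thesis by simp
qed

text \<open>Smoothing at cos b x + sin b y with r = cos a / cos b gives cos a x plus noise of total
  variance sin^2 a, but W sees only the share r sin b of it instead of sin a. The two weighted
  images are therefore proportional, with ratio tan a / tan b. The gain is that a now enters through
  the function \<open>ou (cos a / cos b)\<close> while the evaluation point keeps the angle
  b.\<close>

lemma E_flux_scaling:
  assumes b: "0 < b" and a: "b \<le> a" "a < pi / 2"
  shows "E_flux a * (cos a * sin b)
    = sin a * cos b * (LINT p|MG. W p * ou (cos a / cos b) (indicat_real E) (cos b *\<^sub>R fst p + sin b *\<^sub>R snd p))"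
proof -
  define r s where "r = cos a / cos b" and "s = sqrt (1 - r\<^sup>2)"
  have cb: "cos b > 0" and ca: "cos a > 0" using a b by (auto intro!: cos_gt_zero)
  have "cos a \<le> cos b" using a b by (intro cos_monotone_0_pi_le) auto
  then have r: "0 \<le> r" "r \<le> 1" "r * cos b = cos a" using ca cb by (auto simp: r_def)
  have rs: "r\<^sup>2 + s\<^sup>2 = 1" unfolding s_def by (rule circle_sqrt[OF r(1,2)])
  interpret Q: pair_sigma_finite MG \<gamma> ..
  have sets_Q: "sets (MG \<Otimes>\<^sub>M \<gamma>) = sets borel"
    unfolding borel_prod[symmetric] by (rule sets_pair_measure_cong) (simp_all add: borel_prod)
  note mQ = measurable_cong_sets[OF sets_Q refl]
  have fst_Q: "(fst :: ('a \<times> 'a) \<times> 'a \<Rightarrow> 'a \<times> 'a) \<in> measurable borel borel" by measurable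
  define Z2 where "Z2 q = r *\<^sub>R (cos b *\<^sub>R fst (fst q) + sin b *\<^sub>R snd (fst q)) + s *\<^sub>R snd q" for q :: "('a \<times> 'a) \<times> 'a"
  have Z2m: "Z2 \<in> measurable borel borel"
    unfolding Z2_def by (intro borel_measurable_continuous_onI continuous_intros)
  define w2 where "w2 q = - (sin a * cos b) * W (fst q)" for q :: "('a \<times> 'a) \<times> 'a"
  have Wq: "(\<lambda>q :: ('a \<times> 'a) \<times> 'a. W (fst q)) \<in> borel_measurable borel"
    by (rule measurable_compose[OF fst_Q W_measurable])
  have iWq: "integrable (MG \<Otimes>\<^sub>M \<gamma>) (\<lambda>q. W (fst q))"
    using Wq W_integrable by (intro Q.Fubini_integrable) (auto simp: mQ)
  then have iw2: "integrable (MG \<Otimes>\<^sub>M \<gamma>) w2" unfolding w2_def by simp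
  have iw1: "integrable MG (\<lambda>p. (cos a * sin b) * W p)" using W_integrable by simp
  have fub: "(LINT q|(MG \<Otimes>\<^sub>M \<gamma>). w2 q * u (Z2 q)) = - (sin a * cos b) * (LINT p|MG. W p * ou r u (cos b *\<^sub>R fst p + sin b *\<^sub>R snd p))"
    if u: "u \<in> borel_measurable borel" "\<And>x. \<bar>u x\<bar> \<le> K" for u :: "'a \<Rightarrow> real" and K
  proof -
    have "integrable (MG \<Otimes>\<^sub>M \<gamma>) (\<lambda>q. w2 q * u (Z2 q))"
      using measurable_compose[OF Z2m u(1)] u(2) by (intro integrable_mult_bounded[OF iw2]) (auto simp: mQ)
    from Q.integral_fst'[OF this] have "(LINT q|(MG \<Otimes>\<^sub>M \<gamma>). w2 q * u (Z2 q)) = (LINT p|MG. LINT z|\<gamma>. w2 (p, z) * u (Z2 (p, z)))"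
      by simp
    also have "\<dots> = (LINT p|MG. - (sin a * cos b) * (W p * ou r u (cos b *\<^sub>R fst p + sin b *\<^sub>R snd p)))"
      by (simp add: w2_def Z2_def ou_def s_def mult.assoc)
    finally show ?thesis by simp
  qed
  have main: "(LINT p|MG. (cos a * sin b) * W p * indicat_real E (cos a *\<^sub>R fst p + sin a *\<^sub>R snd p))
      + (LINT q|(MG \<Otimes>\<^sub>M \<gamma>). w2 q * indicat_real E (Z2 q)) = 0"
  proof (rule trig_functional_zero[where ?Z1.0 = "\<lambda>p. cos a *\<^sub>R fst p + sin a *\<^sub>R snd p", OF iw1 iw2, where u = "indicat_real E" and K = 1])
    show "(\<lambda>p. cos a *\<^sub>R fst p + sin a *\<^sub>R snd p) \<in> measurable MG borel" by simp
    show "Z2 \<in> measurable (MG \<Otimes>\<^sub>M \<gamma>) borel" using Z2m by (simp add: mQ)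
    fix f :: "'a \<Rightarrow>\<^sub>L real" and \<theta> :: real
    have cm: "(\<lambda>x. cos (f x + \<theta>)) \<in> borel_measurable borel"
      by (intro borel_measurable_continuous_onI continuous_intros)
    have ou_cos: "ou r (\<lambda>x. cos (f x + \<theta>)) x = exp (- s\<^sup>2 * cov f f / 2) * cos (r * f x + \<theta>)" for x
    proof -
      have "ou r (\<lambda>x. cos (f x + \<theta>)) x = (LINT y|\<gamma>. cos ((s *\<^sub>R f) y + (r * f x + \<theta>)))"
        unfolding ou_def s_def[symmetric]
        by (simp add: blinfun.add_right blinfun.scaleR_right blinfun.scaleR_left add_ac)
      then show ?thesis
        unfolding cos_integral by (simp add: cov_simps power2_eq_square mult.assoc)
    qed
    define J where "J = (LINT x|M. pairing x f * sin (cos a * f x + \<theta>))"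
    have "(LINT p|MG. W p * ou r (\<lambda>x. cos (f x + \<theta>)) (cos b *\<^sub>R fst p + sin b *\<^sub>R snd p))
        = (LINT p|MG. exp (- s\<^sup>2 * cov f f / 2) * (W p * cos (f ((r * cos b) *\<^sub>R fst p + (r * sin b) *\<^sub>R snd p) + \<theta>)))"
      unfolding ou_cos by (simp add: blinfun.add_right blinfun.scaleR_right algebra_simps)
    also have "\<dots> = exp (- s\<^sup>2 * cov f f / 2) * (- (r * sin b * exp (- (r * sin b)\<^sup>2 * cov f f / 2) * J))"
      by (simp add: cos_mix_W J_def r(3))
    also have "\<dots> = - (r * sin b * exp (- s\<^sup>2 * cov f f / 2 + - (r * sin b)\<^sup>2 * cov f f / 2) * J)"
      by (simp only: exp_add) (simp add: mult_ac)
    also have "- s\<^sup>2 * cov f f / 2 + - (r * sin b)\<^sup>2 * cov f f / 2 = - (sin a)\<^sup>2 * cov f f / 2"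
    proof -
      have "s\<^sup>2 + (r * sin b)\<^sup>2 = 1 - (r * cos b)\<^sup>2"
        using rs by (simp add: power_mult_distrib sin_squared_eq algebra_simps)
      also have "\<dots> = (sin a)\<^sup>2" by (simp add: r(3) sin_squared_eq)
      finally have "(s\<^sup>2 + (r * sin b)\<^sup>2) * cov f f = (sin a)\<^sup>2 * cov f f" by simp
      then show ?thesis by (simp add: algebra_simps)
    qed
    finally have 2: "(LINT q|(MG \<Otimes>\<^sub>M \<gamma>). w2 q * cos (f (Z2 q) + \<theta>)) = sin a * cos b * (r * sin b * exp (- (sin a)\<^sup>2 * cov f f / 2) * J)"
      using fub[OF cm, of 1] by simp
    have 1: "(LINT p|MG. (cos a * sin b) * W p * cos (f (cos a *\<^sub>R fst p + sin a *\<^sub>R snd p) + \<theta>))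
        = (cos a * sin b) * - (sin a * exp (- (sin a)\<^sup>2 * cov f f / 2) * J)"
      using cos_mix_W[of f "cos a" "sin a" \<theta>] by (simp add: J_def mult.assoc)
    show "(LINT p|MG. (cos a * sin b) * W p * cos (f (cos a *\<^sub>R fst p + sin a *\<^sub>R snd p) + \<theta>))
        + (LINT q|(MG \<Otimes>\<^sub>M \<gamma>). w2 q * cos (f (Z2 q) + \<theta>)) = 0"
      unfolding 1 2 by (simp add: r(3)[symmetric] mult_ac)
  qed (auto simp: indicator_def)
  have e1: "(LINT p|MG. (cos a * sin b) * W p * indicat_real E (cos a *\<^sub>R fst p + sin a *\<^sub>R snd p)) = (cos a * sin b) * E_flux a"
    by (simp add: E_flux_def flux_def rot_def mult_ac)
  have e2: "(LINT q|(MG \<Otimes>\<^sub>M \<gamma>). w2 q * indicat_real E (Z2 q))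
      = - (sin a * cos b) * (LINT p|MG. W p * ou r (indicat_real E) (cos b *\<^sub>R fst p + sin b *\<^sub>R snd p))"
    by (rule fub[of _ 1]) (auto simp: indicator_def)
  show ?thesis using main unfolding e1 e2 by (simp add: r_def mult.commute)
qed

section \<open>The blow-up\<close>

lemma E_borel_bounded: "indicat_real E \<in> borel_measurable borel" "\<And>x. \<bar>indicat_real E x\<bar> \<le> 1"
  by (auto simp: indicator_def)

text \<open>The L1 contraction reduces the pair r', r to the pair r' / r, 1. There the distance is
  at most the symmetric difference of E and its copy rotated by arccos (r' / r), which
  \<open>overlap_upper\<close> controls.\<close>

lemma ou_E_close:
  assumes r: "0 \<le> r'" "r' \<le> r" "0 < r" "r \<le> 1"
  shows "(LINT x|\<gamma>. \<bar>ou r' (indicat_real E) x - ou r (indicat_real E) x\<bar>) \<le> 2 * (arccos (r' / r) * max_flux)"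
proof -
  define d where "d = r' / r"
  have d: "0 \<le> d" "d \<le> 1" "r * d = r'" using r by (auto simp: d_def)
  define a where "a = arccos d"
  have a: "0 \<le> a" "a \<le> pi" "cos a = d" using d unfolding a_def by (auto intro: arccos_lbound arccos_ubound)
  let ?E = "indicat_real E"
  have dm1: "(\<lambda>x. ou d ?E x - ?E x) \<in> borel_measurable borel"
    by (intro borel_measurable_diff ou_measurable E_borel_bounded)
  have dm2: "\<bar>ou d ?E x - ?E x\<bar> \<le> 1 + 1" for x
    using ou_bound[OF E_borel_bounded, of d x] E_borel_bounded(2)[of x] by linarith
  note dm = dm1 dm2
  have "ou r (\<lambda>x. ou d ?E x - ?E x) x = ou r' ?E x - ou r ?E x" for x
    unfolding ou_diff[OF ou_measurable[OF E_borel_bounded(1)] ou_bound[OF E_borel_bounded] E_borel_bounded]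
      ou_semigroup[OF less_imp_le[OF r(3)] r(4) d(1,2) E_borel_bounded] d(3) ..
  then have "(LINT x|\<gamma>. \<bar>ou r' ?E x - ou r ?E x\<bar>) = (LINT x|\<gamma>. \<bar>ou r (\<lambda>x. ou d ?E x - ?E x) x\<bar>)"
    by (simp only:)
  also have "\<dots> \<le> (LINT x|\<gamma>. \<bar>ou d ?E x - ?E x\<bar>)"
    using r dm by (intro ou_contraction[of _ _ "1 + 1"]) auto
  also have "\<dots> \<le> (LINT p|GG. \<bar>?E (fst p) - ?E (fst (rot (cos a) (sin a) p))\<bar>)"
  proof -
    let ?k = "\<lambda>p. ?E (fst p) - ?E (fst (rot (cos a) (sin a) p))"
    have km: "?k \<in> borel_measurable borel" by measurable
    have k1: "\<bar>?k p\<bar> \<le> 1" for p by (auto simp: indicator_def)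
    have i: "integrable GG (\<lambda>p. \<bar>?k p\<bar>)" using gauss2_integrable[OF km k1] by simp
    have sa: "sqrt (1 - d\<^sup>2) = sin a" using sin_ge_zero[OF a(1,2)] by (simp add: a(3)[symmetric] sin_squared_eq[symmetric])
    have "(LINT x|\<gamma>. \<bar>ou d ?E x - ?E x\<bar>) \<le> (LINT x|\<gamma>. LINT y|\<gamma>. \<bar>?k (x, y)\<bar>)"
    proof (rule integral_mono)
      show "integrable \<gamma> (\<lambda>x. \<bar>ou d ?E x - ?E x\<bar>)" using bounded_integrable[OF dm] by simp
      show "integrable \<gamma> (\<lambda>x. LINT y|\<gamma>. \<bar>?k (x, y)\<bar>)" using pp.integrable_fst'[OF i] by simp
      fix x
      have m: "(\<lambda>y. ?E (d *\<^sub>R x + sin a *\<^sub>R y)) \<in> borel_measurable borel"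
        by (rule slice_measurable[OF E_borel_bounded(1)])
      have "ou d ?E x - ?E x = (LINT y|\<gamma>. ?E (d *\<^sub>R x + sin a *\<^sub>R y) - ?E x)"
        unfolding ou_def sa using bounded_integrable[OF m E_borel_bounded(2)] by simp
      then have "\<bar>ou d ?E x - ?E x\<bar> \<le> (LINT y|\<gamma>. \<bar>?E (d *\<^sub>R x + sin a *\<^sub>R y) - ?E x\<bar>)"
        using integral_norm_bound[of \<gamma> "\<lambda>y. ?E (d *\<^sub>R x + sin a *\<^sub>R y) - ?E x"] by simp
      then show "\<bar>ou d ?E x - ?E x\<bar> \<le> (LINT y|\<gamma>. \<bar>?k (x, y)\<bar>)"
        by (simp add: rot_def a(3) abs_minus_commute)
    qed
    also have "\<dots> = (LINT p|GG. \<bar>?k p\<bar>)" by (rule pp.integral_fst'[OF i])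
    finally show ?thesis .
  qed
  also have "\<dots> = 2 * (prob E - overlap a)" by (rule symmetric_difference_rot)
  also have "\<dots> \<le> 2 * (a * max_flux)" using overlap_upper[OF a(1)] by simp
  finally show ?thesis by (simp add: a_def d_def)
qed

text \<open>L1 convergence of the smoothed indicators gives \<gamma>-a.e. convergence along a
  subsequence, and \<open>mix_absolutely_continuous\<close> shows that the points cos b x + sin b y
  avoid the exceptional set \<open>MG\<close>-a.e. A subsequence is enough for the later use, a
  lower bound for the limit.\<close>

lemma E_flux_right_continuous:
  assumes a: "0 < a" "a < pi / 2" and X: "\<And>n. a \<le> X n" "\<And>n. X n < pi / 2" "X \<longlonglongrightarrow> a"
  shows "\<exists>k. strict_mono k \<and> (\<lambda>n. E_flux (X (k n))) \<longlonglongrightarrow> E_flux a"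
proof -
  \<comment> \<open>A fixed angle below a: b > 0 provides noise at the evaluation point, and b \<le>
    a keeps cos a / cos b in [0, 1].\<close>
  define b where "b = a / 2"
  have b: "0 < b" "b \<le> a" "b < a" using a by (auto simp: b_def)
  let ?E = "indicat_real E"
  define r where "r t = cos t / cos b" for t
  have cb: "cos b > 0" using a b by (intro cos_gt_zero) auto
  have sb: "sin b > 0" using a b by (intro sin_gt_zero) auto
  have ct: "cos t > 0" if "a \<le> t" "t < pi / 2" for t using that a by (intro cos_gt_zero) auto
  have r_pos: "0 < r t" if "a \<le> t" "t < pi / 2" for t using ct[OF that] cb by (simp add: r_def)
  have r_le: "r t \<le> r a" if "a \<le> t" "t < pi / 2" for t
  proof -
    have "cos t \<le> cos a" using that a by (intro cos_monotone_0_pi_le) auto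
    then show ?thesis using cb by (simp add: r_def divide_right_mono)
  qed
  have ra: "r a \<le> 1"
  proof -
    have "cos a \<le> cos b" using a b by (intro cos_monotone_0_pi_le) auto
    then show ?thesis using cb by (simp add: r_def)
  qed
  have r_lim: "(\<lambda>n. r (X n)) \<longlonglongrightarrow> r a"
    unfolding r_def using cb by (intro tendsto_intros X) auto
  define U where "U n x = ou (r (X n)) ?E x - ou (r a) ?E x" for n x
  have ouE: "ou c ?E \<in> borel_measurable borel" "\<And>x. \<bar>ou c ?E x\<bar> \<le> 1" for c
    using ou_measurable[OF E_borel_bounded(1)] ou_bound[OF E_borel_bounded] by auto
  have L1: "(\<lambda>n. LINT x|\<gamma>. norm (U n x)) \<longlonglongrightarrow> 0"
  proof (rule tendsto_sandwich[OF _ _ tendsto_const])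
    show "\<forall>\<^sub>F n in sequentially. (LINT x|\<gamma>. norm (U n x)) \<le> 2 * (arccos (r (X n) / r a) * max_flux)"
      using ou_E_close[of "r (X n)" "r a" for n] r_pos r_le ra X a
      by (intro always_eventually allI) (auto simp: U_def less_imp_le)
    have q: "(\<lambda>n. r (X n) / r a) \<longlonglongrightarrow> 1"
      using tendsto_divide[OF r_lim tendsto_const[of "r a"]] r_pos[of a] a by simp
    have "(\<lambda>n. arccos (r (X n) / r a)) \<longlonglongrightarrow> arccos 1"
    proof (rule continuous_on_tendsto_compose[OF continuous_on_arccos' q])
      have "r (X n) / r a \<in> {-1..1}" for n
        using r_pos[of "X n"] r_le[of "X n"] r_pos[of a] X a by (auto simp: field_simps intro: order_trans[of _ 0])
      then show "\<forall>\<^sub>F n in sequentially. r (X n) / r a \<in> {-1..1}" by simp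
    qed simp
    then show "(\<lambda>n. 2 * (arccos (r (X n) / r a) * max_flux)) \<longlonglongrightarrow> 0"
      using tendsto_mult_left[OF tendsto_mult_right[of _ 0 _ max_flux], of _ sequentially 2] by simp
  qed simp
  have Ui: "integrable \<gamma> (U n)" for n
    unfolding U_def using bounded_integrable[OF ouE] by simp
  obtain k where k: "strict_mono k" and ae: "AE x in \<gamma>. (\<lambda>n. U (k n) x) \<longlonglongrightarrow> 0"
    using tendsto_L1_AE_subseq[OF Ui L1] by blast
  have Um: "U n \<in> borel_measurable borel" for n unfolding U_def using ouE(1) by (intro borel_measurable_diff)
  define N where "N = {x. \<not> (\<lambda>n. U (k n) x) \<longlonglongrightarrow> 0}"
  have N: "N \<in> sets borel"
  proof -
    have "{x \<in> space borel. (\<lambda>n. U (k n) x) \<longlonglongrightarrow> 0} \<in> sets borel"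
      using Um by measurable
    from sets.compl_sets[OF this] show ?thesis by (simp add: N_def Compl_eq_Diff_UNIV[symmetric] Collect_neg_eq[symmetric])
  qed
  have "prob N = 0" using ae N by (subst (asm) AE_iff_measurable[of N]) (auto simp: emeasure_eq_measure N_def)
  from mix_absolutely_continuous[OF _ _ N this, of "cos b" "sin b"] sb
  have ae2: "AE p in MG. (\<lambda>n. U (k n) (cos b *\<^sub>R fst p + sin b *\<^sub>R snd p)) \<longlonglongrightarrow> 0"
    by (simp add: N_def)
  define J where "J t = (LINT p|MG. W p * ou (r t) ?E (cos b *\<^sub>R fst p + sin b *\<^sub>R snd p))" for t
  have Jlim: "(\<lambda>n. J (X (k n))) \<longlonglongrightarrow> J a"
    unfolding J_def
  proof (rule integral_dominated_convergence[where w = "\<lambda>p. \<bar>W p\<bar>"])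
    show "AE p in MG. (\<lambda>n. W p * ou (r (X (k n))) ?E (cos b *\<^sub>R fst p + sin b *\<^sub>R snd p))
        \<longlonglongrightarrow> W p * ou (r a) ?E (cos b *\<^sub>R fst p + sin b *\<^sub>R snd p)"
      using ae2
    proof eventually_elim
      case (elim p)
      from tendsto_add[OF elim tendsto_const[of "ou (r a) ?E (cos b *\<^sub>R fst p + sin b *\<^sub>R snd p)"]]
      show ?case by (intro tendsto_mult tendsto_const) (simp add: U_def)
    qed
    show "AE p in MG. norm (W p * ou (r (X (k n))) ?E (cos b *\<^sub>R fst p + sin b *\<^sub>R snd p)) \<le> \<bar>W p\<bar>" for n
    proof (rule AE_I2)
      fix p
      show "norm (W p * ou (r (X (k n))) ?E (cos b *\<^sub>R fst p + sin b *\<^sub>R snd p)) \<le> \<bar>W p\<bar>"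
        using mult_left_mono[OF ouE(2)[of "r (X (k n))" "cos b *\<^sub>R fst p + sin b *\<^sub>R snd p"], of "\<bar>W p\<bar>"] by (simp add: abs_mult)
    qed
  qed (use W_integrable mix_compose_measurable[OF ouE(1)] in \<open>auto intro!: borel_measurable_times\<close>)
  have scal: "E_flux t = sin t * cos b / (cos t * sin b) * J t" if "a \<le> t" "t < pi / 2" for t
    using E_flux_scaling[OF b(1), of t] that b ct[OF that] sb by (simp add: J_def r_def field_simps)
  have Xk: "(\<lambda>n. X (k n)) \<longlonglongrightarrow> a" using LIMSEQ_subseq_LIMSEQ[OF X(3) k] by (simp add: comp_def)
  have "(\<lambda>n. sin (X (k n)) * cos b / (cos (X (k n)) * sin b) * J (X (k n))) \<longlonglongrightarrow> sin a * cos b / (cos a * sin b) * J a"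
    using ct[of a] a sb by (intro tendsto_intros Xk Jlim) auto
  then have "(\<lambda>n. E_flux (X (k n))) \<longlonglongrightarrow> E_flux a" using scal X a by simp
  with k show ?thesis by blast
qed

section \<open>Convexity and the limit of the flux\<close>

lemma E_flux_mean_value:
  assumes a: "0 \<le> a" "a < a'" and e: "e > 0"
  shows "\<exists>b. a < b \<and> b \<le> a' \<and> (overlap a - overlap a') / (a' - a) - e \<le> E_flux b"
proof (rule ccontr)
  define q where "q = (overlap a - overlap a') / (a' - a) - e"
  assume "\<not> ?thesis"
  then have less: "E_flux b \<le> q" if "a < b" "b \<le> a'" for b using that by (force simp: q_def)
  have il: "integrable lborel (\<lambda>b. q * indicat_real {a<..a'} b)"
    using a by (intro integrable_mult_right integrable_real_indicator) (auto simp: emeasure_lborel_Ioc)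
  have ie: "integrable lborel (\<lambda>b. indicat_real {a<..a'} b * E_flux b)"
  proof -
    have "(\<lambda>b. indicat_real {a<..a'} b * E_flux b) = (\<lambda>b. indicat_real {0..a'} b * E_flux b - indicat_real {0..a} b * E_flux b)"
      using a by (intro ext) (auto simp: indicator_def)
    then show ?thesis by (simp add: E_flux_integrable)
  qed
  have "overlap a - overlap a' = (LINT b|lborel. indicat_real {a<..a'} b * E_flux b)"
    using a by (intro overlap_diff) auto
  also have "\<dots> \<le> (LINT b|lborel. q * indicat_real {a<..a'} b)"
    using less by (intro integral_mono ie il) (auto simp: indicator_def)
  also have "\<dots> = q * (a' - a)" using a by simp
  also have "\<dots> = (overlap a - overlap a') / (a' - a) * (a' - a) - e * (a' - a)" by (simp add: q_def left_diff_distrib)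
  also have "\<dots> < overlap a - overlap a'" using a e by simp
  finally show False by simp
qed

text \<open>The change of variables between the angle and the time t = - ln (cos a), whose
  derivative in a is tan a.\<close>

lemma ln_cos_mean_value:
  fixes a a' :: real
  assumes "0 \<le> a" "a < a'" "a' < pi / 2"
  shows "\<exists>z. a < z \<and> z < a' \<and> ln (cos a) - ln (cos a') = (a' - a) * tan z"
proof -
  have "\<exists>z. a < z \<and> z < a' \<and> - ln (cos a') - - ln (cos a) = (a' - a) * tan z"
  proof (rule MVT2[OF assms(2)])
    fix x assume x: "a \<le> x" "x \<le> a'"
    then have "cos x > 0" using assms by (intro cos_gt_zero_pi) auto
    then show "((\<lambda>x. - ln (cos x)) has_real_derivative tan x) (at x)"
      by (auto intro!: derivative_eq_intros simp: tan_def)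
  qed
  then show ?thesis by simp
qed

text \<open>Convexity in t = - ln (cos a): the mean rate of decrease over [a, a'] is at most the
  rate at a, which is \<open>E_flux a / tan a\<close>. By midpoint convexity the mean rates
  \<open>Q n\<close> over repeatedly halved time increments increase, and right continuity of the
  flux bounds them by the rate at a.\<close>

lemma E_flux_lower:
  assumes a: "0 < a" "a < a'" "a' < pi / 2"
  shows "(overlap a - overlap a') / (ln (cos a) - ln (cos a')) * tan a \<le> E_flux a"
proof -
  define c d where "c = cos a" and "d = cos a' / cos a"
  have c: "0 < c" "c \<le> 1" and c': "0 < cos a'" using a by (auto simp: c_def intro!: cos_gt_zero)
  have "cos a' < cos a" using a by (intro cos_monotone_0_pi) auto
  then have d: "0 < d" "d < 1" using c c' by (auto simp: d_def c_def)
  define D where "D t = (LINT x|\<gamma>. indicat_real E x * ou t (indicat_real E) x)" for t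
  \<comment> \<open>Multiplying c by \<open>\<delta> n\<close> advances the time by - ln d / 2^n; n
    = 0 gives the full chord from a to a'.\<close>
  define \<delta> where "\<delta> n = d powr (1 / 2 ^ n)" for n :: nat
  have \<delta>: "0 < \<delta> n" "\<delta> n < 1" for n
    using d powr_less_mono2[of "1 / 2 ^ n" d 1] by (auto simp: \<delta>_def)
  have \<delta>_sq: "(\<delta> (Suc n))\<^sup>2 = \<delta> n" for n
    by (simp add: \<delta>_def power2_eq_square powr_add[symmetric])
  have \<delta>_ln: "- ln (\<delta> n) = - ln d / 2 ^ n" for n using d by (simp add: \<delta>_def ln_powr)
  define L where "L = - ln d"
  have L: "L > 0" using d by (simp add: L_def ln_less_zero)
  define Q where "Q n = (D c - D (c * \<delta> n)) / (- ln (\<delta> n))" for n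
  have Q_eq: "Q n = (D c - D (c * \<delta> n)) * 2 ^ n / L" for n
    unfolding Q_def \<delta>_ln L_def[symmetric] by simp
  have "Q n \<le> Q (Suc n)" for n
  proof -
    have "2 * D (c * \<delta> (Suc n)) \<le> D c + D (c * \<delta> n)"
      using ou_midpoint_convex[of c "\<delta> (Suc n)" "indicat_real E" 1] c \<delta>[of "Suc n"] E_borel_bounded
      unfolding D_def \<delta>_sq by (simp add: less_imp_le)
    then have "D c - D (c * \<delta> n) \<le> 2 * (D c - D (c * \<delta> (Suc n)))" by simp
    then have "(D c - D (c * \<delta> n)) * 2 ^ n \<le> 2 * (D c - D (c * \<delta> (Suc n))) * 2 ^ n"
      by (rule mult_right_mono) simp
    also have "\<dots> = (D c - D (c * \<delta> (Suc n))) * 2 ^ Suc n" by simp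
    finally show ?thesis unfolding Q_eq using L by (intro divide_right_mono) auto
  qed
  then have Q_mono: "Q 0 \<le> Q n" for n by (rule lift_Suc_mono_le) simp
  define A where "A n = arccos (c * \<delta> n)" for n
  have cd: "0 < c * \<delta> n" "c * \<delta> n < c" for n using c \<delta> by auto
  have cd1: "- 1 \<le> c * \<delta> n" "c * \<delta> n \<le> 1" for n using cd[of n] c by linarith+
  have cosA: "cos (A n) = c * \<delta> n" for n
    unfolding A_def using cd1[of n] by (rule cos_arccos)
  have A_bounds: "0 \<le> A n" "A n \<le> pi" for n
    unfolding A_def by (rule arccos_lbound[OF cd1] arccos_ubound[OF cd1])+
  have a_lt: "a < A n" for n
  proof -
    have "arccos c < arccos (c * \<delta> n)" by (rule arccos_less_arccos[OF cd1(1) cd(2) c(2)])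
    then show ?thesis using a by (simp add: A_def c_def arccos_cos)
  qed
  have A_lt: "A n < pi / 2" for n
  proof -
    have "arccos (c * \<delta> n) < arccos 0" using cd(1)[of n] cd1(2)[of n] by (intro arccos_less_arccos) auto
    then show ?thesis by (simp add: A_def)
  qed
  have A_lim: "A \<longlonglongrightarrow> a"
  proof -
    have "(\<lambda>n. (1 / 2 :: real) ^ n) \<longlonglongrightarrow> 0" by (rule LIMSEQ_realpow_zero) auto
    then have l: "(\<lambda>n. d powr ((1 / 2) ^ n)) \<longlonglongrightarrow> d powr 0" using d by (intro tendsto_intros) auto
    have \<delta>_eq: "\<delta> = (\<lambda>n. d powr ((1 / 2) ^ n))" by (simp add: \<delta>_def fun_eq_iff power_one_over)
    have "d powr 0 = 1" using d(1) by (simp only: powr_zero_eq_one less_imp_neq[OF d(1), symmetric] if_False)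
    with l have "\<delta> \<longlonglongrightarrow> 1" unfolding \<delta>_eq by (rule tendsto_eq_rhs)
    then have "(\<lambda>n. c * \<delta> n) \<longlonglongrightarrow> c * 1" by (intro tendsto_mult tendsto_const)
    then have "(\<lambda>n. c * \<delta> n) \<longlonglongrightarrow> c" by simp
    then have "(\<lambda>n. arccos (c * \<delta> n)) \<longlonglongrightarrow> arccos c"
    proof (intro continuous_on_tendsto_compose[OF continuous_on_arccos'])
      have "c * \<delta> n \<in> {-1..1}" for n using cd1[of n] by simp
      then show "\<forall>\<^sub>F n in sequentially. c * \<delta> n \<in> {-1..1}" by simp
    qed (use c in auto)
    moreover have "arccos c = a" using a by (simp add: c_def arccos_cos)
    ultimately show ?thesis by (simp add: A_def[abs_def])
  qed
  have oA: "overlap (A n) = D (c * \<delta> n)" for n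
    unfolding overlap_ou[OF A_bounds] cosA D_def ..
  have oa: "overlap a = D c" using overlap_ou[of a] a by (simp add: D_def c_def)
  have "\<forall>n. \<exists>z. a < z \<and> z < A n \<and> ln (cos a) - ln (cos (A n)) = (A n - a) * tan z"
    using ln_cos_mean_value[of a] a a_lt A_lt by auto
  then obtain z where z: "\<And>n. a < z n" "\<And>n. z n < A n" "\<And>n. ln (cos a) - ln (cos (A n)) = (A n - a) * tan (z n)" by metis
  have quot: "Q 0 * tan (z n) \<le> (overlap a - overlap (A n)) / (A n - a)" for n
  proof -
    have "- ln (\<delta> n) = (A n - a) * tan (z n)"
    proof -
      have "ln (c * \<delta> n) = ln c + ln (\<delta> n)" using c \<delta>[of n] by (simp add: ln_mult)
      with z(3)[of n] show ?thesis unfolding cosA c_def[symmetric] by linarith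
    qed
    moreover have "tan (z n) > 0" using z(1,2)[of n] a A_lt[of n] by (intro tan_gt_zero) auto
    ultimately have "Q n * tan (z n) = (overlap a - overlap (A n)) / (A n - a)"
      by (simp add: Q_def oA oa)
    moreover have "Q 0 * tan (z n) \<le> Q n * tan (z n)"
      using Q_mono \<open>tan (z n) > 0\<close> by (intro mult_right_mono) auto
    ultimately show ?thesis by simp
  qed
  \<comment> \<open>The overlap controls the flux only through integrals, so the mean rate is
    compared with the flux at some point of (a, A n], up to an error that vanishes in the
    limit.\<close>
  have "\<forall>n. \<exists>b. a < b \<and> b \<le> A n \<and> (overlap a - overlap (A n)) / (A n - a) - 1 / Suc n \<le> E_flux b"
    using E_flux_mean_value[of a] a a_lt by auto
  then obtain b where b: "\<And>n. a < b n" "\<And>n. b n \<le> A n"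
    "\<And>n. (overlap a - overlap (A n)) / (A n - a) - 1 / Suc n \<le> E_flux (b n)" by metis
  have b_lim: "b \<longlonglongrightarrow> a"
    by (rule tendsto_sandwich[OF always_eventually always_eventually tendsto_const A_lim])
      (use less_imp_le[OF b(1)] b(2) in blast)+
  have z_lim: "z \<longlonglongrightarrow> a"
    by (rule tendsto_sandwich[OF always_eventually always_eventually tendsto_const A_lim])
      (use less_imp_le[OF z(1)] less_imp_le[OF z(2)] in blast)+
  obtain k where k: "strict_mono k" "(\<lambda>n. E_flux (b (k n))) \<longlonglongrightarrow> E_flux a"
    using E_flux_right_continuous[OF a(1) _ less_imp_le[OF b(1)] le_less_trans[OF b(2) A_lt] b_lim] a by auto
  have lim: "(\<lambda>n. Q 0 * tan (z n) - 1 / real (Suc n)) \<longlonglongrightarrow> Q 0 * tan a - 0"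
  proof -
    have "cos a \<noteq> 0" using c by (simp add: c_def)
    then have "(\<lambda>n. tan (z n)) \<longlonglongrightarrow> tan a" by (intro isCont_tendsto_compose[OF _ z_lim] isCont_tan)
    moreover have "(\<lambda>n. 1 / real (Suc n)) \<longlonglongrightarrow> 0"
      using LIMSEQ_inverse_real_of_nat by (simp add: inverse_eq_divide)
    ultimately show ?thesis by (intro tendsto_diff tendsto_mult tendsto_const)
  qed
  have "Q 0 * tan a - 0 \<le> E_flux a"
  proof (rule LIMSEQ_le[OF LIMSEQ_subseq_LIMSEQ[OF lim k(1)] k(2)])
    have "Q 0 * tan (z n) - 1 / real (Suc n) \<le> E_flux (b n)" for n
      using quot[of n] b(3)[of n] by linarith
    then show "\<exists>N. \<forall>n\<ge>N. ((\<lambda>n. Q 0 * tan (z n) - 1 / real (Suc n)) \<circ> k) n \<le> E_flux (b (k n))" by simp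
  qed
  moreover have "Q 0 = (overlap a - overlap a') / (ln (cos a) - ln (cos a'))"
  proof -
    have \<delta>0: "\<delta> 0 = d" using d by (simp add: \<delta>_def)
    have "c * d = cos a'" using c by (simp add: d_def c_def)
    then have "A 0 = a'" using a by (simp add: A_def \<delta>0 arccos_cos)
    then have "D (c * \<delta> 0) = overlap a'" using oA[of 0] by simp
    moreover have "- ln (\<delta> 0) = ln (cos a) - ln (cos a')"
      unfolding \<delta>0 using c c' by (simp add: d_def c_def ln_div)
    ultimately show ?thesis by (simp add: Q_def oa)
  qed
  ultimately show ?thesis by simp
qed

lemma max_flux_nonneg: "0 \<le> max_flux"
  by (simp add: max_flux_def)

text \<open>Only the lower bound needs work. The loss of overlap is at most a max_flux at a and at
  least a' (max_flux - r) at a' = (1 + \<eta>) a, so its mean rate over [a, a'] is nearly max_flux;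
  \<open>E_flux_lower\<close> passes to the point a at the price of the factor tan a / tan
  a'.\<close>

lemma E_flux_tendsto: "(E_flux \<longlongrightarrow> max_flux) (at_right 0)"
proof (rule order_tendstoI)
  fix l assume "max_flux < l"
  then show "\<forall>\<^sub>F a in at_right 0. E_flux a < l"
    using E_flux_le by (intro always_eventually allI) (auto intro: le_less_trans)
next
  fix l assume "l < max_flux"
  define e where "e = max_flux - l"
  have e: "e > 0" using \<open>l < max_flux\<close> by (simp add: e_def)
  define k where "k = max_flux + 1"
  have k: "k > 0" using max_flux_nonneg by (simp add: k_def)
  \<comment> \<open>This keeps max_flux * \<eta>, a bound for the loss due to the ratio of tangents,
    at most e / 4; the shift by 1 in \<open>k\<close> avoids dividing by zero.\<close>
  define \<eta> where "\<eta> = e / (4 * k)"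
  have \<eta>: "\<eta> > 0" using e k by (simp add: \<eta>_def)
  \<comment> \<open>Chosen so that a' r = (e / 2) (a' - a): the error of the loss at a' costs e / 2
    in the mean rate over [a, a'].\<close>
  define r where "r = (e / 2) * \<eta> / (1 + \<eta>)"
  have r: "r > 0" using e \<eta> by (simp add: r_def)
  obtain \<kappa> where \<kappa>: "\<kappa> > 0" "\<And>a. 0 < a \<Longrightarrow> a < \<kappa> \<Longrightarrow> a * (max_flux - r) \<le> prob E - overlap a"
    using overlap_lower[OF r] by (auto simp: eventually_at_right_field)
  have "((\<lambda>a. max_flux * (tan a / tan ((1 + \<eta>) * a))) \<longlongrightarrow> max_flux * (1 / (1 + \<eta>))) (at_right 0)"
  proof (intro tendsto_mult tendsto_const)
    have t: "((\<lambda>a. tan (k * a) / a) \<longlongrightarrow> k) (at_right 0)" for k :: real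
    proof -
      have "((\<lambda>a. tan (k * a)) has_real_derivative k) (at 0)"
        by (auto intro!: derivative_eq_intros)
      then show ?thesis
        unfolding has_field_derivative_iff by (auto intro: tendsto_mono[OF at_le])
    qed
    have "((\<lambda>a. (tan (1 * a) / a) / (tan ((1 + \<eta>) * a) / a)) \<longlongrightarrow> 1 / (1 + \<eta>)) (at_right 0)"
      using \<eta> by (intro tendsto_divide t) auto
    then show "((\<lambda>a. tan a / tan ((1 + \<eta>) * a)) \<longlongrightarrow> 1 / (1 + \<eta>)) (at_right 0)"
    proof (rule Lim_transform_eventually)
      show "\<forall>\<^sub>F a in at_right 0. tan (1 * a) / a / (tan ((1 + \<eta>) * a) / a) = tan a / tan ((1 + \<eta>) * a)"
        using eventually_at_right_less[of "0 :: real"] by eventually_elim simp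
    qed
  qed
  moreover have "max_flux * (1 / (1 + \<eta>)) > max_flux - e / 2"
  proof -
    have "max_flux - max_flux * (1 / (1 + \<eta>)) = max_flux * \<eta> / (1 + \<eta>)" using \<eta> by (simp add: field_simps)
    also have "\<dots> \<le> max_flux * \<eta>" using divide_left_mono[of 1 "1 + \<eta>" "max_flux * \<eta>"] \<eta> max_flux_nonneg by simp
    also have "\<dots> \<le> k * \<eta>" using \<eta> by (intro mult_right_mono) (auto simp: k_def)
    also have "\<dots> = e / 4" using k by (simp add: \<eta>_def)
    finally show ?thesis using e by simp
  qed
  ultimately have "\<forall>\<^sub>F a in at_right 0. max_flux * (tan a / tan ((1 + \<eta>) * a)) > max_flux - e / 2"
    by (rule order_tendstoD(1))
  moreover have "\<forall>\<^sub>F a in at_right 0. (1 + \<eta>) * a < min \<kappa> (pi / 2)"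
  proof -
    have "((\<lambda>a. (1 + \<eta>) * a) \<longlongrightarrow> (1 + \<eta>) * 0) (at_right 0)" by (intro tendsto_intros)
    then show ?thesis using \<kappa>(1) by (intro order_tendstoD(2)) auto
  qed
  ultimately show "\<forall>\<^sub>F a in at_right 0. l < E_flux a"
    using eventually_at_right_less[of "0 :: real"]
  proof eventually_elim
    case (elim a)
    define a' where "a' = (1 + \<eta>) * a"
    have a: "0 < a" "a < a'" "a' < pi / 2" "a' < \<kappa>" using elim \<eta> by (auto simp: a'_def algebra_simps)
    have aa: "a' - a = \<eta> * a" by (simp add: a'_def algebra_simps)
    have "(max_flux - e / 2) * (a' - a) = (a' - a) * max_flux - a' * r"
    proof -
      have "a' * r = a * ((1 + \<eta>) * r)" by (simp add: a'_def mult_ac)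
      also have "(1 + \<eta>) * r = (e / 2) * \<eta>"
      proof -
        have "1 + \<eta> \<noteq> 0" using \<eta> by simp
        then show ?thesis by (simp only: r_def times_divide_eq_right nonzero_mult_div_cancel_left not_False_eq_True)
      qed
      finally show ?thesis by (simp add: aa algebra_simps)
    qed
    also have "\<dots> \<le> overlap a - overlap a'"
      using overlap_upper[of a] \<kappa>(2)[of a'] a by (simp add: algebra_simps)
    finally have num: "(max_flux - e / 2) * (a' - a) \<le> overlap a - overlap a'" .
    obtain z where z: "a < z" "z < a'" "ln (cos a) - ln (cos a') = (a' - a) * tan z"
      using ln_cos_mean_value[of a a'] a by auto
    have tz: "tan z > 0" "tan a > 0" using z a by (auto intro!: tan_gt_zero)
    have t1: "tan a / tan z \<le> 1" using z a tz by (simp add: tan_mono_lt_eq less_imp_le)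
    have "tan z \<le> tan a'" using z a by (simp add: tan_mono_le_eq less_imp_le)
    then have t2: "tan a / tan a' \<le> tan a / tan z" using tz by (intro divide_left_mono) auto
    have "max_flux * (tan a / tan a') - e / 2 \<le> max_flux * (tan a / tan z) - e / 2 * (tan a / tan z)"
      using t1 t2 max_flux_nonneg e mult_left_mono[of "tan a / tan z" 1 "e / 2"] by (intro diff_mono mult_left_mono) auto
    also have "\<dots> = (max_flux - e / 2) * (a' - a) / ((a' - a) * tan z) * tan a"
    proof -
      have "(max_flux - e / 2) * (a' - a) / ((a' - a) * tan z) = (max_flux - e / 2) / tan z" using a by simp
      then show ?thesis by (simp add: left_diff_distrib diff_divide_distrib)
    qed
    also have "\<dots> \<le> (overlap a - overlap a') / ((a' - a) * tan z) * tan a"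
      using num a tz by (intro mult_right_mono divide_right_mono) auto
    also have "\<dots> \<le> E_flux a" using E_flux_lower[OF a(1-3)] unfolding z(3) .
    finally have "max_flux * (tan a / tan a') - e / 2 \<le> E_flux a" .
    moreover have "max_flux - e / 2 - e / 2 < max_flux * (tan a / tan a') - e / 2"
      using elim(1) unfolding a'_def by (rule diff_strict_right_mono)
    moreover have "l = max_flux - e / 2 - e / 2" by (simp add: e_def field_simps)
    ultimately show ?case by simp
  qed
qed

lemma W_nonzero: "AE p in MG. W p \<noteq> 0"
proof (rule MG.AE_pair_measure)
  show "{p \<in> space MG. W p \<noteq> 0} \<in> sets MG" using W_measurable by simp
  show "AE x in M. AE y in \<gamma>. W (x, y) \<noteq> 0"
    using W_norm by eventually_elim (rule closure_nonzero[OF W_closure])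
qed

text \<open>The defect of the flux controls V only with the weight |W|. Where |W| \<ge> r, division
  by r suffices; the set |W| < r has small measure, uniformly in a, because W vanishes almost
  nowhere.\<close>

theorem blowup_tendsto:
  "((\<lambda>a. LINT p|MG. \<bar>indicat_real E (cos a *\<^sub>R fst p + sin a *\<^sub>R snd p) - indicat_real {p. W p > 0} p\<bar>) \<longlongrightarrow> 0) (at_right 0)"
proof -
  define V where "V a p = \<bar>indicat_real E (cos a *\<^sub>R fst p + sin a *\<^sub>R snd p) - indicat_real {p. W p > 0} p\<bar>" for a p
  have Vm: "V a \<in> borel_measurable borel" for a
    unfolding V_def using mix_compose_measurable[OF E_borel_bounded(1), of "cos a" "sin a"]
    by measurable
  have V1: "0 \<le> V a p" "V a p \<le> 1" for a p by (auto simp: V_def indicator_def)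
  have Vi: "integrable MG (V a)" for a
    using Vm V1 by (intro fMG.integrable_const_bound[of _ 1]) auto
  \<comment> \<open>Pointwise, the positive part of W minus \<chi> W equals W on the part of the
    half-space missed by the rotated set and - W on the part where the rotated set exceeds
    it.\<close>
  have excess: "(LINT p|MG. V a p * \<bar>W p\<bar>) = max_flux - E_flux a" for a
  proof -
    have "(LINT p|MG. V a p * \<bar>W p\<bar>) = (LINT p|MG. max 0 (W p) - indicat_real E (fst (rot (cos a) (sin a) p)) * W p)"
      by (intro Bochner_Integration.integral_cong) (auto simp: V_def rot_def indicator_def)
    also have "\<dots> = max_flux - E_flux a"
      using W_integrable flux_integrable_integrand[OF E_indicator, of a]
      by (simp add: max_flux_def E_flux_def flux_def)
    finally show ?thesis .
  qed
  have VWi: "integrable MG (\<lambda>p. V a p * \<bar>W p\<bar>)" for a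
    using integrable_mult_bounded[OF integrable_abs[OF W_integrable], of "V a" 1] Vm V1 by (simp add: mult.commute)
  have Sm: "{p. \<bar>W p\<bar> < r} \<in> sets borel" for r by measurable
  have small: "(\<lambda>n. measure MG {p. \<bar>W p\<bar> < 1 / real (Suc n)}) \<longlonglongrightarrow> 0"
  proof -
    have "(\<lambda>n. measure MG {p. \<bar>W p\<bar> < 1 / real (Suc n)}) \<longlonglongrightarrow> measure MG (\<Inter>n. {p. \<bar>W p\<bar> < 1 / real (Suc n)})"
    proof (rule fMG.finite_Lim_measure_decseq)
      show "range (\<lambda>n. {p. \<bar>W p\<bar> < 1 / real (Suc n)}) \<subseteq> sets MG" using Sm by auto
      show "decseq (\<lambda>n. {p. \<bar>W p\<bar> < 1 / real (Suc n)})"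
        unfolding decseq_def by (auto intro: less_le_trans simp: frac_le)
    qed
    also have "(\<Inter>n. {p. \<bar>W p\<bar> < 1 / real (Suc n)}) = {p. W p = 0}"
    proof safe
      fix x y assume *: "(x, y) \<in> (\<Inter>n. {p. \<bar>W p\<bar> < 1 / real (Suc n)})"
      show "W (x, y) = 0"
      proof (rule ccontr)
        assume "W (x, y) \<noteq> 0"
        then obtain n where "1 / real (Suc n) < \<bar>W (x, y)\<bar>" using nat_approx_posE[of "\<bar>W (x, y)\<bar>"] by auto
        moreover have "\<bar>W (x, y)\<bar> < 1 / real (Suc n)" using * by blast
        ultimately show False by simp
      qed
    qed auto
    also have "measure MG {p. W p = 0} = 0"
      using W_nonzero by (subst (asm) AE_iff_measurable[of "{p. W p = 0}"]) (auto simp: measure_def)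
    finally show ?thesis .
  qed
  have bound: "(LINT p|MG. V a p) \<le> measure MG {p. \<bar>W p\<bar> < r} + (max_flux - E_flux a) / r" if r: "r > 0" for a r
  proof -
    have "(LINT p|MG. V a p) \<le> (LINT p|MG. indicat_real {p. \<bar>W p\<bar> < r} p + (1 / r) * (V a p * \<bar>W p\<bar>))"
    proof (rule integral_mono[OF Vi])
      show "integrable MG (\<lambda>p. indicat_real {p. \<bar>W p\<bar> < r} p + (1 / r) * (V a p * \<bar>W p\<bar>))"
        using VWi Sm by (intro Bochner_Integration.integrable_add integrable_mult_right integrable_real_indicator)
          (auto simp: fMG.emeasure_eq_measure)
      fix p
      show "V a p \<le> indicat_real {p. \<bar>W p\<bar> < r} p + (1 / r) * (V a p * \<bar>W p\<bar>)"
      proof (cases "\<bar>W p\<bar> < r")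
        case True
        then show ?thesis using V1[of a p] r by (simp add: add_increasing2)
      next
        case False
        then have "V a p * r \<le> V a p * \<bar>W p\<bar>" using V1 by (intro mult_left_mono) auto
        then show ?thesis using False r by (simp add: field_simps)
      qed
    qed
    also have "\<dots> = measure MG {p. \<bar>W p\<bar> < r} + (max_flux - E_flux a) / r"
      using VWi Sm excess by (subst Bochner_Integration.integral_add)
        (auto intro!: integrable_real_indicator simp: fMG.emeasure_eq_measure)
    finally show ?thesis .
  qed
  have "((\<lambda>a. LINT p|MG. V a p) \<longlongrightarrow> 0) (at_right 0)"
  proof (rule order_tendstoI)
    fix l :: real assume "l < 0"
    moreover have "0 \<le> (LINT p|MG. V a p)" for a using V1 by simp
    ultimately show "\<forall>\<^sub>F a in at_right 0. l < (LINT p|MG. V a p)"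
      by (intro always_eventually allI) (rule less_le_trans)
  next
    fix l :: real assume l: "0 < l"
    then obtain n where n: "measure MG {p. \<bar>W p\<bar> < 1 / real (Suc n)} < l / 2"
      using order_tendstoD(2)[OF small, of "l / 2"] by (auto simp: eventually_sequentially)
    have "((\<lambda>a. (max_flux - E_flux a) / (1 / real (Suc n))) \<longlongrightarrow> (max_flux - max_flux) / (1 / real (Suc n))) (at_right 0)"
      by (intro tendsto_intros E_flux_tendsto) auto
    then have "\<forall>\<^sub>F a in at_right 0. (max_flux - E_flux a) / (1 / real (Suc n)) < l / 2"
      using l by (intro order_tendstoD(2)) auto
    then show "\<forall>\<^sub>F a in at_right 0. (LINT p|MG. V a p) < l"
    proof eventually_elim
      case (elim a)
      then show ?case using bound[of "1 / real (Suc n)" a] n by simp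
    qed
  qed
  then show ?thesis by (simp add: V_def)
qed

end

section \<open>Perimeter measures\<close>

text \<open>The supremum over the Borel subsets of A is attained at the part of A where w > 0, a
  Hahn decomposition read off the density. The right side is the density of the positive part since
  \<open>ennreal\<close> truncates.\<close>

lemma signed_pos_density:
  fixes M :: "'a::topological_space measure" and w :: "'a \<Rightarrow> real"
  assumes sets: "sets M = sets borel" and w: "integrable M w"
    and \<mu>: "\<And>B. B \<in> sets borel \<Longrightarrow> \<mu> B = (LINT x:B|M. w x)"
  shows "signed_pos \<mu> = density M (\<lambda>x. ennreal (w x))"
proof -
  have sp: "space M = UNIV" using sets_eq_imp_space_eq[OF sets] by simp
  have wm: "w \<in> borel_measurable M" using w by simp
  let ?d = "density M (\<lambda>x. ennreal (w x))"
  have wp: "integrable M (\<lambda>x. max 0 (w x))" using w by simp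
  have em: "emeasure ?d A = ennreal (LINT x|M. indicat_real A x * max 0 (w x))" if "A \<in> sets borel" for A
  proof -
    have A: "A \<in> sets M" using that by (simp add: sets)
    have "emeasure ?d A = (\<integral>\<^sup>+x. ennreal (w x) * indicator A x \<partial>M)"
      using wm A by (intro emeasure_density) auto
    also have "\<dots> = (\<integral>\<^sup>+x. ennreal (indicat_real A x * max 0 (w x)) \<partial>M)"
      by (intro nn_integral_cong) (auto simp: indicator_def)
    also have "\<dots> = ennreal (LINT x|M. indicat_real A x * max 0 (w x))"
      using integrable_mult_indicator[OF A wp] by (intro nn_integral_eq_integral) auto
    finally show ?thesis .
  qed
  have sup: "(\<Squnion>B\<in>{B \<in> sets borel. B \<subseteq> A}. ennreal (\<mu> B)) = emeasure ?d A" if A: "A \<in> sets borel" for A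
  proof (rule antisym)
    show "(\<Squnion>B\<in>{B \<in> sets borel. B \<subseteq> A}. ennreal (\<mu> B)) \<le> emeasure ?d A"
    proof (rule SUP_least)
      fix B assume B: "B \<in> {B \<in> sets borel. B \<subseteq> A}"
      then have Bs: "B \<in> sets M" by (simp add: sets)
      have "\<mu> B = (LINT x|M. indicat_real B x * w x)" using B by (simp add: \<mu> set_lebesgue_integral_def)
      also have "\<dots> \<le> (LINT x|M. indicat_real A x * max 0 (w x))"
        using integrable_mult_indicator[OF Bs w] integrable_mult_indicator[OF _ wp, of A] A B
        by (intro integral_mono) (auto simp: indicator_def sets)
      finally show "ennreal (\<mu> B) \<le> emeasure ?d A"
        unfolding em[OF A] by (rule ennreal_leI)
    qed
    define B where "B = A \<inter> {x. w x > 0}"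
    have "{x \<in> space M. w x > 0} \<in> sets M" using wm by measurable
    then have B: "B \<in> sets borel" using A by (auto simp: B_def sp sets)
    have "emeasure ?d A = ennreal (LINT x|M. indicat_real A x * max 0 (w x))" by (rule em[OF A])
    also have "(LINT x|M. indicat_real A x * max 0 (w x)) = (LINT x|M. indicat_real B x * w x)"
      by (intro Bochner_Integration.integral_cong) (auto simp: B_def indicator_def)
    also have "\<dots> = \<mu> B" using B by (simp add: \<mu> set_lebesgue_integral_def)
    finally show "emeasure ?d A \<le> (\<Squnion>B\<in>{B \<in> sets borel. B \<subseteq> A}. ennreal (\<mu> B))"
      using B by (auto simp: B_def intro: SUP_upper)
  qed
  have "signed_pos \<mu> = measure_of UNIV (sets borel) (emeasure ?d)"
    unfolding signed_pos_def
    by (rule measure_of_eq) (auto simp: sup sets.sigma_sets_eq[of borel, simplified])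
  also have "\<dots> = ?d"
    using measure_of_of_measure[of ?d] by (simp add: sp sets)
  finally show ?thesis .
qed

lemma signed_integral_density:
  fixes M :: "'a::topological_space measure" and w \<phi> :: "'a \<Rightarrow> real"
  assumes sets: "sets M = sets borel" and w: "integrable M w"
    and \<mu>: "\<And>B. B \<in> sets borel \<Longrightarrow> \<mu> B = (LINT x:B|M. w x)"
    and \<phi>: "\<phi> \<in> borel_measurable borel" "\<And>x. \<bar>\<phi> x\<bar> \<le> K"
  shows "signed_integral \<mu> \<phi> = (LINT x|M. \<phi> x * w x)"
proof -
  have \<phi>m: "\<phi> \<in> borel_measurable M" using \<phi>(1) by (simp add: measurable_cong_sets[OF sets refl])
  have wm: "w \<in> borel_measurable M" using w by simp
  have mx: "ennreal a = ennreal (max 0 a)" for a :: real by (simp add: max_def ennreal_neg)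
  have p: "signed_pos \<mu> = density M (\<lambda>x. ennreal (max 0 (w x)))"
    by (subst mx[symmetric]) (rule signed_pos_density[OF sets w \<mu>])
  have n: "signed_pos (\<lambda>B. - \<mu> B) = density M (\<lambda>x. ennreal (max 0 (- w x)))"
    using w by (subst mx[symmetric], intro signed_pos_density[OF sets]) (auto simp: \<mu> set_lebesgue_integral_def)
  have id: "(LINT x|density M (\<lambda>x. ennreal (max 0 (v x))). \<phi> x) = (LINT x|M. max 0 (v x) * \<phi> x)"
    if "v \<in> borel_measurable M" for v
    using that \<phi>m by (subst integral_density) auto
  have i: "integrable M (\<lambda>x. max 0 (w x) * \<phi> x)" "integrable M (\<lambda>x. max 0 (- w x) * \<phi> x)"
    using w \<phi>m \<phi>(2) by (auto intro!: integrable_mult_bounded[where C = K])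
  have "signed_integral \<mu> \<phi> = (LINT x|M. max 0 (w x) * \<phi> x) - (LINT x|M. max 0 (- w x) * \<phi> x)"
    unfolding signed_integral_def p n using wm by (subst (1 2) id) auto
  also have "\<dots> = (LINT x|M. max 0 (w x) * \<phi> x - max 0 (- w x) * \<phi> x)" using i by simp
  also have "\<dots> = (LINT x|M. \<phi> x * w x)"
    by (intro Bochner_Integration.integral_cong) (auto simp: max_def)
  finally show ?thesis .
qed

lemma sin_C1b:
  fixes f :: "'a::real_normed_vector \<Rightarrow>\<^sub>L real" and \<theta> :: real
  shows "(\<lambda>x. sin (f x + \<theta>)) \<in> C1b"
proof -
  have "cylindrical (\<lambda>x. sin (f x + \<theta>))"
    unfolding cylindrical_def by (intro exI[of _ "{f}"]) auto
  moreover have "bounded (range (\<lambda>x. sin (f x + \<theta>)))"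
    by (rule boundedI[of _ 1]) auto
  moreover have "((\<lambda>x. sin (f x + \<theta>)) has_derivative blinfun_apply (cos (f x + \<theta>) *\<^sub>R f)) (at x)" for x
    by (auto intro!: derivative_eq_intros simp: blinfun.scaleR_left)
  moreover have "continuous_on UNIV (\<lambda>x. cos (f x + \<theta>) *\<^sub>R f)" by (intro continuous_intros)
  moreover have "bounded (range (\<lambda>x. cos (f x + \<theta>) *\<^sub>R f))"
    by (rule boundedI[of _ "norm f"]) (auto intro!: mult_left_le_one_le)
  ultimately show ?thesis unfolding C1b_def by (auto intro!: exI[of _ "\<lambda>x. cos (f x + \<theta>) *\<^sub>R f"])
qed

lemma dir_deriv_sin:
  fixes f :: "'a::real_normed_vector \<Rightarrow>\<^sub>L real" and \<theta> :: real
  shows "dir_deriv h (\<lambda>x. sin (f x + \<theta>)) x = f h * cos (f x + \<theta>)"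
proof -
  have "((\<lambda>s. sin (f x + s * f h + \<theta>)) has_real_derivative f h * cos (f x + \<theta>)) (at 0)"
    by (auto intro!: derivative_eq_intros)
  then show ?thesis
    unfolding dir_deriv_def by (intro DERIV_imp_deriv) (simp add: blinfun.add_right blinfun.scaleR_right)
qed

section \<open>Cameron-Martin norm and measurable representatives\<close>

context centered_gaussian
begin

lemma L2_dual_closure_cong:
  assumes g: "g \<in> L2_dual_closure \<gamma>" and k: "k \<in> borel_measurable borel" and ae: "AE x in \<gamma>. k x = g x"
  shows "k \<in> L2_dual_closure \<gamma>"
proof -
  note L = L2_dual_closureD(1)[OF g]
  have "integrable \<gamma> (\<lambda>x. (k x)\<^sup>2)"
    using L2_power2[OF L] ae k L2_measurable[OF L] by (subst integrable_cong_AE[of _ _ "\<lambda>x. (g x)\<^sup>2"]) auto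
  then have kL: "k \<in> L2 \<gamma>" using k by (simp add: L2_iff)
  obtain f :: "nat \<Rightarrow> 'a \<Rightarrow>\<^sub>L real" where f: "(\<lambda>n. LINT x|\<gamma>. (g x - blinfun_apply (f n) x)\<^sup>2) \<longlonglongrightarrow> 0"
    using L2_dual_closureD(2)[OF g] by blast
  have "(LINT x|\<gamma>. (k x - blinfun_apply (f n) x)\<^sup>2) = (LINT x|\<gamma>. (g x - blinfun_apply (f n) x)\<^sup>2)" for n
    using ae k L2_measurable[OF L] by (intro integral_cong_AE) auto
  with f show ?thesis by (intro L2_dual_closureI[OF kL, of f]) simp
qed

lemma CM_hat:
  assumes "h \<in> CM \<gamma>"
  shows "hat \<gamma> h \<in> L2_dual_closure \<gamma>" "hat \<gamma> h \<in> L2 \<gamma>" "h = (LINT x|\<gamma>. hat \<gamma> h x *\<^sub>R x)"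
  using CM_representative[OF assms] L2_dual_closureD(1) by auto

text \<open>\<open>hat\<close> is a choice and hence additive only up to null sets, which the
  integral does not see.\<close>

lemma cm_norm_diff:
  assumes h: "h \<in> CM \<gamma>" and k: "k \<in> CM \<gamma>"
  shows "cm_norm \<gamma> (h - k) = L2norm (\<lambda>x. hat \<gamma> h x - hat \<gamma> k x)"
proof -
  have c: "(\<lambda>x. hat \<gamma> h x - hat \<gamma> k x) \<in> L2_dual_closure \<gamma>"
    by (rule L2_dual_closure_diff[OF CM_hat(1)[OF h] CM_hat(1)[OF k]])
  have "(LINT x|\<gamma>. (hat \<gamma> h x - hat \<gamma> k x) *\<^sub>R x) = (LINT x|\<gamma>. hat \<gamma> h x *\<^sub>R x) - (LINT x|\<gamma>. hat \<gamma> k x *\<^sub>R x)"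
    using L2_scaleR_id[OF CM_hat(2)[OF h]] L2_scaleR_id[OF CM_hat(2)[OF k]] by (simp add: scaleR_diff_left)
  then have e: "h - k = (LINT x|\<gamma>. (hat \<gamma> h x - hat \<gamma> k x) *\<^sub>R x)"
    using CM_hat(3)[OF h] CM_hat(3)[OF k] by simp
  have d: "h - k \<in> CM \<gamma>" unfolding e by (rule barycentre_in_CM[OF L2_dual_closureD(1)[OF c]])
  have "AE x in \<gamma>. hat \<gamma> (h - k) x = hat \<gamma> h x - hat \<gamma> k x"
    using hat_barycentre[OF c] unfolding e[symmetric] .
  then have "(LINT x|\<gamma>. (hat \<gamma> (h - k) x)\<^sup>2) = (LINT x|\<gamma>. (hat \<gamma> h x - hat \<gamma> k x)\<^sup>2)"
    using L2_measurable[OF CM_hat(2)[OF d]] L2_measurable[OF L2_dual_closureD(1)[OF c]]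
    by (intro integral_cong_AE) auto
  then show ?thesis by (simp add: cm_norm_def L2norm_def)
qed

lemma cm_norm_triangle:
  assumes "h \<in> CM \<gamma>" "k \<in> CM \<gamma>" "l \<in> CM \<gamma>"
  shows "cm_norm \<gamma> (h - l) \<le> cm_norm \<gamma> (h - k) + cm_norm \<gamma> (k - l)"
  using L2norm_triangle[OF L2_diff[OF CM_hat(2)[OF assms(1)] CM_hat(2)[OF assms(2)]]
      L2_diff[OF CM_hat(2)[OF assms(2)] CM_hat(2)[OF assms(3)]]]
  by (simp add: cm_norm_diff assms)

lemma cm_shift_CM: "cm_shift f \<in> CM \<gamma>"
  unfolding cm_shift_def by (rule barycentre_in_CM) simp

lemma hat_cm_shift: "AE x in \<gamma>. hat \<gamma> (cm_shift f) x = blinfun_apply f x"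
  unfolding cm_shift_def by (rule hat_barycentre) simp

lemma cm_norm_diff_shift:
  assumes h: "h \<in> CM \<gamma>"
  shows "cm_norm \<gamma> (h - cm_shift f) = L2norm (\<lambda>x. hat \<gamma> h x - f x)"
proof -
  have "(LINT x|\<gamma>. (hat \<gamma> h x - hat \<gamma> (cm_shift f) x)\<^sup>2) = (LINT x|\<gamma>. (hat \<gamma> h x - f x)\<^sup>2)"
    using hat_cm_shift[of f] L2_measurable[OF CM_hat(2)[OF h]] L2_measurable[OF CM_hat(2)[OF cm_shift_CM]]
    by (intro integral_cong_AE) auto
  then show ?thesis by (simp add: cm_norm_diff[OF h cm_shift_CM] L2norm_def)
qed

lemma space_cm_borel: "space (cm_borel \<gamma>) = CM \<gamma>"
  unfolding cm_borel_def by (rule space_measure_of) auto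

lemma cm_ball_measurable:
  assumes k: "k \<in> CM \<gamma>"
  shows "{h \<in> CM \<gamma>. cm_norm \<gamma> (h - k) < r} \<in> sets (cm_borel \<gamma>)"
proof -
  let ?U = "{h \<in> CM \<gamma>. cm_norm \<gamma> (h - k) < r}"
  have "\<forall>h\<in>?U. \<exists>s>0. \<forall>l\<in>CM \<gamma>. cm_norm \<gamma> (l - h) < s \<longrightarrow> l \<in> ?U"
  proof
    fix h assume h: "h \<in> ?U"
    show "\<exists>s>0. \<forall>l\<in>CM \<gamma>. cm_norm \<gamma> (l - h) < s \<longrightarrow> l \<in> ?U"
    proof (intro exI[of _ "r - cm_norm \<gamma> (h - k)"] conjI ballI impI)
      fix l assume l: "l \<in> CM \<gamma>" "cm_norm \<gamma> (l - h) < r - cm_norm \<gamma> (h - k)"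
      then show "l \<in> ?U" using cm_norm_triangle[of l h k] h k by auto
    qed (use h in auto)
  qed
  then show ?thesis unfolding cm_borel_def by (subst sets_measure_of) (auto intro!: sigma_sets.Basic)
qed

text \<open>The choice made by \<^const>\<open>hat\<close> need not be measurable in \<open>x\<close>, so \<open>hat \<gamma> (\<nu> x)\<close> is approximated by members of a countable
  dense family of functionals, selected measurably.\<close>

lemma measurable_representative:
  assumes \<nu>: "\<nu> \<in> measurable borel (cm_borel \<gamma>)"
  obtains W :: "'a \<times> 'a \<Rightarrow> real"
  where "W \<in> borel_measurable borel" "\<And>x. AE y in \<gamma>. W (x, y) = hat \<gamma> (\<nu> x) y"
proof -
  have \<nu>CM: "\<nu> x \<in> CM \<gamma>" for x using measurable_space[OF \<nu>, of x] by (simp add: space_cm_borel)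
  obtain e :: "nat \<Rightarrow> 'a \<Rightarrow>\<^sub>L real"
    where e: "\<And>g r. g \<in> L2_dual_closure \<gamma> \<Longrightarrow> r > 0 \<Longrightarrow> \<exists>j. L2norm (\<lambda>x. g x - e j x) < r"
    using dual_separable by blast
  \<comment> \<open>The rate 2^-n makes the squared errors summable, so that for each x the full
    sequence of approximants converges for almost every y.\<close>
  define P where "P n j x \<longleftrightarrow> cm_norm \<gamma> (\<nu> x - cm_shift (e j)) < (1 / 2) ^ n" for n j x
  have P_meas: "Measurable.pred borel (P n j)" for n j
  proof -
    have "\<nu> -` {h \<in> CM \<gamma>. cm_norm \<gamma> (h - cm_shift (e j)) < (1 / 2) ^ n} \<inter> space borel \<in> sets borel"
      by (rule measurable_sets[OF \<nu> cm_ball_measurable[OF cm_shift_CM]])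
    then show ?thesis by (simp add: P_def[abs_def] pred_def vimage_def \<nu>CM)
  qed
  \<comment> \<open>Taking the least index makes the selection measurable in x, as each P n i is a
    Borel predicate.\<close>
  define j where "j n x = (LEAST i. P n i x)" for n x
  have P_ex: "\<exists>i. P n i x" for n x
    using e[OF CM_hat(1)[OF \<nu>CM], of "(1 / 2) ^ n" x] by (simp add: P_def cm_norm_diff_shift[OF \<nu>CM])
  have P_j: "P n (j n x) x" for n x unfolding j_def using P_ex by (rule LeastI_ex)
  have j_meas: "j n \<in> measurable borel (count_space UNIV)" for n
    unfolding j_def[abs_def] using P_meas by (intro measurable_Least) auto
  define w where "w n p = e (j n (fst p)) (snd p)" for n and p :: "'a \<times> 'a"
  have w_meas: "w n \<in> borel_measurable borel" for n
    unfolding w_def[abs_def]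
  proof (rule measurable_compose_countable[where f = "\<lambda>i p. e i (snd p)"])
    show "(\<lambda>p :: 'a \<times> 'a. e i (snd p)) \<in> borel_measurable borel" for i
      by (rule measurable_compose[OF snd_borel_measurable blinfun_measurable])
    show "(\<lambda>p :: 'a \<times> 'a. j n (fst p)) \<in> measurable borel (count_space UNIV)"
      by (rule measurable_compose[OF fst_borel_measurable j_meas])
  qed
  define W where "W p = lim (\<lambda>n. w n p)" for p
  have W_meas: "W \<in> borel_measurable borel"
    unfolding W_def[abs_def] using w_meas by (intro borel_measurable_lim_metric)
  have "AE y in \<gamma>. W (x, y) = hat \<gamma> (\<nu> x) y" for x
  proof -
    let ?g = "hat \<gamma> (\<nu> x)"
    note L = CM_hat(2)[OF \<nu>CM[of x]]
    have gm: "?g \<in> borel_measurable borel" using L by (rule L2_measurable)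
    have d: "(LINT y|\<gamma>. (?g y - w n (x, y))\<^sup>2) \<le> (1 / 4) ^ n" for n
    proof -
      have "L2norm (\<lambda>y. ?g y - w n (x, y)) \<le> (1 / 2) ^ n"
        using P_j[of n x] by (simp add: P_def cm_norm_diff_shift[OF \<nu>CM] w_def)
      then have "(L2norm (\<lambda>y. ?g y - w n (x, y)))\<^sup>2 \<le> ((1 / 2) ^ n)\<^sup>2" by (intro power_mono L2norm_nonneg)
      also have "\<dots> = (1 / 4) ^ n" by (simp add: power2_eq_square power_mult_distrib[symmetric])
      finally show ?thesis by (simp add: L2norm_power2)
    qed
    have m: "(\<lambda>y. (?g y - w n (x, y))\<^sup>2) \<in> borel_measurable borel" for n
      using gm by (simp add: w_def borel_measurable_diff borel_measurable_power)
    have "(\<integral>\<^sup>+y. (\<Sum>n. ennreal ((?g y - w n (x, y))\<^sup>2)) \<partial>\<gamma>) = (\<Sum>n. \<integral>\<^sup>+y. ennreal ((?g y - w n (x, y))\<^sup>2) \<partial>\<gamma>)"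
      using m by (intro nn_integral_suminf) simp
    also have "\<dots> \<le> (\<Sum>n. ennreal ((1 / 4) ^ n))"
    proof (intro suminf_le)
      fix n
      have "integrable \<gamma> (\<lambda>y. (?g y - w n (x, y))\<^sup>2)"
        using L2_power2[OF L2_diff[OF L L2_blinfun[of "e (j n x)"]]] by (simp add: w_def)
      then have "(\<integral>\<^sup>+y. ennreal ((?g y - w n (x, y))\<^sup>2) \<partial>\<gamma>) = ennreal (LINT y|\<gamma>. (?g y - w n (x, y))\<^sup>2)"
        by (rule nn_integral_eq_integral) simp
      then show "(\<integral>\<^sup>+y. ennreal ((?g y - w n (x, y))\<^sup>2) \<partial>\<gamma>) \<le> ennreal ((1 / 4) ^ n)"
        using d[of n] by (simp add: ennreal_leI)
    qed auto
    also have "\<dots> < \<infinity>"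
      using summable_geometric[of "1 / 4 :: real"] by (subst suminf_ennreal2) auto
    finally have "AE y in \<gamma>. (\<Sum>n. ennreal ((?g y - w n (x, y))\<^sup>2)) \<noteq> \<infinity>"
      using m by (intro nn_integral_PInf_AE) auto
    then show ?thesis
    proof eventually_elim
      case (elim y)
      then have "summable (\<lambda>n. (?g y - w n (x, y))\<^sup>2)"
        by (intro summable_suminf_not_top) (auto simp: top_ennreal_def[symmetric] infinity_ennreal_def)
      then have "(\<lambda>n. (?g y - w n (x, y))\<^sup>2) \<longlonglongrightarrow> 0" by (rule summable_LIMSEQ_zero)
      then have "(\<lambda>n. sqrt ((?g y - w n (x, y))\<^sup>2)) \<longlonglongrightarrow> sqrt 0" by (rule tendsto_real_sqrt)
      then have "(\<lambda>n. ?g y - w n (x, y)) \<longlonglongrightarrow> 0" by (simp add: tendsto_rabs_zero_iff)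
      from tendsto_diff[OF tendsto_const[of "?g y"] this] have "(\<lambda>n. w n (x, y)) \<longlonglongrightarrow> ?g y" by simp
      then show ?case unfolding W_def by (rule limI)
    qed
  qed
  with W_meas show ?thesis by (rule that)
qed

end

lemma sets_variation_measure [simp]: "sets (variation_measure \<gamma> D) = sets borel"
  by (simp add: variation_measure_def sets.sigma_sets_eq[of borel, simplified])

text \<open>The \<open>emeasure\<close> of a \<open>measure_of\<close> is either the given set
  function or zero, and both are finite on \<open>UNIV\<close>.\<close>

lemma finite_variation_measure:
  assumes "total_variation \<gamma> D UNIV < \<infinity>"
  shows "finite_measure (variation_measure \<gamma> D)"
proof (rule finite_measureI)
  have "space (variation_measure \<gamma> D) = UNIV" using sets_eq_imp_space_eq[OF sets_variation_measure] by simp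
  moreover have "emeasure (variation_measure \<gamma> D) UNIV \<noteq> \<infinity>"
    using assms unfolding variation_measure_def emeasure_measure_of_conv by auto
  ultimately show "emeasure (variation_measure \<gamma> D) (space (variation_measure \<gamma> D)) \<noteq> \<infinity>" by simp
qed

text \<open>This is the angle with cosine exp (- t). Written with arcsin, the limit is taken at the
  interior point 0 of the domain and not at the endpoint 1 of arccos.\<close>

lemma angle_at_right_0:
  "filterlim (\<lambda>t::real. arcsin (sqrt (1 - exp (- 2 * t)))) (at_right 0) (at_right 0)"
proof (rule tendsto_imp_filterlim_at_right)
  have "((\<lambda>t::real. sqrt (1 - exp (- 2 * t))) \<longlongrightarrow> sqrt (1 - exp (- 2 * 0))) (at_right 0)"
    by (intro tendsto_intros)
  then have "((\<lambda>t::real. sqrt (1 - exp (- 2 * t))) \<longlongrightarrow> 0) (at_right 0)" by simp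
  from isCont_tendsto_compose[OF isCont_arcsin this]
  show "((\<lambda>t::real. arcsin (sqrt (1 - exp (- 2 * t)))) \<longlongrightarrow> 0) (at_right 0)" by simp
  show "eventually (\<lambda>t::real. 0 < arcsin (sqrt (1 - exp (- 2 * t)))) (at_right 0)"
    using eventually_at_right_less[of "0::real"]
  proof eventually_elim
    case (elim t)
    then have "arcsin 0 < arcsin (sqrt (1 - exp (- 2 * t)))"
      by (intro arcsin_less_arcsin) auto
    then show ?case by simp
  qed
qed

lemma cos_sin_angle:
  fixes t :: real
  assumes "0 < t"
  shows "cos (arcsin (sqrt (1 - exp (- 2 * t)))) = exp (- t)"
    and "sin (arcsin (sqrt (1 - exp (- 2 * t)))) = sqrt (1 - exp (- 2 * t))"
proof -
  have s: "- 1 \<le> sqrt (1 - exp (- 2 * t))" "sqrt (1 - exp (- 2 * t)) \<le> 1"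
    using assms order_trans[OF _ real_sqrt_ge_zero[of "1 - exp (- 2 * t)"], of "-1"] by auto
  show "sin (arcsin (sqrt (1 - exp (- 2 * t)))) = sqrt (1 - exp (- 2 * t))" using s by simp
  have "cos (arcsin (sqrt (1 - exp (- 2 * t)))) = sqrt (exp (- 2 * t))"
    using s assms by (simp add: cos_arcsin)
  also have "\<dots> = sqrt ((exp (- t))\<^sup>2)" by (simp add: exp_double[symmetric])
  finally show "cos (arcsin (sqrt (1 - exp (- 2 * t)))) = exp (- t)" by simp
qed

context centered_gaussian
begin

text \<open>\<open>ibp\<close> is the defining formula of the perimeter measure for the test
  function sin (f + \<theta>) in the direction \<open>cm_shift g\<close>, along which its derivative
  is cov f g cos (f + \<theta>). The polar decomposition gives the scalar measure a density against
  M and so converts the signed integral.\<close>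

lemma gauss_boundary_perimeter:
  assumes per: "finite_perimeter \<gamma> E" and pol: "polar_decomposition \<gamma> (D_chi \<gamma> E) \<nu>"
    and W: "W \<in> borel_measurable borel" and WAE: "\<And>x. AE y in \<gamma>. W (x, y) = hat \<gamma> (\<nu> x) y"
  shows "gauss_boundary \<gamma> E (variation_measure \<gamma> (D_chi \<gamma> E)) W"
proof -
  define D where "D = D_chi \<gamma> E"
  define M where "M = variation_measure \<gamma> D"
  have E: "E \<in> sets borel" using per by (simp add: finite_perimeter_def)
  have D: "is_D_chi \<gamma> E D"
    using per unfolding D_def D_chi_def finite_perimeter_def by (intro someI_ex[of "is_D_chi \<gamma> E"]) blast
  have \<nu>: "\<nu> \<in> measurable borel (cm_borel \<gamma>)" and \<nu>1: "AE x in M. cm_norm \<gamma> (\<nu> x) = 1"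
    and pd: "\<And>B h. B \<in> sets borel \<Longrightarrow> h \<in> CM \<gamma> \<Longrightarrow> cm_inner \<gamma> (D B) h = (LINT x:B|M. cm_inner \<gamma> (\<nu> x) h)"
    using pol unfolding polar_decomposition_def M_def D_def by auto
  have \<nu>CM: "\<nu> x \<in> CM \<gamma>" for x using measurable_space[OF \<nu>, of x] by (simp add: space_cm_borel)
  have sM [simp]: "sets M = sets borel" by (simp add: M_def)
  interpret M: finite_measure M
    unfolding M_def using D by (intro finite_variation_measure) (simp add: is_D_chi_def)
  have Wsl: "(\<lambda>y. W (x, y)) \<in> borel_measurable borel" for x
    by (rule measurable_compose[OF _ W]) (intro borel_measurable_continuous_onI continuous_intros)
  have Wcl: "(\<lambda>y. W (x, y)) \<in> L2_dual_closure \<gamma>" for x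
    by (rule L2_dual_closure_cong[OF CM_hat(1)[OF \<nu>CM] Wsl WAE])
  have hm: "hat \<gamma> h \<in> borel_measurable borel" if "h \<in> CM \<gamma>" for h
    using CM_hat(2)[OF that] by (rule L2_measurable)
  have Wn: "(LINT y|\<gamma>. (W (x, y))\<^sup>2) = (cm_norm \<gamma> (\<nu> x))\<^sup>2" for x
  proof -
    have "(LINT y|\<gamma>. (W (x, y))\<^sup>2) = (LINT y|\<gamma>. (hat \<gamma> (\<nu> x) y)\<^sup>2)"
      using WAE[of x] Wsl hm[OF \<nu>CM] by (intro integral_cong_AE) auto
    then show ?thesis by (simp add: cm_norm_def)
  qed
  have W1: "AE x in M. (LINT y|\<gamma>. (W (x, y))\<^sup>2) = 1" using \<nu>1 by eventually_elim (simp add: Wn)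
  have ibp: "cov f g * (LINT x|\<gamma>. indicat_real E x * cos (f x + \<theta>)) =
      - (LINT x|M. sin (f x + \<theta>) * (LINT y|\<gamma>. W (x, y) * g y))
      + (LINT x|\<gamma>. indicat_real E x * (sin (f x + \<theta>) * g x))" for f g :: "'a \<Rightarrow>\<^sub>L real" and \<theta> :: real
  proof -
    define w where "w x = cm_inner \<gamma> (\<nu> x) (cm_shift g)" for x
    have w: "w x = (LINT y|\<gamma>. W (x, y) * g y)" for x
    proof -
      have "AE y in \<gamma>. hat \<gamma> (\<nu> x) y * hat \<gamma> (cm_shift g) y = W (x, y) * g y"
        using WAE[of x] hat_cm_shift[of g] by eventually_elim simp
      then show ?thesis
        unfolding w_def cm_inner_def using Wsl hm[OF \<nu>CM] hm[OF cm_shift_CM]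
        by (intro integral_cong_AE) auto
    qed
    have "(\<lambda>p. W p * g (snd p)) \<in> borel_measurable borel" using W by measurable
    from borel_measurable_partial_integral[OF this] have wm: "w \<in> borel_measurable borel"
      by (simp add: w[abs_def])
    have "AE x in M. \<bar>w x\<bar> \<le> sqrt (cov g g)"
      using W1
    proof eventually_elim
      case (elim x)
      then have "(w x)\<^sup>2 \<le> cov g g"
        using L2_Cauchy_Schwarz[OF L2_dual_closureD(1)[OF Wcl] L2_blinfun, of x g]
        by (simp add: w cov_def power2_eq_square)
      then show ?case by (simp add: real_le_rsqrt)
    qed
    then have wi: "integrable M w"
      using wm by (intro M.integrable_const_bound[of _ "sqrt (cov g g)"])
        (auto simp: measurable_cong_sets[OF sM refl])
    have \<phi>: "(\<lambda>x. sin (f x + \<theta>)) \<in> borel_measurable borel" by measurable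
    have si: "signed_integral (\<lambda>B. cm_inner \<gamma> (D B) (cm_shift g)) (\<lambda>x. sin (f x + \<theta>)) = (LINT x|M. sin (f x + \<theta>) * w x)"
      by (rule signed_integral_density[OF sM wi _ \<phi>, of _ 1]) (auto simp: pd cm_shift_CM w_def)
    have "(LINT x:E|\<gamma>. dir_deriv (cm_shift g) (\<lambda>x. sin (f x + \<theta>)) x) =
        - (LINT x|M. sin (f x + \<theta>) * w x) + (LINT x:E|\<gamma>. sin (f x + \<theta>) * hat \<gamma> (cm_shift g) x)"
      using D sin_C1b[of f \<theta>] cm_shift_CM[of g] unfolding is_D_chi_def si[symmetric] by blast
    moreover have "(LINT x:E|\<gamma>. dir_deriv (cm_shift g) (\<lambda>x. sin (f x + \<theta>)) x) =
        cov f g * (LINT x|\<gamma>. indicat_real E x * cos (f x + \<theta>))"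
      unfolding Bochner_Integration.integral_mult_right_zero[symmetric] set_lebesgue_integral_def
      by (intro Bochner_Integration.integral_cong) (auto simp: dir_deriv_sin blinfun_cm_shift cov_commute[of g])
    moreover have "(LINT x:E|\<gamma>. sin (f x + \<theta>) * hat \<gamma> (cm_shift g) x) =
        (LINT x|\<gamma>. indicat_real E x * (sin (f x + \<theta>) * g x))"
      unfolding set_lebesgue_integral_def real_scaleR_def
      using hat_cm_shift[of g] hm[OF cm_shift_CM[of g]] \<phi> E by (intro integral_cong_AE) auto
    ultimately show ?thesis by (simp add: w)
  qed
  show ?thesis unfolding D_def[symmetric] M_def[symmetric]
    by unfold_locales (use E sM W Wcl W1 ibp M.finite_measure_axioms in auto)
qed

end

theorem theorem1p1:
  fixes \<gamma> :: "'a::{banach, second_countable_topology} measure"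
    and E :: "'a set" and \<nu> :: "'a \<Rightarrow> 'a"
  assumes "gaussian_measure \<gamma>" and "centered \<gamma>" and "nondegenerate \<gamma>"
    and "finite_perimeter \<gamma> E"
    and "polar_decomposition \<gamma> (D_chi \<gamma> E) \<nu>"
  shows "((\<lambda>t::real. \<integral>\<^sup>+x. (\<integral>\<^sup>+y.
            ennreal \<bar>indicat_real E (exp (- t) *\<^sub>R x + sqrt (1 - exp (- 2 * t)) *\<^sub>R y)
                      - indicat_real (halfspace \<gamma> (\<nu> x)) y\<bar> \<partial>\<gamma>)
            \<partial>variation_measure \<gamma> (D_chi \<gamma> E)) \<longlongrightarrow> 0) (at_right 0)"
proof -
  interpret centered_gaussian \<gamma> using assms by unfold_locales
  have "\<nu> \<in> measurable borel (cm_borel \<gamma>)" using assms(5) by (simp add: polar_decomposition_def)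
  then obtain W where W: "W \<in> borel_measurable borel" "\<And>x. AE y in \<gamma>. W (x, y) = hat \<gamma> (\<nu> x) y"
    using measurable_representative by blast
  define M where "M = variation_measure \<gamma> (D_chi \<gamma> E)"
  interpret gauss_boundary \<gamma> E M W
    unfolding M_def by (rule gauss_boundary_perimeter[OF assms(4,5) W])
  define V where "V a p = \<bar>indicat_real E (cos a *\<^sub>R fst p + sin a *\<^sub>R snd p) - indicat_real {p. W p > 0} p\<bar>" for a p
  have Vm: "V a \<in> borel_measurable borel" for a
  proof -
    have "indicat_real {p. W p > 0} \<in> borel_measurable borel" using W(1) by measurable
    moreover have "(\<lambda>p. indicat_real E (cos a *\<^sub>R fst p + sin a *\<^sub>R snd p)) \<in> borel_measurable borel"
      by (rule measurable_compose[OF mix_measurable borel_measurable_indicator[OF E]])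
    ultimately show ?thesis unfolding V_def[abs_def] by measurable
  qed
  \<comment> \<open>For every x, passing from \<open>hat\<close> to W changes the inner integrand on
    a \<gamma>-null set only, and joint measurability of W opens the way to Tonelli.\<close>
  have eq: "(\<integral>\<^sup>+x. (\<integral>\<^sup>+y. ennreal \<bar>indicat_real E (cos a *\<^sub>R x + sin a *\<^sub>R y)
      - indicat_real (halfspace \<gamma> (\<nu> x)) y\<bar> \<partial>\<gamma>) \<partial>M) = ennreal (LINT p|MG. V a p)" for a
  proof -
    have "(\<integral>\<^sup>+x. (\<integral>\<^sup>+y. ennreal \<bar>indicat_real E (cos a *\<^sub>R x + sin a *\<^sub>R y)
        - indicat_real (halfspace \<gamma> (\<nu> x)) y\<bar> \<partial>\<gamma>) \<partial>M) = (\<integral>\<^sup>+x. (\<integral>\<^sup>+y. ennreal (V a (x, y)) \<partial>\<gamma>) \<partial>M)"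
    proof (rule nn_integral_cong, rule nn_integral_cong_AE)
      fix x
      show "AE y in \<gamma>. ennreal \<bar>indicat_real E (cos a *\<^sub>R x + sin a *\<^sub>R y) - indicat_real (halfspace \<gamma> (\<nu> x)) y\<bar>
          = ennreal (V a (x, y))"
        using W(2)[of x] by eventually_elim (simp add: V_def halfspace_def indicator_def)
    qed
    also have "\<dots> = (\<integral>\<^sup>+p. ennreal (V a p) \<partial>MG)" using Vm by (intro nn_integral_fst) simp
    also have "\<dots> = ennreal (LINT p|MG. V a p)"
    proof (rule nn_integral_eq_integral)
      show "integrable MG (V a)"
        using Vm by (intro fMG.integrable_const_bound[of _ 1]) (auto simp: V_def indicator_def)
    qed (simp add: V_def)
    finally show ?thesis .
  qed
  have "((\<lambda>a. ennreal (LINT p|MG. V a p)) \<longlongrightarrow> 0) (at_right 0)"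
    using tendsto_ennrealI[OF blowup_tendsto] by (simp add: V_def)
  from filterlim_compose[OF this angle_at_right_0]
  have "((\<lambda>t. ennreal (LINT p|MG. V (arcsin (sqrt (1 - exp (- 2 * t)))) p)) \<longlongrightarrow> 0) (at_right 0)" .
  then show ?thesis
  proof (rule Lim_transform_eventually)
    show "\<forall>\<^sub>F t in at_right 0. ennreal (LINT p|MG. V (arcsin (sqrt (1 - exp (- 2 * t)))) p)
        = (\<integral>\<^sup>+x. (\<integral>\<^sup>+y. ennreal \<bar>indicat_real E (exp (- t) *\<^sub>R x + sqrt (1 - exp (- 2 * t)) *\<^sub>R y)
            - indicat_real (halfspace \<gamma> (\<nu> x)) y\<bar> \<partial>\<gamma>) \<partial>variation_measure \<gamma> (D_chi \<gamma> E))"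
      using eventually_at_right_less[of "0::real"]
    proof eventually_elim
      case (elim t)
      show ?case using eq[of "arcsin (sqrt (1 - exp (- 2 * t)))"]
        by (simp only: cos_sin_angle[OF elim] M_def)
    qed
  qed
qed

end
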